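(* Let $\gamma\in(0,1/2)$ and $\delta>0$, and suppose that $(Z_t)_{t\ge0}$ is a (non-negative) solution to $$dZ_t=\delta\,dt+Z_t^\gamma\,dB_t$$ with $Z_0=0$, where $B$ is a standard Brownian motion. Then for any $T>0$, $\mathrm{Leb}(\{t\in[0,T]:Z_t=0\})>0$ almost surely.
   Context: A non-negative solution means a continuous, non-negative process $Z$ adapted to a filtration with respect to which $B$ is a Brownian motion (on some filtered probability space) such that a.s. $Z_t=\delta t+\int_0^tZ_s^\gamma\,dB_s$ for all $t\ge0$. $\mathrm{Leb}$ is one-dimensional Lebesgue measure. *)

theory Defs
  imports "HOL-Probability.Probability"
begin

text \<open>Processes are functions from time and sample point to the reals. Time is \<^typ>\<open>real\<close>, but only
  times \<open>t \<ge> 0\<close> are constrained. A filtration on \<open>[0,\<infinity>)\<close> is regarded as one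
  indexed by all reals via \<open>F t = F 0\<close> for \<open>t < 0\<close>. The usual conditions are not assumed.\<close>

locale filtered_prob_space = prob_space M + filtration "space M" F
  for M :: "'a measure" and F :: "real \<Rightarrow> 'a measure" +
  assumes filtration_subalgebra: "subalgebra M (F t)"

definition adapted_process :: "(real \<Rightarrow> 'a measure) \<Rightarrow> (real \<Rightarrow> 'a \<Rightarrow> real) \<Rightarrow> bool" where
  "adapted_process F X \<longleftrightarrow> (\<forall>t\<ge>0. X t \<in> borel_measurable (F t))"

definition standard_brownian_motion ::
  "'a measure \<Rightarrow> (real \<Rightarrow> 'a measure) \<Rightarrow> (real \<Rightarrow> 'a \<Rightarrow> real) \<Rightarrow> bool" where
  "standard_brownian_motion M F B \<longleftrightarrow>
     adapted_process F B \<and>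
     (AE \<omega> in M. B 0 \<omega> = 0) \<and>
     (AE \<omega> in M. continuous_on {0..} (\<lambda>t. B t \<omega>)) \<and>
     (\<forall>s t. 0 \<le> s \<and> s < t \<longrightarrow>
        distributed M lborel (\<lambda>\<omega>. B t \<omega> - B s \<omega>) (normal_density 0 (sqrt (t - s))) \<and>
        prob_space.indep_set M (sets (F s))
          {(\<lambda>\<omega>. B t \<omega> - B s \<omega>) -` A \<inter> space M | A. A \<in> sets borel})"

text \<open>A simple process is given by its number \<open>n\<close> of steps, its grid points
  \<open>0 \<le> \<tau> 0 \<le> \<dots> \<le> \<tau> n\<close>, and its bounded, \<open>F (\<tau> i)\<close>-measurable values
  \<open>\<xi> i\<close> on the intervals \<open>(\<tau> i, \<tau> (i + 1)]\<close>.\<close>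

type_synonym 'a step_data = "nat \<times> (nat \<Rightarrow> real) \<times> (nat \<Rightarrow> 'a \<Rightarrow> real)"

definition simple_process :: "'a measure \<Rightarrow> (real \<Rightarrow> 'a measure) \<Rightarrow> 'a step_data \<Rightarrow> bool" where
  "simple_process M F = (\<lambda>(n, \<tau>, \<xi>).
     0 \<le> \<tau> 0 \<and>
     (\<forall>i<n. \<tau> i \<le> \<tau> (Suc i) \<and> \<xi> i \<in> borel_measurable (F (\<tau> i)) \<and>
            (\<exists>C. \<forall>\<omega>\<in>space M. \<bar>\<xi> i \<omega>\<bar> \<le> C)))"

definition simple_value :: "'a step_data \<Rightarrow> real \<Rightarrow> 'a \<Rightarrow> real" where
  "simple_value = (\<lambda>(n, \<tau>, \<xi>) t \<omega>. \<Sum>i<n. \<xi> i \<omega> * indicator {\<tau> i<..\<tau> (Suc i)} t)"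

definition simple_integral :: "(real \<Rightarrow> 'a \<Rightarrow> real) \<Rightarrow> 'a step_data \<Rightarrow> real \<Rightarrow> 'a \<Rightarrow> real" where
  "simple_integral B = (\<lambda>(n, \<tau>, \<xi>) t \<omega>.
     \<Sum>i<n. \<xi> i \<omega> * (B (min t (\<tau> (Suc i))) \<omega> - B (min t (\<tau> i)) \<omega>))"

definition progressively_measurable ::
  "(real \<Rightarrow> 'a measure) \<Rightarrow> (real \<Rightarrow> 'a \<Rightarrow> real) \<Rightarrow> bool" where
  "progressively_measurable F H \<longleftrightarrow>
     (\<forall>T\<ge>0. (\<lambda>(t, \<omega>). H t \<omega>) \<in> borel_measurable (restrict_space borel {0..T} \<Otimes>\<^sub>M F T))"

text \<open>\<open>I\<close> is (a version, with almost surely continuous paths, of) the Ito integral process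
  \<open>\<integral>\<^sub>0\<^sup>t H\<^sub>s dB\<^sub>s\<close>, for a progressively measurable integrand \<open>H\<close> with almost surely
  locally square integrable paths: it is the limit in probability of the elementary integrals of
  simple processes \<open>S k\<close> such that \<open>\<integral>\<^sub>0\<^sup>T (S k - H)\<^sup>2 ds\<close> tends to 0 in probability for every
  \<open>T\<close>. By the Ito isometry and localisation, such \<open>S\<close> exist and the limit does not depend on the
  choice of \<open>S\<close>. As the filtration need not be complete, \<open>I t\<close> is only required to be
  \<open>M\<close>-measurable. The nonnegative integral is used for the squared distance, so that a divergent
  integral is infinite rather than 0.\<close>

definition ito_integral ::
  "'a measure \<Rightarrow> (real \<Rightarrow> 'a measure) \<Rightarrow> (real \<Rightarrow> 'a \<Rightarrow> real) \<Rightarrow> (real \<Rightarrow> 'a \<Rightarrow> real)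
     \<Rightarrow> (real \<Rightarrow> 'a \<Rightarrow> real) \<Rightarrow> bool" where
  "ito_integral M F B H I \<longleftrightarrow>
     progressively_measurable F H \<and>
     (AE \<omega> in M. \<forall>T\<ge>0. (\<integral>\<^sup>+ t\<in>{0..T}. ennreal ((H t \<omega>)\<^sup>2) \<partial>lborel) < \<infinity>) \<and>
     (\<forall>t\<ge>0. I t \<in> borel_measurable M) \<and>
     (AE \<omega> in M. continuous_on {0..} (\<lambda>t. I t \<omega>)) \<and>
     (\<exists>S :: nat \<Rightarrow> 'a step_data.
        (\<forall>k. simple_process M F (S k)) \<and>
        (\<forall>T\<ge>0. \<forall>\<epsilon>>0. (\<lambda>k. measure M {\<omega>\<in>space M.
            (\<integral>\<^sup>+ t\<in>{0..T}. ennreal ((simple_value (S k) t \<omega> - H t \<omega>)\<^sup>2) \<partial>lborel) > ennreal \<epsilon>})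
            \<longlonglongrightarrow> 0) \<and>
        (\<forall>T\<ge>0. \<forall>\<epsilon>>0. (\<lambda>k. measure M {\<omega>\<in>space M.
            \<bar>simple_integral B (S k) T \<omega> - I T \<omega>\<bar> > \<epsilon>})
            \<longlonglongrightarrow> 0))"

definition nonneg_solution ::
  "'a measure \<Rightarrow> (real \<Rightarrow> 'a measure) \<Rightarrow> (real \<Rightarrow> 'a \<Rightarrow> real) \<Rightarrow> real \<Rightarrow> real
     \<Rightarrow> (real \<Rightarrow> 'a \<Rightarrow> real) \<Rightarrow> bool" where
  "nonneg_solution M F B \<delta> \<gamma> Z \<longleftrightarrow>
     adapted_process F Z \<and>
     (\<forall>\<omega>\<in>space M. continuous_on {0..} (\<lambda>t. Z t \<omega>) \<and> (\<forall>t\<ge>0. Z t \<omega> \<ge> 0)) \<and>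
     (\<exists>I. ito_integral M F B (\<lambda>t \<omega>. Z t \<omega> powr \<gamma>) I \<and>
          (AE \<omega> in M. \<forall>t\<ge>0. Z t \<omega> = \<delta> * t + I t \<omega>))"

end

theory Submission
  imports Defs
begin

text \<open>Let \<open>s\<close> be the scale function of the process off 0, so \<open>s' z = exp (- 2 \<delta> / (1 - 2\<gamma>) * z powr (1 - 2\<gamma>))\<close>,
  which is finite and positive at 0 because \<open>\<gamma> < 1/2\<close>. As \<open>s 0 = 0\<close> and \<open>s' 0 = 1\<close>, the process
  \<open>Y = s Z\<close> is a nonnegative local martingale plus \<open>\<delta> A\<close>, where \<open>A t\<close> is the time spent by \<open>Z\<close>
  at 0 up to \<open>t\<close>. Since \<open>Y = 0\<close> on the support of \<open>dA\<close>, the expectation of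
  \<open>Y t * exp (- \<theta> A t)\<close> is at most \<open>\<delta> / \<theta>\<close>, and \<open>\<theta> \<rightarrow> \<infinity>\<close> gives \<open>Z t = 0\<close>
  almost surely on \<open>{A t = 0}\<close>. Applied to all rational \<open>t\<close>, this shows that on \<open>{A T = 0}\<close> the
  path vanishes on \<open>[0, T]\<close>, which contradicts \<open>A T = 0\<close>.

  No stochastic calculus is needed beyond the definition of the integral. The function \<open>s\<close> is
  replaced by nonnegative functions \<open>f\<close> with bounded Lipschitz second derivative, and \<open>A\<close> by
  \<open>\<integral> g (Z s) ds\<close> with \<open>g\<close> continuous. For the approximating simple
  integrals, the Ito inequality follows from a second order Taylor expansion over short time
  steps. An extra factor \<open>exp (- \<integral> H\<^sup>2 ds)\<close>, where \<open>H\<close> is the integrand, makes the second order term bounded,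
  so that the limit can be taken without localisation.\<close>

section \<open>Test functions\<close>

text \<open>The bound \<open>\<delta> / \<theta>\<close> comes from the product rule: the drift of
  \<open>Y * exp (- \<theta> * A)\<close> is
  \<open>exp (- \<theta> * A) * (\<delta> - \<theta> * Y) dA\<close>. Where \<open>Y = 0\<close>
  only \<open>\<delta> * exp (- \<theta> * A) dA\<close> remains, an exact differential of total
  mass at most \<open>\<delta> / \<theta>\<close>. The scale function itself cannot be expanded to
  second order, because its second derivative blows up like \<open>z powr (- 2 * \<gamma>)\<close>
  at 0, a point that matters here. The regularisation is therefore designed to keep the computation
  as an inequality: its generator along the solution is exactly \<open>\<delta> * f' z * g z\<close>
  with \<open>0 \<le> g \<le> 1\<close> and \<open>g 0 = 1\<close>, and the killing rate is \<theta>
  times this same \<open>g\<close>; the term \<open>- \<theta> * g * f\<close> has a sign and is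
  dropped. The extra factor works by the same mechanism: with \<open>Q\<close> the integral of the
  squared integrand, the second order term contributes at most a multiple of the integral of
  \<open>exp (- Q) dQ\<close>, which is at most 1 however large the integrand is. Both weights stay
  strictly positive, so nothing is lost when the path is finally shown to be at 0. The
  regularisation is removed first, and only then does \<theta> tend to infinity.\<close>

locale test_function =
  fixes f f' f'' :: "real \<Rightarrow> real" and L :: real
  assumes deriv1: "\<And>x. (f has_real_derivative f' x) (at x)"
    and deriv2: "\<And>x. (f' has_real_derivative f'' x) (at x)"
    and nonneg: "\<And>x. 0 \<le> f x"
    and deriv1_bound: "\<And>x. \<bar>f' x\<bar> \<le> 1"
    and deriv2_bound: "\<And>x. \<bar>f'' x\<bar> \<le> L"
    and deriv2_Lipschitz: "\<And>x y. \<bar>f'' x - f'' y\<bar> \<le> L * \<bar>x - y\<bar>"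
begin

lemma L_nonneg: "0 \<le> L"
  using deriv2_bound[of 0] by linarith

lemma Lipschitz: "\<bar>f x - f y\<bar> \<le> \<bar>x - y\<bar>"
  using field_differentiable_bound[of UNIV f f' 1 x y] deriv1 deriv1_bound by simp

lemma deriv1_Lipschitz: "\<bar>f' x - f' y\<bar> \<le> L * \<bar>x - y\<bar>"
  using field_differentiable_bound[of UNIV f' f'' L x y] deriv2 deriv2_bound by simp

lemma continuous: "continuous_on UNIV f" "continuous_on UNIV f'" "continuous_on UNIV f''"
proof -
  show "continuous_on UNIV f" using deriv1 DERIV_continuous_on by blast
  show "continuous_on UNIV f'" using deriv2 DERIV_continuous_on by blast
  have "L-lipschitz_on UNIV f''"
    using deriv2_Lipschitz L_nonneg by (intro lipschitz_onI) (auto simp: dist_real_def)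
  then show "continuous_on UNIV f''" by (rule lipschitz_on_continuous_on)
qed

lemma measurable [measurable]: 
  "f \<in> borel_measurable borel" "f' \<in> borel_measurable borel" "f'' \<in> borel_measurable borel"
  using continuous by (auto intro: borel_measurable_continuous_onI)

lemma linear_growth: "\<bar>f x\<bar> \<le> f 0 + \<bar>x\<bar>"
  using Lipschitz[of x 0] nonneg[of 0] by simp

text \<open>The mean value inequality, applied first to \<open>f'\<close> and then to
  \<open>f\<close>, replaces the integral form of the remainder. The constant is not optimal; after
  taking expectations the term is an error of order 3/2 in the step length.\<close>

lemma Taylor: "\<bar>f (x + y) - f x - f' x * y - f'' x / 2 * y\<^sup>2\<bar> \<le> L * \<bar>y\<bar> ^ 3"
proof -
  let ?S = "closed_segment 0 y"
  have S: "\<bar>s\<bar> \<le> \<bar>y\<bar>" if "s \<in> ?S" for s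
    using that by (auto simp: closed_segment_eq_real_ivl split: if_splits)
  have 1: "\<bar>f' (x + s) - f' x - f'' x * s\<bar> \<le> L * \<bar>y\<bar> * \<bar>s\<bar>" if "s \<in> ?S" for s
  proof -
    have "norm ((f' (x + s) - f'' x * s) - (f' (x + 0) - f'' x * 0)) \<le> L * \<bar>y\<bar> * norm (s - 0)"
    proof (rule field_differentiable_bound[where S = ?S and f' = "\<lambda>s. f'' (x + s) - f'' x"])
      fix z assume "z \<in> ?S"
      show "((\<lambda>s. f' (x + s) - f'' x * s) has_field_derivative f'' (x + z) - f'' x) (at z within ?S)"
        by (rule has_field_derivative_at_within)
          (rule derivative_eq_intros DERIV_chain2[OF deriv2] refl | simp)+
      show "norm (f'' (x + z) - f'' x) \<le> L * \<bar>y\<bar>"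
        using deriv2_Lipschitz[of "x + z" x] mult_left_mono[OF S[OF \<open>z \<in> ?S\<close>] L_nonneg] by auto
    qed (use that in auto)
    then show ?thesis by (simp add: algebra_simps)
  qed
  have "norm ((f (x + y) - f' x * y - f'' x / 2 * y\<^sup>2) - (f (x + 0) - f' x * 0 - f'' x / 2 * 0\<^sup>2))
      \<le> L * \<bar>y\<bar> * \<bar>y\<bar> * norm (y - 0)"
  proof (rule field_differentiable_bound[where S = ?S and f' = "\<lambda>s. f' (x + s) - f' x - f'' x * s"])
    fix z assume "z \<in> ?S"
    show "((\<lambda>s. f (x + s) - f' x * s - f'' x / 2 * s\<^sup>2) has_field_derivative
        f' (x + z) - f' x - f'' x * z) (at z within ?S)"
      by (rule has_field_derivative_at_within)
        (rule derivative_eq_intros DERIV_chain2[OF deriv1] refl | simp)+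
    show "norm (f' (x + z) - f' x - f'' x * z) \<le> L * \<bar>y\<bar> * \<bar>y\<bar>"
      using 1[OF \<open>z \<in> ?S\<close>] mult_left_mono[OF S[OF \<open>z \<in> ?S\<close>], of "L * \<bar>y\<bar>"] L_nonneg by auto
  qed auto
  then show ?thesis by (simp add: power3_eq_cube algebra_simps)
qed

end

text \<open>Only upper bounds on the increments of \<open>\<phi>\<close> are available, so a
  partition argument takes the place of the fundamental theorem. An error of order 3/2 in the step
  length disappears under refinement.\<close>

lemma increment_le_integral:
  fixes \<phi> e :: "real \<Rightarrow> real"
  assumes "a \<le> b" and cont: "continuous_on {a..b} e" and "0 \<le> K"
    and step: "\<And>u v. a \<le> u \<Longrightarrow> u < v \<Longrightarrow> v \<le> b \<Longrightarrow> v - u \<le> 1 \<Longrightarrow>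
      \<phi> v - \<phi> u \<le> (v - u) * e u + K * (v - u) * sqrt (v - u)"
  shows "\<phi> b - \<phi> a \<le> integral {a..b} e"
proof (rule field_le_epsilon)
  fix \<epsilon> :: real assume "0 < \<epsilon>"
  \<comment> \<open>The bound \<open>\<epsilon>\<close> is shared equally by the oscillation of
    \<open>e\<close> and the error term; the 1 covers the case \<open>a = b\<close>.\<close>
  define \<eta> where "\<eta> = \<epsilon> / (2 * (b - a + 1))"
  have \<eta>: "0 < \<eta>" "2 * \<eta> * (b - a) \<le> \<epsilon>"
    using \<open>0 < \<epsilon>\<close> \<open>a \<le> b\<close> by (auto simp: \<eta>_def field_simps)
  have "uniformly_continuous_on {a..b} e"
    by (intro compact_uniformly_continuous cont) auto
  then obtain d1 where d1: "0 < d1" "\<And>x x'. x \<in> {a..b} \<Longrightarrow> x' \<in> {a..b} \<Longrightarrow> dist x' x < d1 \<Longrightarrow> dist (e x') (e x) < \<eta>"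
    unfolding uniformly_continuous_on_def using \<eta> by metis
  \<comment> \<open>The entries ensure, in this order, oscillation of \<open>e\<close> below
    \<open>\<eta>\<close>, a step to which the hypothesis applies, and
    \<open>K * sqrt (v - u) \<le> \<eta>\<close>.\<close>
  define d where "d = Min {d1, 1, (\<eta> / (K + 1))\<^sup>2}"
  have d: "0 < d" "d \<le> d1" "d \<le> 1" "d \<le> (\<eta> / (K + 1))\<^sup>2"
    using d1 \<eta> \<open>0 \<le> K\<close> by (auto simp: d_def)
  have int: "e integrable_on {u..v}" if "a \<le> u" "v \<le> b" for u v
    using that by (intro integrable_continuous_real continuous_on_subset[OF cont]) auto
  have small: "\<phi> v - \<phi> u \<le> integral {u..v} e + 2 * \<eta> * (v - u)"
    if "a \<le> u" "u < v" "v \<le> b" "v - u < d" for u v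
  proof -
    have "integral {u..v} (\<lambda>_. e u - \<eta>) \<le> integral {u..v} e"
    proof (rule integral_le)
      fix x assume x: "x \<in> {u..v}"
      then have "dist (e x) (e u) < \<eta>"
        using that d by (intro d1(2)) (auto simp: dist_real_def)
      then show "e u - \<eta> \<le> e x" by (auto simp: dist_real_def)
    qed (use that int in auto)
    then have 1: "(v - u) * e u \<le> integral {u..v} e + \<eta> * (v - u)"
      using that by (simp add: algebra_simps)
    have "sqrt (v - u) \<le> \<eta> / (K + 1)"
      using that d \<eta> \<open>0 \<le> K\<close> by (intro real_le_lsqrt) auto
    then have "K * sqrt (v - u) \<le> (K + 1) * (\<eta> / (K + 1))"
      using that \<open>0 \<le> K\<close> by (intro mult_mono) auto
    then have "K * sqrt (v - u) \<le> \<eta>" using \<open>0 \<le> K\<close> by simp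
    then have "K * (v - u) * sqrt (v - u) \<le> \<eta> * (v - u)"
      using that mult_right_mono[of "K * sqrt (v - u)" \<eta> "v - u"] by (simp add: mult_ac)
    with 1 step[of u v] that d show ?thesis by linarith
  qed
  have chain: "\<phi> v - \<phi> a \<le> integral {a..v} e + 2 * \<eta> * (v - a)"
    if "a \<le> v" "v \<le> b" "v - a \<le> real n * (d / 2)" for n v
    using that
  proof (induction n arbitrary: v)
    case 0
    then show ?case by simp
  next
    case (Suc n)
    \<comment> \<open>Steps of length \<open>d / 2\<close>, since \<open>small\<close> wants them
      strictly shorter than \<open>d\<close>; the maximum shortens the step that would pass
      \<open>a\<close>.\<close>
    define u where "u = max a (v - d / 2)"
    have "v - d / 2 - a \<le> real n * (d / 2)" "0 \<le> real n * (d / 2)"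
      using Suc.prems d by (auto simp: algebra_simps)
    then have u: "a \<le> u" "u \<le> v" "v - u < d" "u - a \<le> real n * (d / 2)"
      using Suc.prems(1) d(1) unfolding u_def by linarith+
    then have IH: "\<phi> u - \<phi> a \<le> integral {a..u} e + 2 * \<eta> * (u - a)"
      using Suc by auto
    have "\<phi> v - \<phi> u \<le> integral {u..v} e + 2 * \<eta> * (v - u)"
      using small[of u v] u Suc.prems by (cases "u = v") auto
    moreover have "integral {a..u} e + integral {u..v} e = integral {a..v} e"
      using u Suc.prems int by (intro Henstock_Kurzweil_Integration.integral_combine) auto
    ultimately show ?case using IH by (simp add: algebra_simps)
  qed
  obtain n where "b - a \<le> real n * (d / 2)"
    using real_arch_simple[of "(b - a) / (d / 2)"] d by (auto simp: field_simps)
  from chain[OF \<open>a \<le> b\<close> order_refl this] \<eta>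
  show "\<phi> b - \<phi> a \<le> integral {a..b} e + \<epsilon>" by linarith
qed

section \<open>Gluing at 0 and construction of the test functions\<close>

lemma has_real_derivative_If_nonneg:
  fixes f g f' g' :: "real \<Rightarrow> real"
  assumes f: "\<And>x. (f has_real_derivative f' x) (at x)" and g: "\<And>x. (g has_real_derivative g' x) (at x)"
    and "f 0 = g 0" "f' 0 = g' 0"
  shows "((\<lambda>x. if 0 \<le> x then f x else g x) has_real_derivative (if 0 \<le> x then f' x else g' x)) (at x)"
    (is "(?h has_real_derivative _) _")
proof -
  consider "x < 0" | "x > 0" | "x = 0" by linarith
  then show ?thesis
  proof cases
    case 1
    have "(?h has_real_derivative g' x) (at x)"
      using g by (rule has_field_derivative_transform_within_open[of _ _ _ "{..<0}"]) (use 1 in auto)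
    then show ?thesis using 1 by simp
  next
    case 2
    have "(?h has_real_derivative f' x) (at x)"
      using f by (rule has_field_derivative_transform_within_open[of _ _ _ "{0<..}"]) (use 2 in auto)
    then show ?thesis using 2 by simp
  next
    case 3
    have F: "((\<lambda>y. (f y - f 0) / (y - 0)) \<longlongrightarrow> f' 0) (at 0)"
      using f[of 0] by (simp add: has_field_derivative_iff)
    have G: "((\<lambda>y. (g y - g 0) / (y - 0)) \<longlongrightarrow> g' 0) (at 0)"
      using g[of 0] by (simp add: has_field_derivative_iff)
    have "((\<lambda>y. (?h y - ?h 0) / (y - 0)) \<longlongrightarrow> f' 0) (at 0)"
    proof (rule filterlim_split_at)
      show "((\<lambda>y. (?h y - ?h 0) / (y - 0)) \<longlongrightarrow> f' 0) (at_left 0)"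
        using assms(3,4)
        by (intro Lim_transform_eventually[OF tendsto_mono[OF at_le[OF subset_UNIV] G, unfolded assms(4)[symmetric]]])
          (auto simp: eventually_at_left_field intro!: exI[of _ "-1"])
      show "((\<lambda>y. (?h y - ?h 0) / (y - 0)) \<longlongrightarrow> f' 0) (at_right 0)"
        by (intro Lim_transform_eventually[OF tendsto_mono[OF at_le[OF subset_UNIV] F]])
          (auto simp: eventually_at_right_field intro!: exI[of _ "1"])
    qed
    then show ?thesis using 3 by (simp add: has_field_derivative_iff)
  qed
qed

text \<open>For arguments on different sides the difference is routed through 0, where the branches
  agree and where the two distances add up to \<open>\<bar>x - y\<bar>\<close>.\<close>

lemma abs_If_nonneg_diff_le:
  fixes f g :: "real \<Rightarrow> real"
  assumes f: "\<And>x y. \<bar>f x - f y\<bar> \<le> L * \<bar>x - y\<bar>" and g: "\<And>x y. \<bar>g x - g y\<bar> \<le> L * \<bar>x - y\<bar>"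
    and "f 0 = g 0"
  shows "\<bar>(if 0 \<le> x then f x else g x) - (if 0 \<le> y then f y else g y)\<bar> \<le> L * \<bar>x - y\<bar>"
proof -
  have *: "\<bar>f x - g y\<bar> \<le> L * \<bar>x - y\<bar>" if "0 \<le> x" "y < 0" for x y
  proof -
    have "\<bar>f x - g y\<bar> \<le> \<bar>f x - f 0\<bar> + \<bar>g 0 - g y\<bar>" using assms(3) by linarith
    also have "\<dots> \<le> L * \<bar>x - 0\<bar> + L * \<bar>0 - y\<bar>" by (intro add_mono f g)
    also have "\<dots> = L * \<bar>x - y\<bar>" using that by (simp add: algebra_simps)
    finally show ?thesis .
  qed
  show ?thesis
    using f[of x y] g[of x y] *[of x y] *[of y x] by (auto simp: abs_minus_commute)
qed

text \<open>On \<open>[0,\<infinity>)\<close>, \<open>f'\<close> is a regularisation of the density of the scale function, in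
  which the singular factor \<open>z powr (-2\<gamma>)\<close> is replaced by \<open>z * (z\<^sup>2 + \<epsilon>\<^sup>2) powr (-1/2-\<gamma>)\<close>; it vanishes
  at 0, so that \<open>f''\<close> extends continuously to the left. The arctangent on the left keeps \<open>f\<close>
  nonnegative, because the approximations of \<open>Z\<close> may become negative.\<close>

lemma test_function_exists:
  fixes \<gamma> \<delta> \<epsilon> :: real
  assumes \<gamma>: "0 < \<gamma>" "\<gamma> < 1/2" and \<delta>: "0 < \<delta>" and \<epsilon>: "0 < \<epsilon>" "\<epsilon> \<le> 1"
  obtains f f' f'' L where "test_function f f' f'' L" "f 0 = \<epsilon> * pi / 2"
    "\<And>z. 0 \<le> z \<Longrightarrow> z * exp (- (\<delta> / (1/2 - \<gamma>)) * (z\<^sup>2 + 1) powr (1/2 - \<gamma>)) \<le> f z"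
    "\<And>z. 0 \<le> z \<Longrightarrow> \<delta> * f' z + f'' z / 2 * (z powr \<gamma>)\<^sup>2 = \<delta> * f' z * (1 - (z\<^sup>2 / (z\<^sup>2 + \<epsilon>\<^sup>2)) powr (1/2 + \<gamma>))"
proof -
  define \<alpha> where "\<alpha> = 1/2 + \<gamma>"
  define \<beta> where "\<beta> = 1/2 - \<gamma>"
  define n where "n x = x\<^sup>2 + \<epsilon>\<^sup>2" for x :: real
  \<comment> \<open>\<open>A\<close> is minus the logarithm of the regularised scale density,
    normalised by \<open>A 0 = 0\<close>. Its derivative is \<open>A'\<close> because
    \<open>\<beta> - 1 = - \<alpha>\<close>; for \<open>x > 0\<close> this tends to the singular
    \<open>2 * \<delta> * x powr (- 2 * \<gamma>)\<close> as \<epsilon> tends to 0.\<close>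
  define A where "A x = \<delta> / \<beta> * (n x powr \<beta> - (\<epsilon>\<^sup>2) powr \<beta>)" for x
  define A' where "A' x = 2 * \<delta> * x * n x powr (- \<alpha>)" for x
  define A'' where "A'' x = 2 * \<delta> * (n x powr (- \<alpha>) - 2 * \<alpha> * x\<^sup>2 * n x powr (- \<alpha> - 1))" for x
  have n: "0 < n x" "\<epsilon>\<^sup>2 \<le> n x" "x\<^sup>2 \<le> n x" for x
    using \<epsilon> by (auto simp: n_def intro!: add_nonneg_pos)
  have \<alpha>\<beta>: "1/2 < \<alpha>" "\<alpha> < 1" "0 < \<beta>" "\<beta> < 1/2" "\<beta> - 1 = - \<alpha>"
    using \<gamma> by (auto simp: \<alpha>_def \<beta>_def)
  have dn: "(n has_real_derivative 2 * x) (at x)" for x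
    unfolding n_def by (auto intro!: derivative_eq_intros)
  have dpow: "((\<lambda>x. n x powr c) has_real_derivative c * n x powr (c - 1) * (2 * x)) (at x)" for c x
    using n by (auto intro!: derivative_eq_intros DERIV_fun_powr[OF dn, THEN DERIV_cong] simp: powr_diff)
  have dA: "(A has_real_derivative A' x) (at x)" for x
    unfolding A_def A'_def using \<alpha>\<beta> by (auto intro!: derivative_eq_intros dpow[THEN DERIV_cong])
  have dA': "(A' has_real_derivative A'' x) (at x)" for x
    unfolding A'_def A''_def
    by (auto intro!: derivative_eq_intros dpow[THEN DERIV_cong] simp: algebra_simps power2_eq_square)
  \<comment> \<open>Bounds for \<open>A'\<close> and \<open>A''\<close>. They blow up as \<epsilon>
    tends to 0, which is harmless: they enter \<open>L\<close>, and the final estimate does not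
    contain \<open>L\<close>.\<close>
  define a where "a = 2 * \<delta> * (\<epsilon>\<^sup>2) powr (1/2 - \<alpha>)"
  define b where "b = 6 * \<delta> * (\<epsilon>\<^sup>2) powr (- \<alpha>)"
  have a: "\<bar>A' x\<bar> \<le> a" for x
  proof -
    have "\<bar>x\<bar> \<le> n x powr (1/2)"
      using n[of x] by (simp add: powr_half_sqrt real_le_rsqrt)
    then have "\<bar>x\<bar> * n x powr (- \<alpha>) \<le> n x powr (1/2) * n x powr (- \<alpha>)"
      by (intro mult_right_mono) auto
    also have "\<dots> = n x powr (1/2 - \<alpha>)" by (simp add: powr_add[symmetric])
    also have "\<dots> \<le> (\<epsilon>\<^sup>2) powr (1/2 - \<alpha>)"
      using n[of x] \<alpha>\<beta> \<epsilon> by (intro powr_mono2') auto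
    finally show ?thesis using \<delta> by (auto simp: A'_def a_def abs_mult)
  qed
  have b: "\<bar>A'' x\<bar> \<le> b" for x
  proof -
    have 1: "n x powr (- \<alpha>) \<le> (\<epsilon>\<^sup>2) powr (- \<alpha>)"
      using n[of x] \<alpha>\<beta> \<epsilon> by (intro powr_mono2') auto
    have "x\<^sup>2 * n x powr (- \<alpha> - 1) \<le> n x * n x powr (- \<alpha> - 1)"
      using n by (intro mult_right_mono) auto
    also have "\<dots> = n x powr (- \<alpha>)" using n[of x] by (simp add: powr_diff)
    finally have 2: "x\<^sup>2 * n x powr (- \<alpha> - 1) \<le> n x powr (- \<alpha>)" .
    have "2 * \<alpha> * (x\<^sup>2 * n x powr (- \<alpha> - 1)) \<le> 2 * n x powr (- \<alpha>)"
      using \<alpha>\<beta> 2 by (intro mult_mono) auto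
    moreover have "0 \<le> 2 * \<alpha> * (x\<^sup>2 * n x powr (- \<alpha> - 1))" using \<alpha>\<beta> by simp
    moreover have "0 \<le> n x powr (- \<alpha>)" by simp
    ultimately have "\<bar>n x powr (- \<alpha>) - 2 * \<alpha> * (x\<^sup>2 * n x powr (- \<alpha> - 1))\<bar> \<le> 3 * n x powr (- \<alpha>)"
      by (intro abs_leI) linarith+
    also have "\<dots> \<le> 3 * (\<epsilon>\<^sup>2) powr (- \<alpha>)" using 1 by simp
    finally show ?thesis using \<delta> by (simp add: A''_def b_def abs_mult mult_ac)
  qed
  \<comment> \<open>\<open>p\<close>, \<open>r\<close> and \<open>s\<close> stand for the first
    three derivatives of the test function, with index 1 on the right of 0 and index 2 on the left.
    The third ones yield the Lipschitz bound for the second.\<close>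
  define p1 where "p1 x = exp (- A x)" for x
  define r1 where "r1 x = - A' x * p1 x" for x
  define s1 where "s1 x = ((A' x)\<^sup>2 - A'' x) * p1 x" for x
  have dp1: "(p1 has_real_derivative r1 x) (at x)" for x
    unfolding p1_def r1_def by (auto intro!: derivative_eq_intros dA[THEN DERIV_cong])
  have dr1: "(r1 has_real_derivative s1 x) (at x)" for x
    unfolding r1_def s1_def
    by (auto intro!: derivative_eq_intros dA'[THEN DERIV_cong] dp1[THEN DERIV_cong] simp: r1_def power2_eq_square algebra_simps)
  have A_nonneg: "0 \<le> A x" for x
    using n[of x] \<alpha>\<beta> \<delta> \<epsilon> unfolding A_def by (intro mult_nonneg_nonneg) (auto intro!: powr_mono2)
  have p1: "0 < p1 x" "p1 x \<le> 1" for x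
    using A_nonneg by (auto simp: p1_def)
  have r1: "\<bar>r1 x\<bar> \<le> a" for x
    using mult_mono[OF a[of x] p1(2)[of x]] p1[of x] abs_ge_zero[THEN order_trans, OF a[of x]]
    by (auto simp: r1_def abs_mult)
  have s1: "\<bar>s1 x\<bar> \<le> a\<^sup>2 + b" for x
  proof -
    have "(A' x)\<^sup>2 \<le> a\<^sup>2" using a[of x] abs_le_square_iff[of "A' x" a] by auto
    then have "\<bar>(A' x)\<^sup>2 - A'' x\<bar> \<le> a\<^sup>2 + b" using b[of x] zero_le_power2[of "A' x"] by linarith
    then show ?thesis
      using mult_mono[of "\<bar>(A' x)\<^sup>2 - A'' x\<bar>" "a\<^sup>2 + b" "p1 x" 1] p1[of x] by (auto simp: s1_def abs_mult)
  qed
  \<comment> \<open>The derivative of \<open>\<epsilon> * arctan (x / \<epsilon>)\<close>. Like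
    \<open>p1\<close> it has value 1 and slope 0 at 0, so gluing leaves the second derivative
    continuous.\<close>
  define p2 where "p2 x = 1 / (1 + (x / \<epsilon>)\<^sup>2)" for x
  define r2 where "r2 x = - (2 * x / \<epsilon>\<^sup>2) * (p2 x)\<^sup>2" for x
  define s2 where "s2 x = - (2 / \<epsilon>\<^sup>2) * (p2 x)\<^sup>2 + 8 / \<epsilon>\<^sup>2 * ((x / \<epsilon>)\<^sup>2 * p2 x) * (p2 x)\<^sup>2" for x
  have p2: "0 < p2 x" "p2 x \<le> 1" "(x / \<epsilon>)\<^sup>2 * p2 x \<le> 1" "\<bar>x / \<epsilon>\<bar> * p2 x \<le> 1" for x
  proof -
    have q: "1 + (x / \<epsilon>)\<^sup>2 > 0" by (intro add_pos_nonneg) auto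
    show "0 < p2 x" "p2 x \<le> 1" "(x / \<epsilon>)\<^sup>2 * p2 x \<le> 1"
      using q by (auto simp: p2_def divide_le_eq zero_less_divide_iff)
    have "y \<le> 1 + y\<^sup>2" for y :: real
      using zero_le_power2[of "y - 1"] zero_le_power2[of y] unfolding power2_diff one_power2 mult_1_right by linarith
    from this[of "\<bar>x / \<epsilon>\<bar>"] have "\<bar>x / \<epsilon>\<bar> \<le> 1 + (x / \<epsilon>)\<^sup>2"
      by (simp only: power2_abs)
    then have "\<bar>x / \<epsilon>\<bar> * p2 x \<le> (1 + (x / \<epsilon>)\<^sup>2) * p2 x"
      using \<open>0 < p2 x\<close> by (intro mult_right_mono) auto
    also have "\<dots> = 1" using q by (simp add: p2_def)
    finally show "\<bar>x / \<epsilon>\<bar> * p2 x \<le> 1" .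
  qed
  have den: "1 + (x / \<epsilon>)\<^sup>2 \<noteq> 0" for x
    using zero_le_power2[of "x/\<epsilon>"] by linarith
  have dp2: "(p2 has_real_derivative r2 x) (at x)" for x
    unfolding p2_def r2_def using den \<epsilon> 
    by (auto intro!: derivative_eq_intros simp: power2_eq_square)
  have dr2: "(r2 has_real_derivative s2 x) (at x)" for x
  proof -
    have "((\<lambda>x. - (2 * x / \<epsilon>\<^sup>2) * (p2 x)\<^sup>2) has_real_derivative
        - (2 / \<epsilon>\<^sup>2) * (p2 x)\<^sup>2 - (2 * x / \<epsilon>\<^sup>2) * (2 * p2 x * r2 x)) (at x)"
      using \<epsilon> by (auto intro!: derivative_eq_intros dp2[THEN DERIV_cong] simp: field_simps power2_eq_square eval_nat_numeral)
    moreover have "- (2 / \<epsilon>\<^sup>2) * (p2 x)\<^sup>2 - (2 * x / \<epsilon>\<^sup>2) * (2 * p2 x * r2 x) = s2 x"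
      by (simp add: r2_def s2_def power_divide power2_eq_square)
    ultimately show ?thesis unfolding r2_def by simp
  qed
  have r2: "\<bar>r2 x\<bar> \<le> 2 / \<epsilon>" for x
  proof -
    have "\<bar>r2 x\<bar> = 2 / \<epsilon> * (\<bar>x / \<epsilon>\<bar> * p2 x * p2 x)"
      using \<epsilon> p2[of x] by (simp add: r2_def abs_mult power2_eq_square)
    also have "\<dots> \<le> 2 / \<epsilon> * 1"
      using \<epsilon> p2[of x] by (intro mult_left_mono mult_le_one[OF p2(4)]) auto
    finally show ?thesis by simp
  qed
  have s2: "\<bar>s2 x\<bar> \<le> 10 / \<epsilon>\<^sup>2" for x
  proof -
    have q: "0 \<le> (p2 x)\<^sup>2" "(p2 x)\<^sup>2 \<le> 1" using p2[of x] by (auto intro: power_le_one)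
    have "2 / \<epsilon>\<^sup>2 * (p2 x)\<^sup>2 \<le> 2 / \<epsilon>\<^sup>2" using q by (intro mult_left_le) auto
    moreover have "8 / \<epsilon>\<^sup>2 * ((x / \<epsilon>)\<^sup>2 * p2 x * (p2 x)\<^sup>2) \<le> 8 / \<epsilon>\<^sup>2"
      using q p2[of x] by (intro mult_left_le mult_le_one[OF p2(3)]) auto
    moreover have "0 \<le> 8 / \<epsilon>\<^sup>2 * ((x / \<epsilon>)\<^sup>2 * p2 x * (p2 x)\<^sup>2)" "0 \<le> 2 / \<epsilon>\<^sup>2 * (p2 x)\<^sup>2"
      using p2[of x] by (auto intro!: mult_nonneg_nonneg less_imp_le)
    moreover have "s2 x = - (2 / \<epsilon>\<^sup>2 * (p2 x)\<^sup>2) + 8 / \<epsilon>\<^sup>2 * ((x / \<epsilon>)\<^sup>2 * p2 x * (p2 x)\<^sup>2)"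
      by (simp add: s2_def)
    moreover have "10 / \<epsilon>\<^sup>2 = 2 / \<epsilon>\<^sup>2 + 8 / \<epsilon>\<^sup>2" by simp
    moreover have "\<bar>u\<bar> \<le> k" if "w \<le> c" "q \<le> d" "0 \<le> q" "0 \<le> w" "u = - w + q" "k = c + d" for u k w q c d :: real
      using that by linarith
    ultimately show ?thesis by blast
  qed
  obtain P where P: "\<And>x. (P has_real_derivative p1 x) (at x)"
    using einterval_antiderivative[of "-\<infinity>" \<infinity> p1] DERIV_isCont[OF dp1]
    by (auto simp: has_real_derivative_iff_has_vector_derivative)
  \<comment> \<open>The constant \<open>\<epsilon> * pi / 2\<close> is what the arctangent branch
    needs to stay nonnegative on the whole left half-line. It becomes \<open>f 0\<close> and
    vanishes with \<epsilon>.\<close>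
  define f1 where "f1 x = P x - P 0 + \<epsilon> * pi / 2" for x
  define f2 where "f2 x = \<epsilon> * (arctan (x / \<epsilon>) + pi / 2)" for x
  have df1: "(f1 has_real_derivative p1 x) (at x)" for x
    unfolding f1_def by (auto intro!: derivative_eq_intros P[THEN DERIV_cong])
  have df2: "(f2 has_real_derivative p2 x) (at x)" for x
    unfolding f2_def p2_def using \<epsilon> by (auto intro!: derivative_eq_intros simp: inverse_eq_divide)
  define f where "f x = (if 0 \<le> x then f1 x else f2 x)" for x
  define f' where "f' x = (if 0 \<le> x then p1 x else p2 x)" for x
  define f'' where "f'' x = (if 0 \<le> x then r1 x else r2 x)" for x
  define L where "L = max (max a (2 / \<epsilon>)) (max (a\<^sup>2 + b) (10 / \<epsilon>\<^sup>2))"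
  have [simp]: "f1 0 = \<epsilon> * pi / 2" "f2 0 = \<epsilon> * pi / 2" "p1 0 = 1" "p2 0 = 1" "r1 0 = 0" "r2 0 = 0"
    by (simp_all add: f1_def f2_def p1_def A_def n_def p2_def r1_def A'_def r2_def)
  \<comment> \<open>\<open>p1\<close> decreases on the right half-line, so the mean slope of
    \<open>f1\<close> between 0 and \<open>x\<close> is at least \<open>p1 x\<close>.\<close>
  have f1_lower: "x * p1 x + \<epsilon> * pi / 2 \<le> f1 x" if x: "0 \<le> x" for x
  proof (cases "x = 0")
    case False
    then obtain z where z: "0 < z" "z < x" "f1 x - f1 0 = (x - 0) * p1 z"
      using MVT2[of 0 x f1 p1] df1 x by auto
    have "A z \<le> A x"
      unfolding A_def n_def using z \<alpha>\<beta> \<delta> \<epsilon>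
      by (intro mult_left_mono diff_right_mono powr_mono2 add_right_mono power_mono) auto
    then have "x * p1 x \<le> x * p1 z" using that by (intro mult_left_mono) (auto simp: p1_def)
    moreover have "f1 x = x * p1 z + \<epsilon> * pi / 2" using z by simp
    ultimately show ?thesis by linarith
  qed simp
  have "test_function f f' f'' L"
  proof
    show "(f has_real_derivative f' x) (at x)" for x
      unfolding f_def[abs_def] f'_def by (rule has_real_derivative_If_nonneg) (auto intro: df1 df2)
    show "(f' has_real_derivative f'' x) (at x)" for x
      unfolding f'_def[abs_def] f''_def by (rule has_real_derivative_If_nonneg) (auto intro: dp1 dp2)
    show "0 \<le> f x" for x
    proof (cases "0 \<le> x")
      case True
      then have "0 \<le> x * p1 x" using p1[of x] by simp
      moreover have "0 \<le> \<epsilon> * pi / 2" using \<epsilon> by simp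
      ultimately have "0 \<le> f1 x" using f1_lower[OF True] by linarith
      then show ?thesis using True by (simp add: f_def)
    next
      case False
      then show ?thesis using arctan_lbound[of "x / \<epsilon>"] \<epsilon> by (simp add: f_def f2_def)
    qed
    show "\<bar>f' x\<bar> \<le> 1" for x
      using p1[of x] p2[of x] by (simp add: f'_def)
    show "\<bar>f'' x\<bar> \<le> L" for x
      using r1[of x] r2[of x] by (auto simp: f''_def L_def le_max_iff_disj)
    have "\<bar>r1 x - r1 y\<bar> \<le> L * \<bar>x - y\<bar>" for x y
    proof -
      have "\<bar>s1 z\<bar> \<le> L" for z using s1[of z] by (auto simp: L_def le_max_iff_disj)
      then show ?thesis using field_differentiable_bound[of UNIV r1 s1 L x y] dr1 by simp
    qed
    moreover have "\<bar>r2 x - r2 y\<bar> \<le> L * \<bar>x - y\<bar>" for x y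
    proof -
      have "\<bar>s2 z\<bar> \<le> L" for z using s2[of z] by (auto simp: L_def le_max_iff_disj)
      then show ?thesis using field_differentiable_bound[of UNIV r2 s2 L x y] dr2 by simp
    qed
    ultimately show "\<bar>f'' x - f'' y\<bar> \<le> L * \<bar>x - y\<bar>" for x y
      unfolding f''_def by (rule abs_If_nonneg_diff_le) auto
  qed
  moreover have "f 0 = \<epsilon> * pi / 2" by (simp add: f_def)
  moreover have "z * exp (- (\<delta> / (1/2 - \<gamma>)) * (z\<^sup>2 + 1) powr (1/2 - \<gamma>)) \<le> f z" if "0 \<le> z" for z
  proof -
    \<comment> \<open>The assumption \<open>\<epsilon> \<le> 1\<close> enters here: it makes the
      lower bound free of \<epsilon>, so that it survives the limit.\<close>
    have "n z powr \<beta> - \<epsilon>\<^sup>2 powr \<beta> \<le> (z\<^sup>2 + 1) powr \<beta> - 0"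
      unfolding n_def using \<epsilon> \<alpha>\<beta>
      by (intro diff_mono powr_mono2 add_left_mono) (auto intro: power_le_one)
    then have "A z \<le> \<delta> / \<beta> * (z\<^sup>2 + 1) powr \<beta>"
      unfolding A_def using \<delta> \<alpha>\<beta> by (intro mult_left_mono) auto
    then have "exp (- (\<delta> / \<beta>) * (z\<^sup>2 + 1) powr \<beta>) \<le> p1 z" by (simp add: p1_def)
    then have "z * exp (- (\<delta> / \<beta>) * (z\<^sup>2 + 1) powr \<beta>) \<le> z * p1 z"
      using that by (intro mult_left_mono) auto
    moreover have "z * p1 z \<le> f1 z" using f1_lower[OF that] \<epsilon> pi_gt_zero mult_nonneg_nonneg[of \<epsilon> pi] by linarith
    ultimately show ?thesis using that by (simp add: f_def \<beta>_def)
  qed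
  moreover have "\<delta> * f' z + f'' z / 2 * (z powr \<gamma>)\<^sup>2 = \<delta> * f' z * (1 - (z\<^sup>2 / (z\<^sup>2 + \<epsilon>\<^sup>2)) powr (1/2 + \<gamma>))"
    if "0 \<le> z" for z
  proof (cases "z = 0")
    case False
    then have z: "0 < z" using that by simp
    \<comment> \<open>This identity dictates \<open>\<alpha> = 1/2 + \<gamma>\<close>: multiplied by
      the squared diffusion coefficient, \<open>A'\<close> becomes \<open>2 * \<delta>\<close> times
      a power of a quotient in \<open>[0, 1]\<close>, so the second order term is a multiple of the
      drift \<open>\<delta> * f' z\<close>.\<close>
    have "(z\<^sup>2) powr \<alpha> = z powr (1 + 2 * \<gamma>)"
      using z by (simp add: powr_powr \<alpha>_def algebra_simps flip: powr_numeral)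
    also have "\<dots> = z * (z powr \<gamma>)\<^sup>2"
      using z by (simp add: powr_mult_base powr_power)
    finally have "z * (z powr \<gamma>)\<^sup>2 = (z\<^sup>2) powr \<alpha>" ..
    then have "A' z * (z powr \<gamma>)\<^sup>2 = 2 * \<delta> * ((z\<^sup>2) powr \<alpha> * n z powr (-\<alpha>))"
      by (simp add: A'_def mult_ac)
    also have "(z\<^sup>2) powr \<alpha> * n z powr (-\<alpha>) = (z\<^sup>2 / n z) powr \<alpha>"
      using n[of z] z by (simp add: powr_divide powr_minus_divide)
    finally have *: "A' z * (z powr \<gamma>)\<^sup>2 = 2 * \<delta> * (z\<^sup>2 / (z\<^sup>2 + \<epsilon>\<^sup>2)) powr (1/2 + \<gamma>)"
      by (simp add: n_def \<alpha>_def)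
    have "f'' z / 2 * (z powr \<gamma>)\<^sup>2 = - p1 z / 2 * (A' z * (z powr \<gamma>)\<^sup>2)"
      using z by (simp add: f''_def r1_def)
    then show ?thesis
      unfolding * using z by (simp add: f'_def algebra_simps)
  \<comment> \<open>At 0 both sides equal \<open>\<delta>\<close>: the second derivative vanishes
    there, and a power with base 0 is 0 by the convention for \<open>powr\<close>.\<close>
  qed (simp add: f'_def f''_def)
  ultimately show thesis by (rule that)
qed

section \<open>One time step\<close>

context filtered_prob_space
begin

lemma measurable_from_F: "X \<in> measurable (F s) N \<Longrightarrow> X \<in> measurable M N"
  by (rule measurable_from_subalg[OF filtration_subalgebra])

lemma measurable_F_mono:
  assumes "s \<le> t" "X \<in> measurable (F s) N" shows "X \<in> measurable (F t) N"
  by (rule measurable_from_subalg[OF _ assms(2)])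
    (use assms(1) sets_F_mono in \<open>auto simp: subalgebra_def space_F\<close>)

end

locale brownian_filtration = filtered_prob_space M F
  for M :: "'a measure" and F :: "real \<Rightarrow> 'a measure" +
  fixes B :: "real \<Rightarrow> 'a \<Rightarrow> real"
  assumes brownian: "standard_brownian_motion M F B"
begin

lemma B_adapted: "0 \<le> t \<Longrightarrow> B t \<in> borel_measurable (F t)"
  and B_continuous: "AE \<omega> in M. continuous_on {0..} (\<lambda>t. B t \<omega>)"
  and B_increment: "0 \<le> s \<Longrightarrow> s < t \<Longrightarrow>
    distributed M lborel (\<lambda>\<omega>. B t \<omega> - B s \<omega>) (normal_density 0 (sqrt (t - s)))"
  and B_indep: "0 \<le> s \<Longrightarrow> s < t \<Longrightarrow>
    indep_set (sets (F s)) {(\<lambda>\<omega>. B t \<omega> - B s \<omega>) -` A \<inter> space M | A. A \<in> sets borel}"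
  using brownian by (auto simp: standard_brownian_motion_def adapted_process_def)

lemma B_measurable: "0 \<le> t \<Longrightarrow> B t \<in> borel_measurable M"
  using B_adapted measurable_from_F by blast

text \<open>The definition of Brownian motion gives independence of two families of events. Both are
  closed under intersection, so it passes to the generated sigma-algebras, which
  \<open>indep_var\<close> speaks of.\<close>

lemma indep_var_increment:
  assumes "0 \<le> s" "s < t" and U: "U \<in> borel_measurable (F s)"
  shows "indep_var borel U borel (\<lambda>\<omega>. B t \<omega> - B s \<omega>)"
proof -
  let ?\<Delta> = "\<lambda>\<omega>. B t \<omega> - B s \<omega>"
  let ?G = "{?\<Delta> -` A \<inter> space M | A. A \<in> sets borel}"
  have rv: "random_variable borel U" "random_variable borel ?\<Delta>"
    using U B_measurable[of s] B_measurable[of t] assms by (auto intro: measurable_from_F)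
  have "Int_stable (sets (F s))" by (rule sets.Int_stable)
  moreover have "Int_stable ?G"
  proof (rule Int_stableI)
    fix a b assume "a \<in> ?G" "b \<in> ?G"
    then obtain A A' where "a = ?\<Delta> -` A \<inter> space M" "b = ?\<Delta> -` A' \<inter> space M" "A \<in> sets borel" "A' \<in> sets borel"
      by blast
    then show "a \<inter> b \<in> ?G" by (intro CollectI exI[of _ "A \<inter> A'"]) auto
  qed
  ultimately have "indep_set (sigma_sets (space M) (sets (F s))) (sigma_sets (space M) ?G)"
    by (intro indep_set_sigma_sets B_indep assms)
  moreover have "sigma_sets (space M) {U -` A \<inter> space M | A. A \<in> sets borel} \<subseteq> sigma_sets (space M) (sets (F s))"
    using measurable_sets[OF U] by (intro sigma_sets_mono') (auto simp: space_F)
  ultimately have "indep_set (sigma_sets (space M) {U -` A \<inter> space M | A. A \<in> sets borel}) (sigma_sets (space M) ?G)"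
    unfolding indep_set_def by (elim indep_sets_mono_sets) (auto split: bool.split)
  with rv show ?thesis by (simp add: indep_var_eq)
qed

text \<open>This plays the role of conditioning on \<open>F s\<close>: independence splits off the
  increment, and its law turns the second factor into a Gaussian moment.\<close>

lemma expectation_increment:
  assumes st: "0 \<le> s" "s < t" and U: "U \<in> borel_measurable (F s)" "integrable M U"
    and g: "g \<in> borel_measurable borel"
    and c: "has_bochner_integral lborel (\<lambda>x. normal_density 0 (sqrt (t - s)) x * g x) c"
  shows "has_bochner_integral M (\<lambda>\<omega>. U \<omega> * g (B t \<omega> - B s \<omega>)) (expectation U * c)"
proof -
  let ?\<Delta> = "\<lambda>\<omega>. B t \<omega> - B s \<omega>"
  have D: "distributed M lborel ?\<Delta> (normal_density 0 (sqrt (t - s)))"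
    using B_increment st by blast
  have int: "integrable M (\<lambda>\<omega>. g (?\<Delta> \<omega>))"
    using distributed_integrable[OF D, of g] g c by (auto simp: has_bochner_integral_iff)
  have E: "expectation (\<lambda>\<omega>. g (?\<Delta> \<omega>)) = c"
    using distributed_integral[OF D, of g] g c by (auto simp: has_bochner_integral_iff)
  have ind: "indep_var borel U borel (\<lambda>\<omega>. g (?\<Delta> \<omega>))"
    using indep_var_compose[OF indep_var_increment[OF st U(1)], of "\<lambda>x. x" borel g borel] g
    by (simp add: comp_def)
  show ?thesis
    using indep_var_integrable[OF ind U(2) int] indep_var_lebesgue_integral[OF ind U(2) int] E
    by (simp add: has_bochner_integral_iff)
qed

lemma
  assumes st: "0 \<le> s" "s < t"
  shows expectation_increment1: "U \<in> borel_measurable (F s) \<Longrightarrow> integrable M U \<Longrightarrow>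
      has_bochner_integral M (\<lambda>\<omega>. U \<omega> * (B t \<omega> - B s \<omega>)) 0"
    and expectation_increment2: "U \<in> borel_measurable (F s) \<Longrightarrow> integrable M U \<Longrightarrow>
      has_bochner_integral M (\<lambda>\<omega>. U \<omega> * (B t \<omega> - B s \<omega>)\<^sup>2) (expectation U * (t - s))"
    and expectation_increment3:
      "has_bochner_integral M (\<lambda>\<omega>. \<bar>B t \<omega> - B s \<omega>\<bar> ^ 3) (2 * ((t - s) * sqrt (t - s)) * sqrt (2 / pi))"
    and integrable_increment: "integrable M (\<lambda>\<omega>. B t \<omega> - B s \<omega>)"
proof -
  have pos: "0 < sqrt (t - s)" using st by simp
  have 1: "has_bochner_integral lborel (\<lambda>x. normal_density 0 (sqrt (t - s)) x * x) 0"
    using normal_moment_odd[OF pos, of 0 0] by simp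
  have 2: "has_bochner_integral lborel (\<lambda>x. normal_density 0 (sqrt (t - s)) x * x\<^sup>2) (t - s)"
    using normal_moment_even[OF pos, of 0 1] st by (simp add: diff_divide_distrib)
  have 3: "has_bochner_integral lborel (\<lambda>x. normal_density 0 (sqrt (t - s)) x * \<bar>x\<bar> ^ 3)
      (2 * ((t - s) * sqrt (t - s)) * sqrt (2 / pi))"
    using normal_moment_abs_odd[OF pos, of 0 1] st by (simp add: power3_eq_cube)
  show "has_bochner_integral M (\<lambda>\<omega>. U \<omega> * (B t \<omega> - B s \<omega>)) 0"
    if "U \<in> borel_measurable (F s)" "integrable M U"
    using expectation_increment[OF st that _ 1] by simp
  show "has_bochner_integral M (\<lambda>\<omega>. U \<omega> * (B t \<omega> - B s \<omega>)\<^sup>2) (expectation U * (t - s))"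
    if "U \<in> borel_measurable (F s)" "integrable M U"
    using expectation_increment[OF st that _ 2] by simp
  show "has_bochner_integral M (\<lambda>\<omega>. \<bar>B t \<omega> - B s \<omega>\<bar> ^ 3) (2 * ((t - s) * sqrt (t - s)) * sqrt (2 / pi))"
  proof -
    have "has_bochner_integral M (\<lambda>\<omega>. 1 * \<bar>B t \<omega> - B s \<omega>\<bar> ^ 3)
        (expectation (\<lambda>_. 1) * (2 * ((t - s) * sqrt (t - s)) * sqrt (2 / pi)))"
      by (rule expectation_increment[OF st _ _ _ 3]) auto
    then show ?thesis by (simp only: mult_1_left lebesgue_integral_const prob_space scaleR_one)
  qed
  have "has_bochner_integral M (\<lambda>\<omega>. 1 * (B t \<omega> - B s \<omega>)) (expectation (\<lambda>_. 1) * 0)"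
    by (rule expectation_increment[OF st _ _ _ 1]) auto
  then show "integrable M (\<lambda>\<omega>. B t \<omega> - B s \<omega>)"
    by (simp only: mult_1_left has_bochner_integral_iff)
qed

end

locale brownian_test = brownian_filtration M F B + test_function f f' f'' L
  for M :: "'a measure" and F B f f' f'' L +
  fixes \<delta> :: real
  assumes drift_nonneg: "0 \<le> \<delta>"
begin

definition generator :: "real \<Rightarrow> real \<Rightarrow> real" where
  "generator h x = \<delta> * f' x + f'' x / 2 * h\<^sup>2"

text \<open>Only the monotonicity of the weight and \<open>0 \<le> f\<close> are used: they allow \<open>V\<close> to be replaced by
  the \<open>F u\<close>-measurable \<open>W\<close> before expanding.\<close>

lemma one_step:
  assumes uv: "0 \<le> u" "u < v" "v - u \<le> 1"
    and [measurable]: "X \<in> borel_measurable (F u)" "\<xi> \<in> borel_measurable (F u)" "W \<in> borel_measurable (F u)"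
      "V \<in> borel_measurable M"
    and X: "integrable M X" and \<xi>: "\<And>\<omega>. \<omega> \<in> space M \<Longrightarrow> \<bar>\<xi> \<omega>\<bar> \<le> C"
    and W: "\<And>\<omega>. \<omega> \<in> space M \<Longrightarrow> 0 \<le> V \<omega>" "\<And>\<omega>. \<omega> \<in> space M \<Longrightarrow> V \<omega> \<le> W \<omega>"
      "\<And>\<omega>. \<omega> \<in> space M \<Longrightarrow> W \<omega> \<le> 1"
  shows "expectation (\<lambda>\<omega>. V \<omega> * f (X \<omega> + \<delta> * (v - u) + \<xi> \<omega> * (B v \<omega> - B u \<omega>))) - expectation (\<lambda>\<omega>. W \<omega> * f (X \<omega>))
    \<le> (v - u) * expectation (\<lambda>\<omega>. W \<omega> * generator (\<xi> \<omega>) (X \<omega>))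
      + (L * \<delta>\<^sup>2 + 4 * L * \<delta> ^ 3 + 8 * L * C ^ 3) * (v - u) * sqrt (v - u)"
proof -
  define h where "h = v - u"
  define \<Delta> where "\<Delta> \<omega> = B v \<omega> - B u \<omega>" for \<omega>
  have h: "0 < h" "h \<le> 1" using uv by (auto simp: h_def)
  have C: "0 \<le> C" using \<xi> not_empty by fastforce
  note [measurable] = measurable_from_F[of X u] measurable_from_F[of \<xi> u] measurable_from_F[of W u]
  have [measurable]: "\<Delta> \<in> borel_measurable M"
    unfolding \<Delta>_def using B_measurable[of u] B_measurable[of v] uv by simp
  have bnd: "integrable M U" if "U \<in> borel_measurable M" "\<And>\<omega>. \<omega> \<in> space M \<Longrightarrow> \<bar>U \<omega>\<bar> \<le> c" for U :: "'a \<Rightarrow> real" and c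
    using that by (intro integrable_const_bound[of _ c] AE_I2) auto
  have int\<Delta>: "integrable M \<Delta>"
    unfolding \<Delta>_def using uv by (intro integrable_increment) auto
  \<comment> \<open>The Taylor coefficients with the weight included. They are bounded and known at
    time \<open>u\<close>, so the increment of \<open>B\<close> can be integrated out against
    them.\<close>
  define U1 where "U1 \<omega> = W \<omega> * f' (X \<omega>)" for \<omega>
  define U2 where "U2 \<omega> = W \<omega> * f'' (X \<omega>)" for \<omega>
  have U: "\<bar>U1 \<omega>\<bar> \<le> 1" "\<bar>U2 \<omega>\<bar> \<le> L" if "\<omega> \<in> space M" for \<omega>
    using mult_mono[of "W \<omega>" 1 "\<bar>f' (X \<omega>)\<bar>" 1] mult_mono[of "W \<omega>" 1 "\<bar>f'' (X \<omega>)\<bar>" L]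
      W[OF that] deriv1_bound deriv2_bound
    by (auto simp: U1_def U2_def abs_mult)
  have U\<xi>: "\<bar>U1 \<omega> * \<xi> \<omega>\<bar> \<le> C" "\<bar>U2 \<omega> * \<xi> \<omega>\<bar> \<le> L * C" "\<bar>U2 \<omega> / 2 * (\<xi> \<omega>)\<^sup>2\<bar> \<le> L * C\<^sup>2"
    if "\<omega> \<in> space M" for \<omega>
  proof -
    show "\<bar>U1 \<omega> * \<xi> \<omega>\<bar> \<le> C" "\<bar>U2 \<omega> * \<xi> \<omega>\<bar> \<le> L * C"
      using mult_mono[OF U(1)[OF that] \<xi>[OF that]] mult_mono[OF U(2)[OF that] \<xi>[OF that]] L_nonneg
      by (auto simp: abs_mult)
    have "(\<xi> \<omega>)\<^sup>2 \<le> C\<^sup>2" using \<xi>[OF that] C by (simp add: abs_le_square_iff[symmetric])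
    moreover have "\<bar>U2 \<omega> / 2\<bar> \<le> L" using U(2)[OF that] by simp
    ultimately show "\<bar>U2 \<omega> / 2 * (\<xi> \<omega>)\<^sup>2\<bar> \<le> L * C\<^sup>2"
      using mult_mono[of "\<bar>U2 \<omega> / 2\<bar>" L "(\<xi> \<omega>)\<^sup>2" "C\<^sup>2"] L_nonneg by (auto simp: abs_mult)
  qed
  have U_meas: "U1 \<in> borel_measurable (F u)" "U2 \<in> borel_measurable (F u)"
    unfolding U1_def U2_def by measurable
  note [measurable] = U_meas U_meas[THEN measurable_from_F]
  have E1: "has_bochner_integral M U1 (expectation U1)"
    using bnd[of U1 1] U by (auto simp: has_bochner_integral_iff)
  have E2: "has_bochner_integral M (\<lambda>\<omega>. U1 \<omega> * \<xi> \<omega> * \<Delta> \<omega>) 0"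
    unfolding \<Delta>_def using uv U\<xi> by (intro expectation_increment1 bnd[of _ C]) auto
  have E3: "has_bochner_integral M (\<lambda>\<omega>. U2 \<omega> * \<xi> \<omega> * \<Delta> \<omega>) 0"
    unfolding \<Delta>_def using uv U\<xi> by (intro expectation_increment1 bnd[of _ "L * C"]) auto
  have E4: "has_bochner_integral M (\<lambda>\<omega>. U2 \<omega> / 2 * (\<xi> \<omega>)\<^sup>2 * (\<Delta> \<omega>)\<^sup>2) (expectation (\<lambda>\<omega>. U2 \<omega> / 2 * (\<xi> \<omega>)\<^sup>2) * h)"
    unfolding \<Delta>_def h_def using uv U\<xi> by (intro expectation_increment2 bnd[of _ "L * C\<^sup>2"]) auto
  have E5: "has_bochner_integral M (\<lambda>\<omega>. \<bar>\<Delta> \<omega>\<bar> ^ 3) (2 * (h * sqrt h) * sqrt (2 / pi))"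
    unfolding \<Delta>_def h_def using uv by (intro expectation_increment3) auto
  \<comment> \<open>A pointwise majorant of the increment, each term of which has a known
    expectation. The terms linear in \<open>\<Delta>\<close> have mean 0; the last two collect the
    cubic remainder and the square of the drift step.\<close>
  define G where "G \<omega> = \<delta> * h * U1 \<omega> + U1 \<omega> * \<xi> \<omega> * \<Delta> \<omega> + \<delta> * h * (U2 \<omega> * \<xi> \<omega> * \<Delta> \<omega>)
    + U2 \<omega> / 2 * (\<xi> \<omega>)\<^sup>2 * (\<Delta> \<omega>)\<^sup>2 + 4 * L * C ^ 3 * \<bar>\<Delta> \<omega>\<bar> ^ 3 + (L * \<delta>\<^sup>2 * h\<^sup>2 + 4 * L * \<delta> ^ 3 * h ^ 3)" for \<omega>
  have EG: "has_bochner_integral M G (\<delta> * h * expectation U1 + 0 + \<delta> * h * 0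
      + expectation (\<lambda>\<omega>. U2 \<omega> / 2 * (\<xi> \<omega>)\<^sup>2) * h + 4 * L * C ^ 3 * (2 * (h * sqrt h) * sqrt (2 / pi))
      + (L * \<delta>\<^sup>2 * h\<^sup>2 + 4 * L * \<delta> ^ 3 * h ^ 3))"
    unfolding G_def
    by (intro has_bochner_integral_add has_bochner_integral_mult_right E1 E2 E3 E4 E5)
      (auto simp: has_bochner_integral_iff prob_space)
  have intfX: "integrable M (\<lambda>\<omega>. W \<omega> * f (X \<omega>))"
  proof (rule Bochner_Integration.integrable_bound)
    show "integrable M (\<lambda>\<omega>. f 0 + \<bar>X \<omega>\<bar>)" using X by auto
    show "AE \<omega> in M. norm (W \<omega> * f (X \<omega>)) \<le> norm (f 0 + \<bar>X \<omega>\<bar>)"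
    proof (rule AE_I2)
      fix \<omega> assume "\<omega> \<in> space M"
      then have "\<bar>W \<omega>\<bar> * \<bar>f (X \<omega>)\<bar> \<le> 1 * (f 0 + \<bar>X \<omega>\<bar>)"
        using W[of \<omega>] by (intro mult_mono linear_growth) auto
      then show "norm (W \<omega> * f (X \<omega>)) \<le> norm (f 0 + \<bar>X \<omega>\<bar>)" by (simp add: abs_mult)
    qed
  qed measurable
  have intfY: "integrable M (\<lambda>\<omega>. V \<omega> * f (X \<omega> + \<delta> * h + \<xi> \<omega> * \<Delta> \<omega>))"
  proof (rule Bochner_Integration.integrable_bound)
    show "integrable M (\<lambda>\<omega>. f 0 + (\<bar>X \<omega>\<bar> + \<delta> * h + C * \<bar>\<Delta> \<omega>\<bar>))" using X int\<Delta> by auto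
    show "AE \<omega> in M. norm (V \<omega> * f (X \<omega> + \<delta> * h + \<xi> \<omega> * \<Delta> \<omega>)) \<le> norm (f 0 + (\<bar>X \<omega>\<bar> + \<delta> * h + C * \<bar>\<Delta> \<omega>\<bar>))"
    proof (rule AE_I2)
      fix \<omega> assume w: "\<omega> \<in> space M"
      let ?x = "X \<omega> + \<delta> * h + \<xi> \<omega> * \<Delta> \<omega>"
      have "\<bar>\<xi> \<omega> * \<Delta> \<omega>\<bar> \<le> C * \<bar>\<Delta> \<omega>\<bar>"
        unfolding abs_mult using \<xi>[OF w] by (intro mult_right_mono) auto
      moreover have "0 \<le> \<delta> * h" using h drift_nonneg by simp
      ultimately have "\<bar>?x\<bar> \<le> \<bar>X \<omega>\<bar> + \<delta> * h + C * \<bar>\<Delta> \<omega>\<bar>" by linarith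
      then have "\<bar>f ?x\<bar> \<le> f 0 + (\<bar>X \<omega>\<bar> + \<delta> * h + C * \<bar>\<Delta> \<omega>\<bar>)" using linear_growth[of ?x] by linarith
      then have "\<bar>V \<omega>\<bar> * \<bar>f ?x\<bar> \<le> 1 * (f 0 + (\<bar>X \<omega>\<bar> + \<delta> * h + C * \<bar>\<Delta> \<omega>\<bar>))"
        using W[of \<omega>] w by (intro mult_mono) auto
      then show "norm (V \<omega> * f ?x) \<le> norm (f 0 + (\<bar>X \<omega>\<bar> + \<delta> * h + C * \<bar>\<Delta> \<omega>\<bar>))" by (simp add: abs_mult)
    qed
  qed measurable
  have pw: "V \<omega> * f (X \<omega> + \<delta> * h + \<xi> \<omega> * \<Delta> \<omega>) - W \<omega> * f (X \<omega>) \<le> G \<omega>" if w: "\<omega> \<in> space M" for \<omega>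
  proof -
    define y where "y = \<delta> * h + \<xi> \<omega> * \<Delta> \<omega>"
    have "\<bar>y\<bar> \<le> \<delta> * h + C * \<bar>\<Delta> \<omega>\<bar>"
      unfolding y_def using \<xi>[OF w] h drift_nonneg
      by (intro order_trans[OF abs_triangle_ineq] add_mono) (auto simp: abs_mult intro: mult_right_mono)
    then have "\<bar>y\<bar> ^ 3 \<le> (\<delta> * h + C * \<bar>\<Delta> \<omega>\<bar>) ^ 3" by (intro power_mono) auto
    also have "(a + b) ^ 3 \<le> 4 * (a ^ 3 + b ^ 3)" if "0 \<le> a" "0 \<le> b" for a b :: real
    proof -
      have "4 * (a ^ 3 + b ^ 3) - (a + b) ^ 3 = 3 * (a + b) * (a - b)\<^sup>2"
        by (simp add: power2_eq_square power3_eq_cube algebra_simps)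
      also have "\<dots> \<ge> 0" using that by simp
      finally show ?thesis by simp
    qed
    then have "(\<delta> * h + C * \<bar>\<Delta> \<omega>\<bar>) ^ 3 \<le> 4 * ((\<delta> * h) ^ 3 + (C * \<bar>\<Delta> \<omega>\<bar>) ^ 3)"
      using C drift_nonneg h by simp
    finally have y3: "\<bar>y\<bar> ^ 3 \<le> 4 * ((\<delta> * h) ^ 3 + (C * \<bar>\<Delta> \<omega>\<bar>) ^ 3)" .
    have "V \<omega> * f (X \<omega> + y) \<le> W \<omega> * f (X \<omega> + y)"
      using W[OF w] nonneg by (intro mult_right_mono) auto
    then have "V \<omega> * f (X \<omega> + y) - W \<omega> * f (X \<omega>) \<le> W \<omega> * (f (X \<omega> + y) - f (X \<omega>))"
      by (simp add: algebra_simps)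
    also have "\<dots> \<le> W \<omega> * (f' (X \<omega>) * y + f'' (X \<omega>) / 2 * y\<^sup>2 + L * \<bar>y\<bar> ^ 3)"
      using Taylor[of "X \<omega>" y] W[OF w] by (intro mult_left_mono) auto
    also have "\<dots> = U1 \<omega> * y + U2 \<omega> / 2 * y\<^sup>2 + W \<omega> * (L * \<bar>y\<bar> ^ 3)"
      by (simp add: U1_def U2_def algebra_simps)
    also have "W \<omega> * (L * \<bar>y\<bar> ^ 3) \<le> 1 * (L * (4 * ((\<delta> * h) ^ 3 + (C * \<bar>\<Delta> \<omega>\<bar>) ^ 3)))"
      using W[OF w] L_nonneg y3 by (intro mult_mono mult_left_mono) auto
    also have "U2 \<omega> / 2 * y\<^sup>2 = U2 \<omega> / 2 * (\<delta> * h)\<^sup>2 + \<delta> * h * (U2 \<omega> * \<xi> \<omega> * \<Delta> \<omega>) + U2 \<omega> / 2 * (\<xi> \<omega>)\<^sup>2 * (\<Delta> \<omega>)\<^sup>2"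
      by (simp add: y_def power2_eq_square algebra_simps)
    also have "U2 \<omega> / 2 * (\<delta> * h)\<^sup>2 \<le> L * (\<delta> * h)\<^sup>2"
      using U(2)[OF w] by (intro mult_right_mono) auto
    finally show ?thesis
      by (simp add: G_def y_def power_mult_distrib algebra_simps)
  qed
  have "expectation (\<lambda>\<omega>. V \<omega> * f (X \<omega> + \<delta> * h + \<xi> \<omega> * \<Delta> \<omega>)) - expectation (\<lambda>\<omega>. W \<omega> * f (X \<omega>))
      = expectation (\<lambda>\<omega>. V \<omega> * f (X \<omega> + \<delta> * h + \<xi> \<omega> * \<Delta> \<omega>) - W \<omega> * f (X \<omega>))"
    using intfX intfY by simp
  also have "\<dots> \<le> expectation G"
    using pw EG by (intro integral_mono Bochner_Integration.integrable_diff intfX intfY) (auto simp: has_bochner_integral_iff)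
  also have "\<dots> = h * (\<delta> * expectation U1 + expectation (\<lambda>\<omega>. U2 \<omega> / 2 * (\<xi> \<omega>)\<^sup>2))
      + (L * \<delta>\<^sup>2 * h\<^sup>2 + 4 * L * \<delta> ^ 3 * h ^ 3 + 8 * L * C ^ 3 * (h * sqrt h) * sqrt (2 / pi))"
    using has_bochner_integral_integral_eq[OF EG] by (simp add: algebra_simps)
  also have "\<delta> * expectation U1 + expectation (\<lambda>\<omega>. U2 \<omega> / 2 * (\<xi> \<omega>)\<^sup>2) = expectation (\<lambda>\<omega>. \<delta> * U1 \<omega> + U2 \<omega> / 2 * (\<xi> \<omega>)\<^sup>2)"
    using E1 bnd[of "\<lambda>\<omega>. U2 \<omega> / 2 * (\<xi> \<omega>)\<^sup>2" "L * C\<^sup>2"] U\<xi> by (simp add: has_bochner_integral_iff)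
  also have "\<dots> = expectation (\<lambda>\<omega>. W \<omega> * generator (\<xi> \<omega>) (X \<omega>))"
    by (simp add: U1_def U2_def generator_def algebra_simps)
  \<comment> \<open>As \<open>h \<le> 1\<close>, every error is a multiple of
    \<open>h * sqrt h\<close>. The 8 is the 4 from the inequality for cubes times the 2 from the
    third absolute moment.\<close>
  also have "L * \<delta>\<^sup>2 * h\<^sup>2 + 4 * L * \<delta> ^ 3 * h ^ 3 + 8 * L * C ^ 3 * (h * sqrt h) * sqrt (2 / pi)
      \<le> L * \<delta>\<^sup>2 * (h * sqrt h) + 4 * L * \<delta> ^ 3 * (h * sqrt h) + 8 * L * C ^ 3 * (h * sqrt h) * 1"
  proof -
    have "h \<le> sqrt h" using h by (intro real_le_rsqrt) (simp add: power2_eq_square mult_left_le)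
    then have 1: "h\<^sup>2 \<le> h * sqrt h" using h by (simp add: power2_eq_square)
    moreover have "h ^ 3 \<le> h\<^sup>2" using h by (intro power_decreasing) auto
    ultimately have 2: "h ^ 3 \<le> h * sqrt h" by linarith
    have "sqrt (2 / pi) \<le> 1" using pi_ge_two by simp
    then show ?thesis
      using 1 2 C L_nonneg drift_nonneg h by (intro add_mono mult_left_mono) auto
  qed
  finally show ?thesis
    by (simp add: h_def \<Delta>_def algebra_simps)
qed

end

section \<open>Simple processes\<close>

lemma simple_process_grid_mono:
  assumes "simple_process M F (n, \<tau>, \<xi>)" "i \<le> j" "j \<le> n"
  shows "\<tau> i \<le> \<tau> j"
  using assms(2,3)
proof (induction j rule: dec_induct)
  case (step j)
  then have "\<tau> j \<le> \<tau> (Suc j)" using assms(1) by (auto simp: simple_process_def)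
  then show ?case using step by simp
qed simp

lemma simple_process_grid_nonneg:
  assumes "simple_process M F (n, \<tau>, \<xi>)" "i \<le> n"
  shows "0 \<le> \<tau> i"
  using simple_process_grid_mono[OF assms(1), of 0 i] assms by (simp add: simple_process_def)

lemma simple_value_step:
  assumes S: "simple_process M F (n, \<tau>, \<xi>)" and "i < n" "\<tau> i < u" "u \<le> \<tau> (Suc i)"
  shows "simple_value (n, \<tau>, \<xi>) u \<omega> = \<xi> i \<omega>"
proof -
  have "\<xi> j \<omega> * indicator {\<tau> j<..\<tau> (Suc j)} u = (if j = i then \<xi> i \<omega> else 0)" if "j < n" for j
  proof -
    consider "j = i" | "Suc j \<le> i" | "Suc i \<le> j" by linarith
    then show ?thesis
    proof cases
      case 2
      then show ?thesis using simple_process_grid_mono[OF S, of "Suc j" i] assms by auto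
    next
      case 3
      then show ?thesis using simple_process_grid_mono[OF S, of "Suc i" j] assms that by auto
    qed (use assms in auto)
  qed
  then have "simple_value (n, \<tau>, \<xi>) u \<omega> = (\<Sum>j<n. if j = i then \<xi> i \<omega> else 0)"
    unfolding simple_value_def prod.case by (intro sum.cong) auto
  then show ?thesis using \<open>i < n\<close> by simp
qed

lemma simple_value_outside:
  assumes S: "simple_process M F (n, \<tau>, \<xi>)" and "u \<le> \<tau> 0 \<or> \<tau> n < u"
  shows "simple_value (n, \<tau>, \<xi>) u \<omega> = 0"
proof -
  have "\<xi> j \<omega> * indicator {\<tau> j<..\<tau> (Suc j)} u = 0" if "j < n" for j
    using simple_process_grid_mono[OF S, of 0 j] simple_process_grid_mono[OF S, of "Suc j" n] that assms by auto
  then show ?thesis unfolding simple_value_def prod.case by (intro sum.neutral) auto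
qed

lemma simple_integral_step:
  assumes S: "simple_process M F (n, \<tau>, \<xi>)" and "i < n" "\<tau> i \<le> u" "u \<le> v" "v \<le> \<tau> (Suc i)"
  shows "simple_integral B (n, \<tau>, \<xi>) v \<omega> = simple_integral B (n, \<tau>, \<xi>) u \<omega> + \<xi> i \<omega> * (B v \<omega> - B u \<omega>)"
proof -
  let ?D = "\<lambda>j u. \<xi> j \<omega> * (B (min u (\<tau> (Suc j))) \<omega> - B (min u (\<tau> j)) \<omega>)"
  have "?D j v = ?D j u + (if j = i then \<xi> i \<omega> * (B v \<omega> - B u \<omega>) else 0)" if "j < n" for j
  proof -
    consider "j = i" | "Suc j \<le> i" | "Suc i \<le> j" by linarith
    then show ?thesis
    proof cases
      case 1
      then show ?thesis using assms by (simp add: min_absorb1 min_absorb2 algebra_simps)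
    next
      case 2
      then have "\<tau> j \<le> u" "\<tau> (Suc j) \<le> u" "\<tau> j \<le> v" "\<tau> (Suc j) \<le> v"
        using simple_process_grid_mono[OF S, of "Suc j" i] simple_process_grid_mono[OF S, of j i] assms by auto
      then show ?thesis using 2 by (simp add: min_absorb2)
    next
      case 3
      then have "u \<le> \<tau> j" "u \<le> \<tau> (Suc j)" "v \<le> \<tau> j" "v \<le> \<tau> (Suc j)"
        using simple_process_grid_mono[OF S, of "Suc i" j] simple_process_grid_mono[OF S, of "Suc i" "Suc j"] assms that by auto
      then show ?thesis using 3 by (simp add: min_absorb1)
    qed
  qed
  then have "(\<Sum>j<n. ?D j v) = (\<Sum>j<n. ?D j u + (if j = i then \<xi> i \<omega> * (B v \<omega> - B u \<omega>) else 0))"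
    by (intro sum.cong) auto
  then show ?thesis using \<open>i < n\<close> by (simp add: simple_integral_def sum.distrib)
qed

lemma simple_integral_before:
  assumes S: "simple_process M F (n, \<tau>, \<xi>)" and "u \<le> \<tau> 0"
  shows "simple_integral B (n, \<tau>, \<xi>) u \<omega> = 0"
proof -
  have "u \<le> \<tau> j" if "j \<le> n" for j
    using simple_process_grid_mono[OF S, of 0 j] assms that by auto
  then show ?thesis by (simp add: simple_integral_def min_absorb1)
qed

lemma simple_integral_after:
  assumes S: "simple_process M F (n, \<tau>, \<xi>)" and "\<tau> n \<le> u" "\<tau> n \<le> v"
  shows "simple_integral B (n, \<tau>, \<xi>) u \<omega> = simple_integral B (n, \<tau>, \<xi>) v \<omega>"
proof -
  have "\<tau> j \<le> u" "\<tau> j \<le> v" if "j \<le> n" for j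
    using simple_process_grid_mono[OF S, of j n] assms that by auto
  then show ?thesis by (simp add: simple_integral_def min_absorb2)
qed

context brownian_filtration
begin

lemma simple_integral_adapted:
  assumes S: "simple_process M F (n, \<tau>, \<xi>)" and "0 \<le> u"
  shows "simple_integral B (n, \<tau>, \<xi>) u \<in> borel_measurable (F u)"
    and "integrable M (simple_integral B (n, \<tau>, \<xi>) u)"
proof -
  let ?D = "\<lambda>j \<omega>. \<xi> j \<omega> * (B (min u (\<tau> (Suc j))) \<omega> - B (min u (\<tau> j)) \<omega>)"
  have eq: "simple_integral B (n, \<tau>, \<xi>) u = (\<lambda>\<omega>. \<Sum>j<n. ?D j \<omega>)"
    by (auto simp: simple_integral_def)
  have D: "?D j \<in> borel_measurable (F u) \<and> integrable M (?D j)" if "j < n" for j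
  proof -
    have \<tau>: "0 \<le> \<tau> j" "\<tau> j \<le> \<tau> (Suc j)" "\<xi> j \<in> borel_measurable (F (\<tau> j))"
      using S that simple_process_grid_nonneg[OF S, of j] by (auto simp: simple_process_def)
    have "\<exists>C. \<forall>\<omega>\<in>space M. \<bar>\<xi> j \<omega>\<bar> \<le> C"
      using S that by (auto simp: simple_process_def)
    then obtain C where C: "\<And>\<omega>. \<omega> \<in> space M \<Longrightarrow> \<bar>\<xi> j \<omega>\<bar> \<le> C" by blast
    show ?thesis
    \<comment> \<open>If interval \<open>j\<close> is degenerate or has not begun before time
      \<open>u\<close>, then \<open>\<xi> j\<close> may fail to be \<open>F u\<close>-measurable,
      but the increment that multiplies it is identically 0.\<close>
    proof (cases "\<tau> j < min u (\<tau> (Suc j))")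
      case True
      have [measurable]: "\<xi> j \<in> borel_measurable (F u)" "B (min u (\<tau> (Suc j))) \<in> borel_measurable (F u)"
        "B (min u (\<tau> j)) \<in> borel_measurable (F u)"
        using True \<tau> \<open>0 \<le> u\<close> by (auto intro: measurable_F_mono[OF _ \<tau>(3)] measurable_F_mono[OF _ B_adapted])
      have "min u (\<tau> j) = \<tau> j" using True by simp
      moreover have "integrable M (\<xi> j)"
        using C \<tau> by (intro integrable_const_bound[of _ C] AE_I2) (auto intro: measurable_from_F)
      ultimately have "integrable M (?D j)"
        using expectation_increment1[OF \<tau>(1) True \<tau>(3)] by (simp add: has_bochner_integral_iff)
      then show ?thesis by simp
    next
      case False
      then have "min u (\<tau> (Suc j)) = min u (\<tau> j)" using \<tau> by linarith
      then show ?thesis by simp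
    qed
  qed
  show "simple_integral B (n, \<tau>, \<xi>) u \<in> borel_measurable (F u)"
    unfolding eq using D by (intro borel_measurable_sum) auto
  show "integrable M (simple_integral B (n, \<tau>, \<xi>) u)"
    unfolding eq using D by (intro Bochner_Integration.integrable_sum) auto
qed

end

context brownian_test
begin

lemma generator_bound: "\<bar>h\<bar> \<le> C \<Longrightarrow> \<bar>generator h x\<bar> \<le> \<delta> + L * C\<^sup>2"
proof -
  assume h: "\<bar>h\<bar> \<le> C"
  then have "h\<^sup>2 \<le> C\<^sup>2" using abs_le_square_iff[of h C] by auto
  then have "\<bar>f'' x / 2\<bar> * h\<^sup>2 \<le> L * C\<^sup>2"
    using deriv2_bound[of x] by (intro mult_mono) auto
  moreover have "\<bar>\<delta> * f' x\<bar> \<le> \<delta>"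
    using deriv1_bound[of x] drift_nonneg by (simp add: abs_mult mult_left_le)
  ultimately show ?thesis
    unfolding generator_def by (intro order_trans[OF abs_triangle_ineq] add_mono) (auto simp: abs_mult)
qed

lemma isCont_generator: "isCont (generator h) x"
  using continuous unfolding generator_def
  by (intro continuous_intros) (auto simp: continuous_on_eq_continuous_at)

text \<open>Between grid points the integrand is a single random variable, known at the left end, so
  \<open>one_step\<close> holds on all subintervals with the same \<open>C\<close> and
  \<open>increment_le_integral\<close> adds up the steps. The latter asks for continuity of
  \<open>e\<close>, which is dominated convergence.\<close>

lemma frozen_interval:
  assumes ab: "0 \<le> a" "a \<le> b"
    and \<xi>: "\<xi> \<in> borel_measurable (F a)" "\<And>\<omega>. \<omega> \<in> space M \<Longrightarrow> \<bar>\<xi> \<omega>\<bar> \<le> C"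
    and X: "\<And>u. a \<le> u \<Longrightarrow> u \<le> b \<Longrightarrow> X u \<in> borel_measurable (F u)" "\<And>u. a \<le> u \<Longrightarrow> u \<le> b \<Longrightarrow> integrable M (X u)"
    and step: "\<And>u v \<omega>. a \<le> u \<Longrightarrow> u \<le> v \<Longrightarrow> v \<le> b \<Longrightarrow> X v \<omega> = X u \<omega> + \<delta> * (v - u) + \<xi> \<omega> * (B v \<omega> - B u \<omega>)"
    and W: "\<And>u. 0 \<le> u \<Longrightarrow> W u \<in> borel_measurable (F u)"
      "\<And>u \<omega>. 0 \<le> u \<Longrightarrow> \<omega> \<in> space M \<Longrightarrow> 0 \<le> W u \<omega>" "\<And>u \<omega>. 0 \<le> u \<Longrightarrow> \<omega> \<in> space M \<Longrightarrow> W u \<omega> \<le> 1"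
      "\<And>u v \<omega>. 0 \<le> u \<Longrightarrow> u \<le> v \<Longrightarrow> \<omega> \<in> space M \<Longrightarrow> W v \<omega> \<le> W u \<omega>"
      "\<And>\<omega>. \<omega> \<in> space M \<Longrightarrow> continuous_on {0..} (\<lambda>u. W u \<omega>)"
  defines "e \<equiv> \<lambda>u. expectation (\<lambda>\<omega>. W u \<omega> * generator (\<xi> \<omega>) (X u \<omega>))"
  shows "continuous_on {a..b} e"
    and "expectation (\<lambda>\<omega>. W b \<omega> * f (X b \<omega>)) - expectation (\<lambda>\<omega>. W a \<omega> * f (X a \<omega>)) \<le> integral {a..b} e"
proof -
  have [measurable]: "\<xi> \<in> borel_measurable M" using \<xi> measurable_from_F by blast
  have XM: "X u \<in> borel_measurable M" if "a \<le> u" "u \<le> b" for u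
    using X(1)[OF that] measurable_from_F by blast
  have WM: "W u \<in> borel_measurable M" if "0 \<le> u" for u
    using W(1)[OF that] measurable_from_F by blast
  have C: "0 \<le> C" using \<xi>(2) not_empty by fastforce
  show cont: "continuous_on {a..b} e"
    unfolding continuous_on_sequentially
  proof (intro ballI allI impI, elim conjE)
    fix x :: "nat \<Rightarrow> real" and u
    assume u: "u \<in> {a..b}" and x: "\<forall>n. x n \<in> {a..b}" "x \<longlonglongrightarrow> u"
    have xn: "a \<le> x n" "x n \<le> b" "0 \<le> x n" for n using x ab by (auto simp: Ball_def intro: order_trans)
    have "(\<lambda>n. e (x n)) \<longlonglongrightarrow> e u"
      unfolding e_def
    proof (rule integral_dominated_convergence[where w = "\<lambda>_. \<delta> + L * C\<^sup>2"])
      show "(\<lambda>\<omega>. W u \<omega> * generator (\<xi> \<omega>) (X u \<omega>)) \<in> borel_measurable M"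
        using XM[of u] WM[of u] u ab unfolding generator_def by simp
      show "(\<lambda>\<omega>. W (x n) \<omega> * generator (\<xi> \<omega>) (X (x n) \<omega>)) \<in> borel_measurable M" for n
        using XM[of "x n"] WM[of "x n"] xn[of n] unfolding generator_def by simp
      show "AE \<omega> in M. (\<lambda>n. W (x n) \<omega> * generator (\<xi> \<omega>) (X (x n) \<omega>)) \<longlonglongrightarrow> W u \<omega> * generator (\<xi> \<omega>) (X u \<omega>)"
        using B_continuous AE_space
      proof eventually_elim
        case (elim \<omega>)
        have B_lim: "(\<lambda>n. B (x n) \<omega>) \<longlonglongrightarrow> B u \<omega>" and W_lim: "(\<lambda>n. W (x n) \<omega>) \<longlonglongrightarrow> W u \<omega>"
          using elim W(5)[OF elim(2)] x(2) u ab xn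
          by (auto intro!: continuous_on_tendsto_compose[of "{0..}" _ x u sequentially] eventuallyI)
        have X_eq: "X v \<omega> = X a \<omega> + \<delta> * (v - a) + \<xi> \<omega> * (B v \<omega> - B a \<omega>)" if "v \<in> {a..b}" for v
          using step[of a v] that by auto
        have "(\<lambda>n. X a \<omega> + \<delta> * (x n - a) + \<xi> \<omega> * (B (x n) \<omega> - B a \<omega>))
            \<longlonglongrightarrow> X a \<omega> + \<delta> * (u - a) + \<xi> \<omega> * (B u \<omega> - B a \<omega>)"
          by (intro tendsto_intros B_lim x(2))
        then have "(\<lambda>n. X (x n) \<omega>) \<longlonglongrightarrow> X u \<omega>"
          by (simp only: X_eq[OF u] X_eq[OF x(1)[rule_format]])
        then have "(\<lambda>n. generator (\<xi> \<omega>) (X (x n) \<omega>)) \<longlonglongrightarrow> generator (\<xi> \<omega>) (X u \<omega>)"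
          by (rule isCont_tendsto_compose[where g = "generator (\<xi> \<omega>)", OF isCont_generator])
        with W_lim show ?case by (rule tendsto_mult)
      qed
      show "AE \<omega> in M. norm (W (x n) \<omega> * generator (\<xi> \<omega>) (X (x n) \<omega>)) \<le> \<delta> + L * C\<^sup>2" for n
      proof (rule AE_I2)
        fix \<omega> assume w: "\<omega> \<in> space M"
        then have "\<bar>W (x n) \<omega>\<bar> * \<bar>generator (\<xi> \<omega>) (X (x n) \<omega>)\<bar> \<le> 1 * (\<delta> + L * C\<^sup>2)"
          using W(2,3)[OF xn(3) w] by (intro mult_mono generator_bound \<xi>) auto
        then show "norm (W (x n) \<omega> * generator (\<xi> \<omega>) (X (x n) \<omega>)) \<le> \<delta> + L * C\<^sup>2"
          by (simp add: abs_mult)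
      qed
    qed simp
    then show "(e \<circ> x) \<longlonglongrightarrow> e u" by (simp add: comp_def)
  qed
  show "expectation (\<lambda>\<omega>. W b \<omega> * f (X b \<omega>)) - expectation (\<lambda>\<omega>. W a \<omega> * f (X a \<omega>)) \<le> integral {a..b} e"
  proof (rule increment_le_integral[where K = "L * \<delta>\<^sup>2 + 4 * L * \<delta> ^ 3 + 8 * L * C ^ 3"])
    show "0 \<le> L * \<delta>\<^sup>2 + 4 * L * \<delta> ^ 3 + 8 * L * C ^ 3" using L_nonneg drift_nonneg C by simp
    fix u v assume uv: "a \<le> u" "u < v" "v \<le> b" "v - u \<le> 1"
    have "expectation (\<lambda>\<omega>. W v \<omega> * f (X u \<omega> + \<delta> * (v - u) + \<xi> \<omega> * (B v \<omega> - B u \<omega>))) - expectation (\<lambda>\<omega>. W u \<omega> * f (X u \<omega>))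
        \<le> (v - u) * e u + (L * \<delta>\<^sup>2 + 4 * L * \<delta> ^ 3 + 8 * L * C ^ 3) * (v - u) * sqrt (v - u)"
      unfolding e_def using uv ab W(2,3,4)
      by (intro one_step X \<xi>(2) W(1) WM) (auto intro: measurable_F_mono[OF _ \<xi>(1)])
    moreover have "(\<lambda>\<omega>. X u \<omega> + \<delta> * (v - u) + \<xi> \<omega> * (B v \<omega> - B u \<omega>)) = X v"
      using step[of u v] uv by auto
    ultimately show "expectation (\<lambda>\<omega>. W v \<omega> * f (X v \<omega>)) - expectation (\<lambda>\<omega>. W u \<omega> * f (X u \<omega>))
        \<le> (v - u) * e u + (L * \<delta>\<^sup>2 + 4 * L * \<delta> ^ 3 + 8 * L * C ^ 3) * (v - u) * sqrt (v - u)"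
      using step[of u v] uv by simp
  qed (use ab cont in auto)
qed

lemma simple_process_inequality:
  assumes S: "simple_process M F (n, \<tau>, \<xi>)" and "0 \<le> t"
    and W: "\<And>u. 0 \<le> u \<Longrightarrow> W u \<in> borel_measurable (F u)"
      "\<And>u \<omega>. 0 \<le> u \<Longrightarrow> \<omega> \<in> space M \<Longrightarrow> 0 \<le> W u \<omega>" "\<And>u \<omega>. 0 \<le> u \<Longrightarrow> \<omega> \<in> space M \<Longrightarrow> W u \<omega> \<le> 1"
      "\<And>u v \<omega>. 0 \<le> u \<Longrightarrow> u \<le> v \<Longrightarrow> \<omega> \<in> space M \<Longrightarrow> W v \<omega> \<le> W u \<omega>"
      "\<And>\<omega>. \<omega> \<in> space M \<Longrightarrow> continuous_on {0..} (\<lambda>u. W u \<omega>)"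
  defines "X \<equiv> \<lambda>u \<omega>. \<delta> * u + simple_integral B (n, \<tau>, \<xi>) u \<omega>"
  shows "expectation (\<lambda>\<omega>. W t \<omega> * f (X t \<omega>)) \<le> f 0
    + integral {0..t} (\<lambda>u. expectation (\<lambda>\<omega>. W u \<omega> * generator (simple_value (n, \<tau>, \<xi>) u \<omega>) (X u \<omega>)))"
proof -
  define e where "e u = expectation (\<lambda>\<omega>. W u \<omega> * generator (simple_value (n, \<tau>, \<xi>) u \<omega>) (X u \<omega>))" for u
  define \<phi> where "\<phi> u = expectation (\<lambda>\<omega>. W u \<omega> * f (X u \<omega>))" for u
  \<comment> \<open>Integrability is carried along because \<open>integral\<close> is 0 on functions
    that are not integrable; together the two conditions are transitive.\<close>
  define P where "P a b \<longleftrightarrow> e integrable_on {a..b} \<and> \<phi> b - \<phi> a \<le> integral {a..b} e" for a b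
  have X: "X u \<in> borel_measurable (F u)" "integrable M (X u)" if "0 \<le> u" for u
    using simple_integral_adapted[OF S that] by (auto simp: X_def)
  have P_refl: "P a a" for a
    using has_integral_refl(2)[of e a] by (simp add: P_def has_integral_iff)
  have P_trans: "P a c" if "P a b" "P b c" "a \<le> b" "b \<le> c" for a b c
  proof -
    have "e integrable_on {a..c}"
      using that Henstock_Kurzweil_Integration.integrable_combine[of a b c e] by (simp add: P_def)
    moreover from this have "integral {a..b} e + integral {b..c} e = integral {a..c} e"
      using that Henstock_Kurzweil_Integration.integral_combine[of a b c e] by simp
    ultimately show ?thesis using that by (simp add: P_def)
  qed
  have frozen: "P a b" if "0 \<le> a" "a \<le> b" "\<eta> \<in> borel_measurable (F a)" "\<And>\<omega>. \<omega> \<in> space M \<Longrightarrow> \<bar>\<eta> \<omega>\<bar> \<le> C"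
    and increment: "\<And>u v \<omega>. a \<le> u \<Longrightarrow> u \<le> v \<Longrightarrow> v \<le> b \<Longrightarrow> simple_integral B (n, \<tau>, \<xi>) v \<omega> = simple_integral B (n, \<tau>, \<xi>) u \<omega> + \<eta> \<omega> * (B v \<omega> - B u \<omega>)"
    and "\<And>u \<omega>. a < u \<Longrightarrow> u \<le> b \<Longrightarrow> simple_value (n, \<tau>, \<xi>) u \<omega> = \<eta> \<omega>"
    for a b \<eta> C
  proof -
    let ?e = "\<lambda>u. expectation (\<lambda>\<omega>. W u \<omega> * generator (\<eta> \<omega>) (X u \<omega>))"
    have X_step: "X v \<omega> = X u \<omega> + \<delta> * (v - u) + \<eta> \<omega> * (B v \<omega> - B u \<omega>)"
      if "a \<le> u" "u \<le> v" "v \<le> b" for u v \<omega>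
      using increment[OF that, of \<omega>] unfolding X_def by (simp add: algebra_simps)
    have X': "X u \<in> borel_measurable (F u)" "integrable M (X u)" if "a \<le> u" "u \<le> b" for u
      using X[of u] that \<open>0 \<le> a\<close> by auto
    have 1: "continuous_on {a..b} ?e"
      by (rule frozen_interval(1)[OF that(1-4) X' X_step W])
    have 2: "\<phi> b - \<phi> a \<le> integral {a..b} ?e"
      unfolding \<phi>_def by (rule frozen_interval(2)[OF that(1-4) X' X_step W])
    have "(?e has_integral integral {a..b} ?e) {a..b}"
      using 1 by (intro integrable_integral integrable_continuous_real)
    \<comment> \<open>The intervals of a simple process are open on the left, so \<open>e\<close>
      and \<open>?e\<close> may differ at the single point \<open>a\<close>.\<close>
    then have "(e has_integral integral {a..b} ?e) {a..b}"
      by (rule has_integral_spike[of "{a}", rotated 2]) (use that(6) in \<open>auto simp: e_def\<close>)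
    then show ?thesis using 2 by (auto simp: P_def has_integral_iff)
  qed
  \<comment> \<open>Before the first grid point, and later after the last one, the integrand is 0,
    which is again a frozen interval.\<close>
  have start: "P 0 (min t (\<tau> 0))"
    using \<open>0 \<le> t\<close> simple_process_grid_nonneg[OF S, of 0]
    by (intro frozen[of _ _ "\<lambda>_. 0" 0]) (auto simp: simple_integral_before[OF S] simple_value_outside[OF S])
  have grid: "P 0 (min t (\<tau> i))" if "i \<le> n" for i
    using that
  proof (induction i)
    case (Suc i)
    have \<tau>: "0 \<le> \<tau> i" "\<tau> i \<le> \<tau> (Suc i)" "\<xi> i \<in> borel_measurable (F (\<tau> i))"
      using S Suc.prems simple_process_grid_nonneg[OF S, of i] by (auto simp: simple_process_def)
    have "\<exists>C. \<forall>\<omega>\<in>space M. \<bar>\<xi> i \<omega>\<bar> \<le> C"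
      using S Suc.prems by (auto simp: simple_process_def)
    then obtain C where C: "\<And>\<omega>. \<omega> \<in> space M \<Longrightarrow> \<bar>\<xi> i \<omega>\<bar> \<le> C" by blast
    have "P (min t (\<tau> i)) (min t (\<tau> (Suc i)))"
    proof (cases "t \<le> \<tau> i")
      case True
      then show ?thesis using \<tau> P_refl by (simp add: min_absorb1)
    next
      case False
      then have "P (\<tau> i) (min t (\<tau> (Suc i)))"
        using \<tau> C Suc.prems
        by (intro frozen[of _ _ "\<xi> i" C] simple_integral_step[OF S] simple_value_step[OF S]) auto
      then show ?thesis using False by (simp add: min_absorb2)
    qed
    with Suc show ?case
      using \<tau> \<open>0 \<le> t\<close> P_trans[of 0 "min t (\<tau> i)" "min t (\<tau> (Suc i))"] by simp
  qed (use start in simp)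
  have "P (min t (\<tau> n)) t"
  proof (cases "t \<le> \<tau> n")
    case False
    then have "P (\<tau> n) t"
      using simple_process_grid_nonneg[OF S, of n]
      by (intro frozen[of _ _ "\<lambda>_. 0" 0]) (auto simp: simple_value_outside[OF S] intro: simple_integral_after[OF S])
    then show ?thesis using False by (simp add: min_absorb2)
  qed (use P_refl in \<open>simp add: min_absorb1\<close>)
  then have "P 0 t"
    using grid[of n] \<open>0 \<le> t\<close> simple_process_grid_nonneg[OF S, of n] P_trans[of 0 "min t (\<tau> n)" t] by simp
  then have "\<phi> t \<le> \<phi> 0 + integral {0..t} e" by (simp add: P_def)
  \<comment> \<open>An inequality because the weight at time 0 is merely known to be at most 1; the
    state starts at 0.\<close>
  moreover have "\<phi> 0 \<le> expectation (\<lambda>_. f 0)"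
    unfolding \<phi>_def
  proof (rule integral_mono)
    have X0: "X 0 \<omega> = 0" for \<omega>
      using simple_integral_before[OF S, of 0] simple_process_grid_nonneg[OF S, of 0] by (simp add: X_def)
    have [measurable]: "W 0 \<in> borel_measurable M" using W(1)[of 0] measurable_from_F by blast
    show "integrable M (\<lambda>\<omega>. W 0 \<omega> * f (X 0 \<omega>))"
      unfolding X0 using W(2,3)[of 0]
      by (intro integrable_mult_left integrable_const_bound[of _ 1] AE_I2) auto
    show "W 0 \<omega> * f (X 0 \<omega>) \<le> f 0" if "\<omega> \<in> space M" for \<omega>
      unfolding X0 using W(2,3)[of 0 \<omega>] that nonneg[of 0] by (simp add: mult_left_le_one_le)
  qed simp
  ultimately show ?thesis by (simp add: \<phi>_def e_def[abs_def] prob_space)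
qed

end

section \<open>Weights and joint measurability\<close>

text \<open>A finite measure in its own right, so that product measures, Fubini and dominated
  convergence apply to time integrals.\<close>

definition time_measure :: "real \<Rightarrow> real measure" where
  "time_measure t = restrict_space lborel {0..t}"

lemma space_time_measure [simp]: "space (time_measure t) = {0..t}"
  by (simp add: time_measure_def space_restrict_space)

lemma measurable_time_measure: "f \<in> measurable borel N \<Longrightarrow> f \<in> measurable (time_measure t) N"
  unfolding time_measure_def by (rule measurable_restrict_space1) simp

lemma finite_measure_time_measure: "finite_measure (time_measure t)"
  unfolding time_measure_def by (intro finite_measureI) (simp add: emeasure_restrict_space space_restrict_space emeasure_lborel_Icc_eq)

lemma measure_time_measure: "0 \<le> t \<Longrightarrow> measure (time_measure t) {0..t} = t"
  by (simp add: time_measure_def measure_restrict_space)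

lemma integral_time_measure:
  fixes f :: "real \<Rightarrow> real"
  assumes "integrable (time_measure t) f"
  shows "f integrable_on {0..t}" and "integral {0..t} f = (\<integral>s. f s \<partial>time_measure t)"
proof -
  have 1: "set_integrable lborel {0..t} f"
    using assms by (simp add: time_measure_def integrable_restrict_space set_integrable_def)
  have 2: "(\<integral>s. f s \<partial>time_measure t) = (LINT s:{0..t}|lborel. f s)"
    by (simp add: time_measure_def integral_restrict_space set_lebesgue_integral_def)
  show "f integrable_on {0..t}" "integral {0..t} f = (\<integral>s. f s \<partial>time_measure t)"
    using set_borel_integral_eq_integral[OF 1] 2 by auto
qed

lemma integrable_time_measure_continuous:
  fixes f :: "real \<Rightarrow> real"
  assumes "continuous_on {0..t} f"
  shows "integrable (time_measure t) f"
  using borel_integrable_atLeastAtMost'[OF assms]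
  by (simp add: time_measure_def integrable_restrict_space set_integrable_def)

lemma nn_integral_time_measure:
  "(\<integral>\<^sup>+s. f s \<partial>time_measure t) = (\<integral>\<^sup>+s\<in>{0..t}. f s \<partial>lborel)"
  by (simp add: time_measure_def nn_integral_restrict_space)

lemma measurable_pair_continuous_paths:
  fixes Y :: "real \<Rightarrow> 'a \<Rightarrow> real"
  assumes "0 \<le> t" and Y: "\<And>s. 0 \<le> s \<Longrightarrow> s \<le> t \<Longrightarrow> Y s \<in> borel_measurable N"
    and cont: "\<And>\<omega>. \<omega> \<in> space N \<Longrightarrow> continuous_on {0..t} (\<lambda>s. Y s \<omega>)"
  shows "(\<lambda>(s, \<omega>). Y s \<omega>) \<in> borel_measurable (time_measure t \<Otimes>\<^sub>M N)"
proof -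
  \<comment> \<open>Approximate by processes that are piecewise constant in time; \<open>c\<close> keeps the times in \<open>[0, t]\<close>.\<close>
  define c where "c s = max 0 (min t s)" for s
  define q where "q n s = c (of_int \<lfloor>real (Suc n) * s\<rfloor> / real (Suc n))" for n s
  have c: "c s \<in> {0..t}" for s using \<open>0 \<le> t\<close> by (simp add: c_def)
  have "(\<lambda>p. Y (q n (fst p)) (snd p)) \<in> borel_measurable (time_measure t \<Otimes>\<^sub>M N)" for n
  proof -
    have [measurable]: "(\<lambda>s. \<lfloor>real (Suc n) * s\<rfloor>) \<in> measurable (time_measure t) (count_space UNIV)"
      by (rule measurable_time_measure) measurable
    have "(\<lambda>p. Y (c (of_int \<lfloor>real (Suc n) * fst p\<rfloor> / real (Suc n))) (snd p)) \<in> borel_measurable (time_measure t \<Otimes>\<^sub>M N)"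
    proof (rule measurable_compose_countable[where f = "\<lambda>i p. Y (c (of_int i / real (Suc n))) (snd p)"])
      show "(\<lambda>p. Y (c (of_int i / real (Suc n))) (snd p)) \<in> borel_measurable (time_measure t \<Otimes>\<^sub>M N)" for i
        using Y[of "c (of_int i / real (Suc n))"] c[of "of_int i / real (Suc n)"] by auto
    qed measurable
    then show ?thesis by (simp add: q_def)
  qed
  moreover have "(\<lambda>n. Y (q n (fst p)) (snd p)) \<longlonglongrightarrow> Y (fst p) (snd p)"
    if p: "p \<in> space (time_measure t \<Otimes>\<^sub>M N)" for p
  proof -
    let ?s = "fst p"
    have s: "?s \<in> {0..t}" "snd p \<in> space N" using p by (auto simp: space_pair_measure)
    have "(\<lambda>n. of_int \<lfloor>real (Suc n) * ?s\<rfloor> / real (Suc n)) \<longlonglongrightarrow> ?s"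
    proof (rule LIMSEQ_I)
      fix r :: real assume "0 < r"
      then obtain m where m: "inverse (real (Suc m)) < r" using reals_Archimedean by blast
      have "norm (of_int \<lfloor>real (Suc n) * ?s\<rfloor> / real (Suc n) - ?s) < r" if "m \<le> n" for n
      proof -
        have "\<bar>of_int \<lfloor>real (Suc n) * ?s\<rfloor> - real (Suc n) * ?s\<bar> \<le> 1" by linarith
        then have "\<bar>(of_int \<lfloor>real (Suc n) * ?s\<rfloor> - real (Suc n) * ?s) / real (Suc n)\<bar> \<le> 1 / real (Suc n)"
          unfolding abs_divide by (simp add: divide_right_mono del: of_nat_Suc)
        also have "\<dots> \<le> inverse (real (Suc m))" using that by (simp add: field_simps)
        finally show ?thesis using m by (simp add: diff_divide_distrib del: of_nat_Suc)
      qed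
      then show "\<exists>no. \<forall>n\<ge>no. norm (of_int \<lfloor>real (Suc n) * ?s\<rfloor> / real (Suc n) - ?s) < r" by blast
    qed
    then have "(\<lambda>n. q n ?s) \<longlonglongrightarrow> c ?s"
      unfolding q_def c_def by (intro tendsto_intros)
    also have "c ?s = ?s" using s by (simp add: c_def)
    finally have "(\<lambda>n. q n ?s) \<longlonglongrightarrow> ?s" .
    then show ?thesis
      using continuous_on_tendsto_compose[OF cont[OF s(2)], of "\<lambda>n. q n ?s"] s c by (simp add: q_def)
  qed
  ultimately have "(\<lambda>p. Y (fst p) (snd p)) \<in> borel_measurable (time_measure t \<Otimes>\<^sub>M N)"
    by (rule borel_measurable_LIMSEQ_metric)
  then show ?thesis by (simp add: case_prod_beta')
qed

text \<open>Joint measurability is derived from continuity of every path, whereas \<open>B\<close>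
  has continuous paths almost surely. Setting the bad paths to 0 repairs this at the price of
  adaptedness, since the exceptional null set belongs to \<open>M\<close> and perhaps not to the
  filtration.\<close>

lemma (in brownian_filtration) B_regular_version:
  obtains B' where "\<And>u. 0 \<le> u \<Longrightarrow> B' u \<in> borel_measurable M"
    "\<And>\<omega>. continuous_on {0..} (\<lambda>u. B' u \<omega>)" "AE \<omega> in M. \<forall>u. B' u \<omega> = B u \<omega>"
proof -
  obtain N where N: "N \<in> null_sets M" "{\<omega>\<in>space M. \<not> continuous_on {0..} (\<lambda>t. B t \<omega>)} \<subseteq> N"
    using B_continuous by (auto elim!: AE_E simp: null_sets_def)
  let ?B = "\<lambda>u \<omega>. indicator (space M - N) \<omega> * B u \<omega>"
  have "?B u \<in> borel_measurable M" if "0 \<le> u" for u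
    using B_measurable[OF that] N by auto
  moreover have "continuous_on {0..} (\<lambda>u. ?B u \<omega>)" for \<omega>
    using N(2) by (cases "\<omega> \<in> space M - N") auto
  moreover have "AE \<omega> in M. \<forall>u. ?B u \<omega> = B u \<omega>"
    using AE_not_in[OF N(1)] AE_space by eventually_elim auto
  ultimately show thesis by (rule that)
qed

section \<open>Quadratic variation of simple stochastic integrals\<close>

definition quadratic_variation :: "'a step_data \<Rightarrow> real \<Rightarrow> 'a \<Rightarrow> real" where
  "quadratic_variation = (\<lambda>(n, \<tau>, \<xi>) t \<omega>. \<Sum>i<n. (\<xi> i \<omega>)\<^sup>2 * (min t (\<tau> (Suc i)) - min t (\<tau> i)))"

text \<open>The intervals are disjoint, so squaring the sum produces no cross terms.\<close>

lemma simple_value_power2: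
  assumes S: "simple_process M F (n, \<tau>, \<xi>)"
  shows "(simple_value (n, \<tau>, \<xi>) u \<omega>)\<^sup>2 = (\<Sum>i<n. (\<xi> i \<omega>)\<^sup>2 * indicator {\<tau> i<..\<tau> (Suc i)} u)"
proof (cases "\<exists>i<n. u \<in> {\<tau> i<..\<tau> (Suc i)}")
  case True
  then obtain i where i: "i < n" "\<tau> i < u" "u \<le> \<tau> (Suc i)" by auto
  have "(\<xi> j \<omega>)\<^sup>2 * indicator {\<tau> j<..\<tau> (Suc j)} u = (if j = i then (\<xi> i \<omega>)\<^sup>2 else 0)" if "j < n" for j
  proof -
    consider "j = i" | "Suc j \<le> i" | "Suc i \<le> j" by linarith
    then show ?thesis
    proof cases
      case 2
      then show ?thesis using simple_process_grid_mono[OF S, of "Suc j" i] i by auto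
    next
      case 3
      then show ?thesis using simple_process_grid_mono[OF S, of "Suc i" j] i that by auto
    qed (use i in auto)
  qed
  then have "(\<Sum>j<n. (\<xi> j \<omega>)\<^sup>2 * indicator {\<tau> j<..\<tau> (Suc j)} u) = (\<Sum>j<n. if j = i then (\<xi> i \<omega>)\<^sup>2 else 0)"
    by (intro sum.cong) auto
  then show ?thesis using simple_value_step[OF S i] i by simp
next
  case False
  have "simple_value (n, \<tau>, \<xi>) u \<omega> = 0"
    unfolding simple_value_def prod.case using False by (intro sum.neutral) auto
  moreover have "(\<Sum>i<n. (\<xi> i \<omega>)\<^sup>2 * indicator {\<tau> i<..\<tau> (Suc i)} u) = 0"
    using False by (intro sum.neutral) auto
  ultimately show ?thesis by simp
qed

lemma quadratic_variation_derivative: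
  assumes S: "simple_process M F (n, \<tau>, \<xi>)" and u: "u \<notin> \<tau> ` {..n}"
  shows "((\<lambda>u. quadratic_variation (n, \<tau>, \<xi>) u \<omega>) has_real_derivative (simple_value (n, \<tau>, \<xi>) u \<omega>)\<^sup>2) (at u)"
proof -
  have min: "((\<lambda>u. min u a) has_real_derivative (if u < a then 1 else 0)) (at u)" if "u \<noteq> a" for a
  proof (cases "u < a")
    case True
    have "((\<lambda>u. min u a) has_real_derivative 1) (at u)"
      by (rule has_field_derivative_transform_within_open[OF DERIV_ident, of "{..<a}"]) (use True in auto)
    then show ?thesis using True by simp
  next
    case False
    have "((\<lambda>u. min u a) has_real_derivative 0) (at u)"
      by (rule has_field_derivative_transform_within_open[OF DERIV_const[of a], of "{a<..}"]) (use False that in auto)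
    then show ?thesis using False by simp
  qed
  have "((\<lambda>u. \<Sum>i<n. (\<xi> i \<omega>)\<^sup>2 * (min u (\<tau> (Suc i)) - min u (\<tau> i))) has_real_derivative
      (\<Sum>i<n. (\<xi> i \<omega>)\<^sup>2 * ((if u < \<tau> (Suc i) then 1 else 0) - (if u < \<tau> i then 1 else 0)))) (at u)"
    using u by (intro DERIV_sum DERIV_cmult DERIV_diff min) auto
  moreover have "(\<Sum>i<n. (\<xi> i \<omega>)\<^sup>2 * ((if u < \<tau> (Suc i) then 1 else 0) - (if u < \<tau> i then 1 else 0)))
      = (\<Sum>i<n. (\<xi> i \<omega>)\<^sup>2 * indicator {\<tau> i<..\<tau> (Suc i)} u)"
  proof (rule sum.cong)
    fix i assume "i \<in> {..<n}"
    then have "u \<noteq> \<tau> i" "u \<noteq> \<tau> (Suc i)" "\<tau> i \<le> \<tau> (Suc i)"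
      using u simple_process_grid_mono[OF S, of i "Suc i"] by auto
    then show "(\<xi> i \<omega>)\<^sup>2 * ((if u < \<tau> (Suc i) then 1 else 0) - (if u < \<tau> i then 1 else 0)) = (\<xi> i \<omega>)\<^sup>2 * indicator {\<tau> i<..\<tau> (Suc i)} u"
      by (auto split: split_indicator)
  qed simp
  ultimately show ?thesis
    by (simp only: quadratic_variation_def prod.case simple_value_power2[OF S])
qed

lemma continuous_on_quadratic_variation: "continuous_on A (\<lambda>u. quadratic_variation S u \<omega>)"
  by (cases S) (auto simp: quadratic_variation_def intro!: continuous_intros)

lemma quadratic_variation_0:
  assumes "simple_process M F S"
  shows "quadratic_variation S 0 \<omega> = 0"
proof -
  obtain n \<tau> \<xi> where S: "S = (n, \<tau>, \<xi>)" by (cases S)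
  have "0 \<le> \<tau> i" if "i \<le> n" for i
    using simple_process_grid_nonneg[OF assms[unfolded S] that] .
  then show ?thesis by (simp add: S quadratic_variation_def min_absorb1)
qed

lemma quadratic_variation_mono:
  assumes "simple_process M F S" "u \<le> v"
  shows "quadratic_variation S u \<omega> \<le> quadratic_variation S v \<omega>"
proof -
  obtain n \<tau> \<xi> where S: "S = (n, \<tau>, \<xi>)" by (cases S)
  have "\<tau> i \<le> \<tau> (Suc i)" if "i < n" for i
    using simple_process_grid_mono[OF assms(1)[unfolded S], of i "Suc i"] that by auto
  then show ?thesis using assms(2)
    unfolding S quadratic_variation_def prod.case by (intro sum_mono mult_left_mono) (force simp: min_def)+
qed

text \<open>Both are the fundamental theorem with the grid as finite exceptional set. The second
  integral is at most 1 however large the simple process is, which is how the extra weight tames the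
  second order term.\<close>

lemma quadratic_variation_has_integral:
  assumes "simple_process M F S" "0 \<le> t"
  shows "((\<lambda>u. (simple_value S u \<omega>)\<^sup>2) has_integral quadratic_variation S t \<omega>) {0..t}"
    and "((\<lambda>u. exp (- quadratic_variation S u \<omega>) * (simple_value S u \<omega>)\<^sup>2) has_integral
      (1 - exp (- quadratic_variation S t \<omega>))) {0..t}"
proof -
  obtain n \<tau> \<xi> where S: "S = (n, \<tau>, \<xi>)" by (cases S)
  note deriv = quadratic_variation_derivative[OF assms(1)[unfolded S]]
  have "((\<lambda>u. (simple_value S u \<omega>)\<^sup>2) has_integral quadratic_variation S t \<omega> - quadratic_variation S 0 \<omega>) {0..t}"
    by (rule fundamental_theorem_of_calculus_strong[of "\<tau> ` {..n}"])
      (use assms deriv in \<open>auto simp: S has_real_derivative_iff_has_vector_derivative[symmetric] intro: continuous_on_quadratic_variation\<close>)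
  then show "((\<lambda>u. (simple_value S u \<omega>)\<^sup>2) has_integral quadratic_variation S t \<omega>) {0..t}"
    by (simp add: quadratic_variation_0[OF assms(1)])
  have "((\<lambda>u. exp (- quadratic_variation S u \<omega>) * (simple_value S u \<omega>)\<^sup>2) has_integral
      - exp (- quadratic_variation S t \<omega>) - (- exp (- quadratic_variation S 0 \<omega>))) {0..t}"
  proof (rule fundamental_theorem_of_calculus_strong[of "\<tau> ` {..n}"])
    fix u assume "u \<in> {0..t} - \<tau> ` {..n}"
    then have "((\<lambda>u. quadratic_variation S u \<omega>) has_real_derivative (simple_value S u \<omega>)\<^sup>2) (at u)"
      unfolding S by (intro deriv) auto
    then show "((\<lambda>u. - exp (- quadratic_variation S u \<omega>)) has_vector_derivative
        exp (- quadratic_variation S u \<omega>) * (simple_value S u \<omega>)\<^sup>2) (at u)"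
      unfolding has_real_derivative_iff_has_vector_derivative[symmetric]
      by (auto intro!: derivative_eq_intros)
  qed (use assms in \<open>auto intro!: continuous_intros continuous_on_quadratic_variation\<close>)
  then show "((\<lambda>u. exp (- quadratic_variation S u \<omega>) * (simple_value S u \<omega>)\<^sup>2) has_integral
      (1 - exp (- quadratic_variation S t \<omega>))) {0..t}"
    by (simp add: quadratic_variation_0[OF assms(1)])
qed

lemma (in filtered_prob_space) quadratic_variation_adapted:
  assumes "simple_process M F S" "0 \<le> u"
  shows "quadratic_variation S u \<in> borel_measurable (F u)"
proof -
  obtain n \<tau> \<xi> where S: "S = (n, \<tau>, \<xi>)" by (cases S)
  have eq: "quadratic_variation S u = (\<lambda>\<omega>. \<Sum>i<n. (\<xi> i \<omega>)\<^sup>2 * (min u (\<tau> (Suc i)) - min u (\<tau> i)))"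
    by (auto simp: S quadratic_variation_def)
  show ?thesis
    unfolding eq
  proof (rule borel_measurable_sum)
    fix i assume "i \<in> {..<n}"
    then have \<tau>: "\<tau> i \<le> \<tau> (Suc i)" "\<xi> i \<in> borel_measurable (F (\<tau> i))"
      using assms by (auto simp: S simple_process_def)
    show "(\<lambda>\<omega>. (\<xi> i \<omega>)\<^sup>2 * (min u (\<tau> (Suc i)) - min u (\<tau> i))) \<in> borel_measurable (F u)"
    proof (cases "u \<le> \<tau> i")
      case True
      then show ?thesis using \<tau> by (simp add: min_absorb1)
    next
      case False
      then have [measurable]: "\<xi> i \<in> borel_measurable (F u)" by (intro measurable_F_mono[OF _ \<tau>(2)]) auto
      show ?thesis by measurable
    qed
  qed
qed

lemma (in filtered_prob_space) simple_value_measurable: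
  assumes "simple_process M F S"
  shows "(\<lambda>(u, \<omega>). simple_value S u \<omega>) \<in> borel_measurable (time_measure t \<Otimes>\<^sub>M M)"
    and "\<exists>C. \<forall>u. \<forall>\<omega>\<in>space M. \<bar>simple_value S u \<omega>\<bar> \<le> C"
proof -
  obtain n \<tau> \<xi> where S: "S = (n, \<tau>, \<xi>)" by (cases S)
  have \<xi>: "\<xi> i \<in> borel_measurable M" if "i < n" for i
    using assms that measurable_from_F[of "\<xi> i" "\<tau> i"] by (auto simp: S simple_process_def)
  have "(\<lambda>p. \<xi> i (snd p) * indicator {\<tau> i<..\<tau> (Suc i)} (fst p)) \<in> borel_measurable (time_measure t \<Otimes>\<^sub>M M)"
    if "i < n" for i
  proof -
    have [measurable]: "(indicator {\<tau> i<..\<tau> (Suc i)} :: real \<Rightarrow> real) \<in> borel_measurable (time_measure t)"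
      by (rule measurable_time_measure) measurable
    show ?thesis using \<xi>[OF that] by measurable
  qed
  then show "(\<lambda>(u, \<omega>). simple_value S u \<omega>) \<in> borel_measurable (time_measure t \<Otimes>\<^sub>M M)"
    unfolding S simple_value_def case_prod_beta' prod.case fst_conv snd_conv by (intro borel_measurable_sum) auto
  have "\<forall>i. \<exists>C. i < n \<longrightarrow> (\<forall>\<omega>\<in>space M. \<bar>\<xi> i \<omega>\<bar> \<le> C)"
    using assms by (auto simp: S simple_process_def)
  then obtain C where C: "\<And>i \<omega>. i < n \<Longrightarrow> \<omega> \<in> space M \<Longrightarrow> \<bar>\<xi> i \<omega>\<bar> \<le> C i" by metis
  have "\<bar>simple_value S u \<omega>\<bar> \<le> (\<Sum>i<n. C i)" if "\<omega> \<in> space M" for u \<omega>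
    unfolding S simple_value_def prod.case
  proof (rule order_trans[OF sum_abs sum_mono])
    fix i assume "i \<in> {..<n}"
    then show "\<bar>\<xi> i \<omega> * indicator {\<tau> i<..\<tau> (Suc i)} u\<bar> \<le> C i"
      using C[of i \<omega>] that by (auto split: split_indicator)
  qed
  then show "\<exists>C. \<forall>u. \<forall>\<omega>\<in>space M. \<bar>simple_value S u \<omega>\<bar> \<le> C" by blast
qed

section \<open>Stability of the weighted generator under limits\<close>

context brownian_test
begin

text \<open>Deliberately asymmetric: the distance of the states is multiplied by the square of the
  limit integrand \<open>h\<close>, which is bounded along a path, while the approximation
  \<open>h'\<close> enters through the difference of squares alone. The truncated distance is what
  convergence in probability controls.\<close>

lemma generator_diff:
  "\<bar>generator h' x' - generator h x\<bar> \<le> (\<delta> * (L + 2) + L * h\<^sup>2) * min 1 \<bar>x' - x\<bar> + L * \<bar>h'\<^sup>2 - h\<^sup>2\<bar>"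
proof -
  define m where "m = min 1 \<bar>x' - x\<bar>"
  have 1: "\<bar>f' x' - f' x\<bar> \<le> (L + 2) * m"
  proof (cases "\<bar>x' - x\<bar> \<le> 1")
    case True
    then have m: "m = \<bar>x' - x\<bar>" by (simp add: m_def)
    have "\<bar>f' x' - f' x\<bar> \<le> L * m" unfolding m by (rule deriv1_Lipschitz)
    moreover have "0 \<le> m" by (simp add: m_def)
    ultimately show ?thesis unfolding distrib_right by linarith
  next
    case False
    then have "m = 1" by (simp add: m_def)
    then show ?thesis using abs_triangle_ineq4[of "f' x'" "f' x"] deriv1_bound[of x] deriv1_bound[of x'] L_nonneg by simp
  qed
  have 2: "\<bar>f'' x' - f'' x\<bar> \<le> 2 * L * m"
  proof (cases "\<bar>x' - x\<bar> \<le> 1")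
    case True
    then have m: "m = \<bar>x' - x\<bar>" by (simp add: m_def)
    have "0 \<le> L * \<bar>x' - x\<bar>" using L_nonneg by simp
    then show ?thesis using deriv2_Lipschitz[of x' x] unfolding m by linarith
  next
    case False
    then have "m = 1" by (simp add: m_def)
    then show ?thesis using abs_triangle_ineq4[of "f'' x'" "f'' x"] deriv2_bound[of x] deriv2_bound[of x'] by simp
  qed
  have "generator h' x' - generator h x
      = \<delta> * (f' x' - f' x) + f'' x' / 2 * (h'\<^sup>2 - h\<^sup>2) + (f'' x' - f'' x) / 2 * h\<^sup>2"
    by (simp add: generator_def algebra_simps diff_divide_distrib)
  also have "\<bar>\<dots>\<bar> \<le> \<delta> * \<bar>f' x' - f' x\<bar> + \<bar>f'' x' / 2\<bar> * \<bar>h'\<^sup>2 - h\<^sup>2\<bar> + \<bar>f'' x' - f'' x\<bar> / 2 * h\<^sup>2"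
    using drift_nonneg
    by (intro order_trans[OF abs_triangle_ineq] add_mono) (auto simp: abs_mult)
  also have "\<dots> \<le> \<delta> * ((L + 2) * m) + L * \<bar>h'\<^sup>2 - h\<^sup>2\<bar> + (2 * L * m) / 2 * h\<^sup>2"
    using 1 2 drift_nonneg deriv2_bound[of x'] by (intro add_mono mult_left_mono mult_right_mono divide_right_mono) auto
  finally show ?thesis by (simp add: m_def algebra_simps)
qed

text \<open>This is applied for one sample point, with time as the measure space. Since
  \<open>h\<close> is bounded, L2 convergence of \<open>s\<close> gives L1 convergence of the
  squares; by hypothesis that distance also controls the weights uniformly.\<close>

lemma weighted_generator_limit:
  fixes x w s :: "nat \<Rightarrow> 'b \<Rightarrow> real"
  assumes "finite_measure N"
    and [measurable]: "\<And>k. x k \<in> borel_measurable N" "\<And>k. w k \<in> borel_measurable N" "\<And>k. s k \<in> borel_measurable N"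
      "z \<in> borel_measurable N" "w' \<in> borel_measurable N" "h \<in> borel_measurable N"
    and h: "\<And>u. u \<in> space N \<Longrightarrow> \<bar>h u\<bar> \<le> K"
    and s: "\<And>k. integrable N (\<lambda>u. (s k u - h u)\<^sup>2)" "(\<lambda>k. \<integral>u. (s k u - h u)\<^sup>2 \<partial>N) \<longlonglongrightarrow> 0"
    and x: "(\<lambda>k. \<integral>u. min 1 \<bar>x k u - z u\<bar> \<partial>N) \<longlonglongrightarrow> 0"
    and w: "\<And>k u. u \<in> space N \<Longrightarrow> 0 \<le> w k u" "\<And>k u. u \<in> space N \<Longrightarrow> w k u \<le> 1"
      "\<And>u. u \<in> space N \<Longrightarrow> 0 \<le> w' u" "\<And>u. u \<in> space N \<Longrightarrow> w' u \<le> 1"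
      "\<And>k u. u \<in> space N \<Longrightarrow> \<bar>w k u - w' u\<bar> \<le> (\<integral>u. \<bar>(s k u)\<^sup>2 - (h u)\<^sup>2\<bar> \<partial>N)"
  shows "(\<lambda>k. \<integral>u. \<bar>(s k u)\<^sup>2 - (h u)\<^sup>2\<bar> \<partial>N) \<longlonglongrightarrow> 0"
    and "(\<lambda>k. \<integral>u. w k u * generator (s k u) (x k u) \<partial>N) \<longlonglongrightarrow> (\<integral>u. w' u * generator (h u) (z u) \<partial>N)"
proof -
  interpret N: finite_measure N by fact
  define m where "m = measure N (space N)"
  define v where "v k = (\<integral>u. (s k u - h u)\<^sup>2 \<partial>N)" for k
  define q where "q k = (\<integral>u. \<bar>(s k u)\<^sup>2 - (h u)\<^sup>2\<bar> \<partial>N)" for k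
  have m: "0 \<le> m" by (simp add: m_def)
  have h2: "(h u)\<^sup>2 \<le> K\<^sup>2" if "u \<in> space N" for u
    using h[OF that] abs_le_square_iff[of "h u" K] by auto
  \<comment> \<open>The free parameter makes the coefficient of \<open>b\<^sup>2\<close> small
    before the L2 distance is sent to 0, so that only the bound on \<open>h\<close> enters and none
    on \<open>s k\<close>.\<close>
  have Young: "\<bar>a\<^sup>2 - b\<^sup>2\<bar> \<le> (1 + 1 / \<eta>) * (a - b)\<^sup>2 + \<eta> * b\<^sup>2" if "0 < \<eta>" for a b \<eta> :: real
  proof -
    define c where "c = \<bar>a - b\<bar>"
    have "a\<^sup>2 - b\<^sup>2 = (a - b)\<^sup>2 + 2 * b * (a - b)" by (simp add: power2_eq_square algebra_simps)
    then have "\<bar>a\<^sup>2 - b\<^sup>2\<bar> \<le> (a - b)\<^sup>2 + 2 * \<bar>b\<bar> * c"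
      by (metis abs_triangle_ineq abs_mult abs_numeral abs_power2 c_def)
    moreover have "0 \<le> (c - \<eta> * \<bar>b\<bar>)\<^sup>2 / \<eta>" using that by simp
    then have "2 * \<bar>b\<bar> * c \<le> c\<^sup>2 / \<eta> + \<eta> * b\<^sup>2"
      using that by (simp add: power2_diff power_mult_distrib field_simps power2_eq_square)
    ultimately show ?thesis by (simp add: c_def algebra_simps)
  qed
  have int_h2: "integrable N (\<lambda>u. (h u)\<^sup>2)"
    using h2 by (intro N.integrable_const_bound[of _ "K\<^sup>2"] AE_I2) auto
  have int_q: "integrable N (\<lambda>u. \<bar>(s k u)\<^sup>2 - (h u)\<^sup>2\<bar>)" for k
  proof (rule Bochner_Integration.integrable_bound)
    show "integrable N (\<lambda>u. (1 + 1 / 1) * (s k u - h u)\<^sup>2 + 1 * (h u)\<^sup>2)"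
      using s(1) int_h2 by auto
    show "AE u in N. norm \<bar>(s k u)\<^sup>2 - (h u)\<^sup>2\<bar> \<le> norm ((1 + 1 / 1) * (s k u - h u)\<^sup>2 + 1 * (h u)\<^sup>2)"
      using Young[of 1] by (auto intro!: AE_I2 elim!: order_trans)
  qed measurable
  have q_nonneg: "0 \<le> q k" for k unfolding q_def by simp
  have q_le: "q k \<le> (1 + 1 / \<eta>) * v k + \<eta> * (K\<^sup>2 * m)" if "0 < \<eta>" for k \<eta>
  proof -
    have "q k \<le> (\<integral>u. (1 + 1 / \<eta>) * (s k u - h u)\<^sup>2 + \<eta> * K\<^sup>2 \<partial>N)"
      unfolding q_def
    proof (rule integral_mono)
      show "integrable N (\<lambda>u. (1 + 1 / \<eta>) * (s k u - h u)\<^sup>2 + \<eta> * K\<^sup>2)" using s(1) by auto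
      fix u assume "u \<in> space N"
      then have "\<eta> * (h u)\<^sup>2 \<le> \<eta> * K\<^sup>2" using h2 that by (intro mult_left_mono) auto
      then show "\<bar>(s k u)\<^sup>2 - (h u)\<^sup>2\<bar> \<le> (1 + 1 / \<eta>) * (s k u - h u)\<^sup>2 + \<eta> * K\<^sup>2"
        using Young[OF that, of "s k u" "h u"] by linarith
    qed (rule int_q)
    also have "\<dots> = (1 + 1 / \<eta>) * v k + \<eta> * (K\<^sup>2 * m)"
      using s(1)[of k] by (simp add: v_def m_def)
    finally show ?thesis .
  qed
  have q_lim: "q \<longlonglongrightarrow> 0"
  proof (rule LIMSEQ_I)
    fix r :: real assume r: "0 < r"
    \<comment> \<open>Half of \<open>r\<close> goes to the term with \<open>K\<^sup>2 * m\<close>;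
      the 1 keeps the denominator positive.\<close>
    define \<eta> where "\<eta> = r / (2 * (K\<^sup>2 * m + 1))"
    have pos: "0 < K\<^sup>2 * m + 1" using m by (intro add_nonneg_pos) auto
    then have \<eta>: "0 < \<eta>" using r by (simp add: \<eta>_def)
    have "\<eta> * (K\<^sup>2 * m) \<le> \<eta> * (K\<^sup>2 * m + 1)" using \<eta> by simp
    also have "\<dots> = r / 2"
    proof -
      have "r / (2 * c) * c = r / 2" if "0 < c" for c using that by simp
      from this[OF pos] show ?thesis by (simp only: \<eta>_def)
    qed
    finally have small: "\<eta> * (K\<^sup>2 * m) \<le> r / 2" .
    have "(\<lambda>k. (1 + 1 / \<eta>) * v k) \<longlonglongrightarrow> (1 + 1 / \<eta>) * 0"
      using s(2) unfolding v_def by (intro tendsto_intros)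
    then have "eventually (\<lambda>k. (1 + 1 / \<eta>) * v k < r / 2) sequentially"
      using r by (intro order_tendstoD(2)[of _ 0]) auto
    then have "eventually (\<lambda>k. norm (q k - 0) < r) sequentially"
    proof eventually_elim
      case (elim k)
      then have "q k < r" using q_le[OF \<eta>, of k] small by linarith
      then show ?case using q_nonneg[of k] by simp
    qed
    then show "\<exists>no. \<forall>n\<ge>no. norm (q n - 0) < r" by (simp add: eventually_sequentially)
  qed
  then show "(\<lambda>k. \<integral>u. \<bar>(s k u)\<^sup>2 - (h u)\<^sup>2\<bar> \<partial>N) \<longlonglongrightarrow> 0" by (simp add: q_def[abs_def])
  define c where "c = \<delta> * (L + 2) + L * K\<^sup>2"
  define d where "d = \<delta> + L * K\<^sup>2"
  have [measurable]: "(\<lambda>u. generator (h u) (z u)) \<in> borel_measurable N"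
    "(\<lambda>u. generator (s k u) (x k u)) \<in> borel_measurable N" for k
    unfolding generator_def by measurable
  have pw: "\<bar>w k u * generator (s k u) (x k u) - w' u * generator (h u) (z u)\<bar>
      \<le> c * min 1 \<bar>x k u - z u\<bar> + L * \<bar>(s k u)\<^sup>2 - (h u)\<^sup>2\<bar> + d * q k" if u: "u \<in> space N" for k u
  proof -
    \<comment> \<open>The products are split so that the difference of the weights meets the limit
      generator, which is bounded by \<open>d\<close>.\<close>
    have "w k u * generator (s k u) (x k u) - w' u * generator (h u) (z u)
      = w k u * (generator (s k u) (x k u) - generator (h u) (z u)) + (w k u - w' u) * generator (h u) (z u)"
      by (simp add: algebra_simps)
    also have "\<bar>\<dots>\<bar> \<le> \<bar>w k u\<bar> * \<bar>generator (s k u) (x k u) - generator (h u) (z u)\<bar> + \<bar>w k u - w' u\<bar> * \<bar>generator (h u) (z u)\<bar>"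
      by (intro order_trans[OF abs_triangle_ineq] add_mono) (auto simp: abs_mult)
    also have "\<dots> \<le> 1 * ((\<delta> * (L + 2) + L * (h u)\<^sup>2) * min 1 \<bar>x k u - z u\<bar> + L * \<bar>(s k u)\<^sup>2 - (h u)\<^sup>2\<bar>) + q k * d"
      unfolding d_def
      using w(1,2)[OF u, of k] w(5)[OF u, of k] q_nonneg[of k]
      by (intro add_mono mult_mono generator_diff generator_bound h u) (auto simp: q_def)
    also have "(\<delta> * (L + 2) + L * (h u)\<^sup>2) * min 1 \<bar>x k u - z u\<bar> \<le> c * min 1 \<bar>x k u - z u\<bar>"
      unfolding c_def using h2[OF u] L_nonneg by (intro mult_right_mono add_left_mono mult_left_mono) auto
    finally show ?thesis by (simp add: algebra_simps)
  qed
  have int_m: "integrable N (\<lambda>u. min 1 \<bar>x k u - z u\<bar>)" for k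
    by (intro N.integrable_const_bound[of _ 1] AE_I2) auto
  have int_bound: "integrable N (\<lambda>u. c * min 1 \<bar>x k u - z u\<bar> + L * \<bar>(s k u)\<^sup>2 - (h u)\<^sup>2\<bar> + d * q k)" for k
    using int_m int_q by auto
  have int_w': "integrable N (\<lambda>u. w' u * generator (h u) (z u))"
  proof (intro N.integrable_const_bound[of _ d] AE_I2)
    fix u assume u: "u \<in> space N"
    then have "\<bar>w' u\<bar> * \<bar>generator (h u) (z u)\<bar> \<le> 1 * d"
      unfolding d_def using w(3,4) by (intro mult_mono generator_bound h) auto
    then show "norm (w' u * generator (h u) (z u)) \<le> d" by (simp add: abs_mult)
  qed measurable
  have int_diff: "integrable N (\<lambda>u. w k u * generator (s k u) (x k u) - w' u * generator (h u) (z u))" for k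
    by (rule Bochner_Integration.integrable_bound[OF int_bound[of k]])
      (auto intro!: AE_I2 pw[THEN order_trans, OF _ abs_ge_self])
  have int_w: "integrable N (\<lambda>u. w k u * generator (s k u) (x k u))" for k
    using Bochner_Integration.integrable_add[OF int_diff[of k] int_w'] by simp
  have bound: "norm ((\<integral>u. w k u * generator (s k u) (x k u) \<partial>N) - (\<integral>u. w' u * generator (h u) (z u) \<partial>N))
      \<le> c * (\<integral>u. min 1 \<bar>x k u - z u\<bar> \<partial>N) + L * q k + d * q k * m" for k
  proof -
    have "norm ((\<integral>u. w k u * generator (s k u) (x k u) \<partial>N) - (\<integral>u. w' u * generator (h u) (z u) \<partial>N))
      = norm (\<integral>u. w k u * generator (s k u) (x k u) - w' u * generator (h u) (z u) \<partial>N)"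
      using int_w int_w' by simp
    also have "\<dots> \<le> (\<integral>u. norm (w k u * generator (s k u) (x k u) - w' u * generator (h u) (z u)) \<partial>N)"
      by (rule integral_norm_bound)
    also have "\<dots> \<le> (\<integral>u. c * min 1 \<bar>x k u - z u\<bar> + L * \<bar>(s k u)\<^sup>2 - (h u)\<^sup>2\<bar> + d * q k \<partial>N)"
      using int_diff int_bound pw by (intro integral_mono) auto
    also have "\<dots> = c * (\<integral>u. min 1 \<bar>x k u - z u\<bar> \<partial>N) + L * q k + d * q k * m"
      using int_m int_q by (simp add: q_def m_def)
    finally show ?thesis .
  qed
  have "(\<lambda>k. c * (\<integral>u. min 1 \<bar>x k u - z u\<bar> \<partial>N) + L * q k + d * q k * m) \<longlonglongrightarrow> c * 0 + L * 0 + d * 0 * m"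
    by (intro tendsto_intros x q_lim)
  then have "(\<lambda>k. c * (\<integral>u. min 1 \<bar>x k u - z u\<bar> \<partial>N) + L * q k + d * q k * m) \<longlonglongrightarrow> 0"
    by simp
  then have "(\<lambda>k. (\<integral>u. w k u * generator (s k u) (x k u) \<partial>N) - (\<integral>u. w' u * generator (h u) (z u) \<partial>N)) \<longlonglongrightarrow> 0"
    by (rule Lim_null_comparison[OF always_eventually[OF allI[OF bound]]])
  then show "(\<lambda>k. \<integral>u. w k u * generator (s k u) (x k u) \<partial>N) \<longlonglongrightarrow> (\<integral>u. w' u * generator (h u) (z u) \<partial>N)"
    using LIM_zero_iff by blast
qed

end

text \<open>Truncation turns convergence in probability into L1 convergence, from which an almost
  surely convergent subsequence can later be extracted.\<close>

lemma (in prob_space) expectation_min_1_tendsto_0: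
  fixes Y :: "nat \<Rightarrow> 'a \<Rightarrow> real"
  assumes Y [measurable]: "\<And>k. Y k \<in> borel_measurable M" and nonneg: "\<And>k \<omega>. \<omega> \<in> space M \<Longrightarrow> 0 \<le> Y k \<omega>"
    and lim: "\<And>\<epsilon>. 0 < \<epsilon> \<Longrightarrow> (\<lambda>k. prob {\<omega>\<in>space M. Y k \<omega> > \<epsilon>}) \<longlonglongrightarrow> 0"
  shows "(\<lambda>k. expectation (\<lambda>\<omega>. min 1 (Y k \<omega>))) \<longlonglongrightarrow> 0"
proof (rule LIMSEQ_I)
  fix r :: real assume "0 < r"
  then have "eventually (\<lambda>k. prob {\<omega>\<in>space M. Y k \<omega> > r / 2} < r / 2) sequentially"
    using lim[of "r / 2"] by (intro order_tendstoD(2)[of _ 0]) auto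
  then have "eventually (\<lambda>k. norm (expectation (\<lambda>\<omega>. min 1 (Y k \<omega>)) - 0) < r) sequentially"
  proof eventually_elim
    case (elim k)
    let ?A = "{\<omega>\<in>space M. Y k \<omega> > r / 2}"
    have "expectation (\<lambda>\<omega>. min 1 (Y k \<omega>)) \<le> expectation (\<lambda>\<omega>. r / 2 + indicator ?A \<omega>)"
    proof (rule integral_mono)
      show "integrable M (\<lambda>\<omega>. min 1 (Y k \<omega>))"
        using nonneg by (intro integrable_const_bound[of _ 1] AE_I2) auto
      show "integrable M (\<lambda>\<omega>. r / 2 + indicator ?A \<omega>)"
        by (intro Bochner_Integration.integrable_add integrable_const integrable_real_indicator) (auto simp: emeasure_eq_measure)
      show "min 1 (Y k \<omega>) \<le> r / 2 + indicator ?A \<omega>" if "\<omega> \<in> space M" for \<omega>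
        using that \<open>0 < r\<close> by (auto split: split_indicator)
    qed
    also have "\<dots> = r / 2 + expectation (indicator ?A)"
      by (subst Bochner_Integration.integral_add) (auto simp: prob_space emeasure_eq_measure)
    also have "expectation (indicator ?A) = prob ?A"
      by (subst Bochner_Integration.integral_indicator) (auto intro: arg_cong[where f = prob])
    also have "r / 2 + prob ?A < r" using elim by linarith
    finally have "expectation (\<lambda>\<omega>. min 1 (Y k \<omega>)) < r" .
    moreover have "0 \<le> expectation (\<lambda>\<omega>. min 1 (Y k \<omega>))"
      using nonneg by (intro Bochner_Integration.integral_nonneg_AE AE_I2) auto
    ultimately show ?case by simp
  qed
  then show "\<exists>no. \<forall>k\<ge>no. norm (expectation (\<lambda>\<omega>. min 1 (Y k \<omega>)) - 0) < r"
    by (simp add: eventually_sequentially)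
qed

lemma continuous_on_atLeast_if_compact:
  fixes g :: "real \<Rightarrow> 'a::topological_space"
  assumes "\<And>b. a \<le> b \<Longrightarrow> continuous_on {a..b} g"
  shows "continuous_on {a..} g"
  unfolding continuous_on_eq_continuous_within
proof
  fix x assume x: "x \<in> {a..}"
  then have "continuous (at x within {a..x + 1}) g"
    using assms[of "x + 1"] by (auto simp: continuous_on_eq_continuous_within)
  moreover have "at x within {a..} = at x within {a..x + 1}"
    by (rule at_within_nhd[of x "{..<x + 1}"]) auto
  ultimately show "continuous (at x within {a..}) g" by (simp add: continuous_within)
qed

lemma simple_integral_continuous:
  assumes "simple_process M F S" and B: "continuous_on {0..} (\<lambda>u. B u \<omega>)"
  shows "continuous_on {0..} (\<lambda>u. simple_integral B S u \<omega>)"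
proof -
  obtain n \<tau> \<xi> where S: "S = (n, \<tau>, \<xi>)" by (cases S)
  have "continuous_on {0..} (\<lambda>u. B (min u (\<tau> i)) \<omega>)" if "i \<le> n" for i
    using simple_process_grid_nonneg[OF assms(1)[unfolded S] that]
    by (intro continuous_on_compose2[OF B]) (auto intro!: continuous_intros)
  then show ?thesis
    unfolding S simple_integral_def prod.case by (intro continuous_intros) auto
qed

lemma (in filtered_prob_space) simple_integral_measurable:
  assumes "simple_process M F S" and B: "\<And>u. 0 \<le> u \<Longrightarrow> B u \<in> borel_measurable M" and "0 \<le> u"
  shows "simple_integral B S u \<in> borel_measurable M"
proof -
  obtain n \<tau> \<xi> where S: "S = (n, \<tau>, \<xi>)" by (cases S)
  have eq: "simple_integral B S u = (\<lambda>\<omega>. \<Sum>i<n. \<xi> i \<omega> * (B (min u (\<tau> (Suc i))) \<omega> - B (min u (\<tau> i)) \<omega>))"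
    by (auto simp: S simple_integral_def)
  have \<xi>: "\<xi> i \<in> borel_measurable M" if "i < n" for i
    using assms(1) that measurable_from_F[of "\<xi> i" "\<tau> i"] by (auto simp: S simple_process_def)
  have "B (min u (\<tau> i)) \<in> borel_measurable M" if "i \<le> n" for i
    using simple_process_grid_nonneg[OF assms(1)[unfolded S] that] \<open>0 \<le> u\<close> by (intro B) auto
  then show ?thesis
    unfolding eq using \<xi> by (intro borel_measurable_sum borel_measurable_times borel_measurable_diff) auto
qed

section \<open>Approximations weighted by killing and by their quadratic variation\<close>

locale killed_process = brownian_test M F B f f' f'' L \<delta>
  for M :: "'a measure" and F B f f' f'' L \<delta> +
  fixes Z :: "real \<Rightarrow> 'a \<Rightarrow> real" and \<kappa> :: "real \<Rightarrow> real"
  assumes Z_adapted: "\<And>u. 0 \<le> u \<Longrightarrow> Z u \<in> borel_measurable (F u)"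
    and Z_continuous: "\<And>\<omega>. \<omega> \<in> space M \<Longrightarrow> continuous_on {0..} (\<lambda>u. Z u \<omega>)"
    and \<kappa>_continuous: "continuous_on UNIV \<kappa>"
    and \<kappa>_nonneg: "\<And>z. 0 \<le> \<kappa> z"
begin

definition killing :: "real \<Rightarrow> 'a \<Rightarrow> real" where
  "killing u \<omega> = integral {0..u} (\<lambda>s. \<kappa> (Z s \<omega>))"

text \<open>The killing is read off from \<open>Z\<close> and is common to all approximations. The
  quadratic variation is that of \<open>S\<close> itself, because only a factor matched to
  \<open>S\<close> bounds the weighted time integral of the squared simple process by 1.\<close>

definition weight :: "'a step_data \<Rightarrow> real \<Rightarrow> 'a \<Rightarrow> real" where
  "weight S u \<omega> = exp (- killing u \<omega> - quadratic_variation S u \<omega>)"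

lemma Z_measurable: "0 \<le> u \<Longrightarrow> Z u \<in> borel_measurable M"
  using Z_adapted measurable_from_F by blast

lemma \<kappa>_Z_continuous: "\<omega> \<in> space M \<Longrightarrow> continuous_on {0..u} (\<lambda>s. \<kappa> (Z s \<omega>))"
  by (rule continuous_on_compose2[OF \<kappa>_continuous continuous_on_subset[OF Z_continuous]]) auto

lemma \<kappa>_Z_integrable: "\<omega> \<in> space M \<Longrightarrow> 0 \<le> a \<Longrightarrow> (\<lambda>s. \<kappa> (Z s \<omega>)) integrable_on {a..b}"
  by (rule integrable_on_subinterval[OF integrable_continuous_real[OF \<kappa>_Z_continuous[of \<omega> b]]]) auto

lemma killing_nonneg: "\<omega> \<in> space M \<Longrightarrow> 0 \<le> killing u \<omega>"
  unfolding killing_def by (intro Henstock_Kurzweil_Integration.integral_nonneg \<kappa>_Z_integrable) (auto simp: \<kappa>_nonneg)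

lemma killing_mono: "\<omega> \<in> space M \<Longrightarrow> u \<le> v \<Longrightarrow> killing u \<omega> \<le> killing v \<omega>"
  unfolding killing_def by (intro integral_subset_le \<kappa>_Z_integrable) (auto simp: \<kappa>_nonneg)

lemma killing_continuous: "\<omega> \<in> space M \<Longrightarrow> continuous_on {0..} (\<lambda>u. killing u \<omega>)"
  unfolding killing_def
  by (intro continuous_on_atLeast_if_compact indefinite_integral_continuous_1 \<kappa>_Z_integrable) auto

lemma killing_adapted:
  assumes "0 \<le> u" shows "killing u \<in> borel_measurable (F u)"
proof -
  interpret T: finite_measure "time_measure u" by (rule finite_measure_time_measure)
  have "(\<lambda>(s, \<omega>). Z s \<omega>) \<in> borel_measurable (time_measure u \<Otimes>\<^sub>M F u)"
  proof (rule measurable_pair_continuous_paths[OF assms])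
    show "Z s \<in> borel_measurable (F u)" if "0 \<le> s" "s \<le> u" for s
      by (rule measurable_F_mono[OF that(2) Z_adapted[OF that(1)]])
    show "continuous_on {0..u} (\<lambda>s. Z s \<omega>)" if "\<omega> \<in> space (F u)" for \<omega>
      using Z_continuous[of \<omega>] that continuous_on_subset by (fastforce simp: space_F)
  qed
  then have [measurable]: "(\<lambda>(\<omega>, s). Z s \<omega>) \<in> borel_measurable (F u \<Otimes>\<^sub>M time_measure u)"
    by (subst measurable_pair_swap_iff) (simp add: case_prod_beta')
  have [measurable]: "\<kappa> \<in> borel_measurable borel" by (rule borel_measurable_continuous_onI[OF \<kappa>_continuous])
  have "(\<lambda>\<omega>. \<integral>s. \<kappa> (Z s \<omega>) \<partial>time_measure u) \<in> borel_measurable (F u)"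
    by measurable
  moreover have "killing u \<omega> = (\<integral>s. \<kappa> (Z s \<omega>) \<partial>time_measure u)" if "\<omega> \<in> space (F u)" for \<omega>
    unfolding killing_def using that
    by (intro integral_time_measure integrable_time_measure_continuous \<kappa>_Z_continuous) (simp add: space_F)
  ultimately show ?thesis by (subst measurable_cong) auto
qed

lemma weight_properties:
  assumes "simple_process M F S"
  shows "0 \<le> u \<Longrightarrow> weight S u \<in> borel_measurable (F u)"
    and "0 \<le> weight S u \<omega>"
    and "0 \<le> u \<Longrightarrow> \<omega> \<in> space M \<Longrightarrow> weight S u \<omega> \<le> exp (- quadratic_variation S u \<omega>)"
    and "0 \<le> u \<Longrightarrow> \<omega> \<in> space M \<Longrightarrow> weight S u \<omega> \<le> 1"
    and "u \<le> v \<Longrightarrow> \<omega> \<in> space M \<Longrightarrow> weight S v \<omega> \<le> weight S u \<omega>"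
    and "\<omega> \<in> space M \<Longrightarrow> continuous_on {0..} (\<lambda>u. weight S u \<omega>)"
proof -
  show "weight S u \<in> borel_measurable (F u)" if "0 \<le> u"
    using killing_adapted[OF that] quadratic_variation_adapted[OF assms that] unfolding weight_def by measurable
  show "0 \<le> weight S u \<omega>" by (simp add: weight_def)
  show 1: "weight S u \<omega> \<le> exp (- quadratic_variation S u \<omega>)" if "0 \<le> u" "\<omega> \<in> space M"
    using killing_nonneg[OF that(2), of u] by (simp add: weight_def)
  show "weight S u \<omega> \<le> 1" if "0 \<le> u" "\<omega> \<in> space M"
    using 1[OF that] quadratic_variation_mono[OF assms that(1), of \<omega>] quadratic_variation_0[OF assms, of \<omega>]
    by (auto intro: order_trans)
  show "weight S v \<omega> \<le> weight S u \<omega>" if "u \<le> v" "\<omega> \<in> space M"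
    using killing_mono[OF that(2,1)] quadratic_variation_mono[OF assms that(1), of \<omega>] by (simp add: weight_def)
  show "continuous_on {0..} (\<lambda>u. weight S u \<omega>)" if "\<omega> \<in> space M"
    unfolding weight_def by (intro continuous_intros killing_continuous continuous_on_quadratic_variation that)
qed

lemma weight_pair_measurable:
  assumes "simple_process M F S" "0 \<le> t"
  shows "(\<lambda>(u, \<omega>). weight S u \<omega>) \<in> borel_measurable (time_measure t \<Otimes>\<^sub>M M)"
proof (rule measurable_pair_continuous_paths[OF assms(2)])
  show "weight S u \<in> borel_measurable M" if "0 \<le> u" for u
    using weight_properties(1)[OF assms(1) that] measurable_from_F by blast
  show "continuous_on {0..t} (\<lambda>u. weight S u \<omega>)" if "\<omega> \<in> space M" for \<omega>
    using weight_properties(6)[OF assms(1) that] continuous_on_subset by fastforce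
qed

lemma generator_le: "\<bar>generator h x\<bar> \<le> \<delta> + L * h\<^sup>2"
  using generator_bound[of h "\<bar>h\<bar>" x] by simp

text \<open>The bound on \<open>R\<close> is independent of \<open>S\<close>, so it can serve as
  dominating constant in the limit. The Ito inequality concerns the adapted \<open>B\<close>, while
  joint measurability and Fubini want the continuous paths of \<open>B'\<close>; the two agree
  almost surely.\<close>

lemma killed_inequality:
  assumes S: "simple_process M F S" and t: "0 \<le> t"
    and B': "\<And>u. 0 \<le> u \<Longrightarrow> B' u \<in> borel_measurable M"
      "\<And>\<omega>. continuous_on {0..} (\<lambda>u. B' u \<omega>)" "AE \<omega> in M. \<forall>u. B' u \<omega> = B u \<omega>"
  defines "X \<equiv> \<lambda>u \<omega>. \<delta> * u + simple_integral B' S u \<omega>"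
  defines "R \<equiv> \<lambda>\<omega>. \<integral>u. weight S u \<omega> * generator (simple_value S u \<omega>) (X u \<omega>) \<partial>time_measure t"
  shows "(\<lambda>(u, \<omega>). X u \<omega>) \<in> borel_measurable (time_measure t \<Otimes>\<^sub>M M)"
    and "R \<in> borel_measurable M"
    and "\<omega> \<in> space M \<Longrightarrow> \<bar>R \<omega>\<bar> \<le> \<delta> * t + L"
    and "integrable M (\<lambda>\<omega>. weight S t \<omega> * f (X t \<omega>))"
    and "expectation (\<lambda>\<omega>. weight S t \<omega> * f (X t \<omega>)) \<le> f 0 + expectation R"
proof -
  interpret T: finite_measure "time_measure t" by (rule finite_measure_time_measure)
  interpret P: pair_sigma_finite "time_measure t" M ..
  interpret TM: finite_measure "time_measure t \<Otimes>\<^sub>M M"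
    by (intro finite_measure_pair_measure finite_measure_time_measure finite_measure_axioms)
  have X: "X u \<in> borel_measurable M" if "0 \<le> u" for u
    using simple_integral_measurable[OF S B'(1) that] unfolding X_def by measurable
  have X_cont: "continuous_on {0..} (\<lambda>u. X u \<omega>)" for \<omega>
    unfolding X_def by (intro continuous_intros simple_integral_continuous[OF S] B'(2))
  show X_pair: "(\<lambda>(u, \<omega>). X u \<omega>) \<in> borel_measurable (time_measure t \<Otimes>\<^sub>M M)"
    by (rule measurable_pair_continuous_paths[OF t X]) (auto intro: continuous_on_subset[OF X_cont])
  note [measurable] = X_pair weight_pair_measurable[OF S t] simple_value_measurable(1)[OF S, of t]
  define \<psi> where "\<psi> u \<omega> = weight S u \<omega> * generator (simple_value S u \<omega>) (X u \<omega>)" for u \<omega>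
  have \<psi>_pair [measurable]: "(\<lambda>(u, \<omega>). \<psi> u \<omega>) \<in> borel_measurable (time_measure t \<Otimes>\<^sub>M M)"
    unfolding \<psi>_def generator_def by measurable
  have \<psi>_swap [measurable]: "(\<lambda>(\<omega>, u). \<psi> u \<omega>) \<in> borel_measurable (M \<Otimes>\<^sub>M time_measure t)"
    by (subst measurable_pair_swap_iff) (use \<psi>_pair in \<open>simp add: case_prod_beta'\<close>)
  show "R \<in> borel_measurable M"
    unfolding R_def \<psi>_def[symmetric] by measurable
  \<comment> \<open>This constant depends on \<open>S\<close> and is good for integrability alone;
    the uniform bound will come from \<open>?q\<close>.\<close>
  obtain C where C: "\<And>u \<omega>. \<omega> \<in> space M \<Longrightarrow> \<bar>simple_value S u \<omega>\<bar> \<le> C"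
    using simple_value_measurable(2)[OF S] by blast
  have \<psi>_bound: "\<bar>\<psi> u \<omega>\<bar> \<le> \<delta> + L * C\<^sup>2" if "u \<in> {0..t}" "\<omega> \<in> space M" for u \<omega>
  proof -
    have "\<bar>weight S u \<omega>\<bar> * \<bar>generator (simple_value S u \<omega>) (X u \<omega>)\<bar> \<le> 1 * (\<delta> + L * C\<^sup>2)"
      using weight_properties(2,4)[OF S, of u \<omega>] that by (intro mult_mono generator_bound C) auto
    then show ?thesis by (simp add: \<psi>_def abs_mult)
  qed
  have \<psi>_int: "integrable (time_measure t \<Otimes>\<^sub>M M) (\<lambda>(u, \<omega>). \<psi> u \<omega>)"
    by (rule TM.integrable_const_bound[of _ "\<delta> + L * C\<^sup>2"])
      (use \<psi>_bound in \<open>auto intro!: AE_I2 simp: space_pair_measure\<close>)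
  show "\<bar>R \<omega>\<bar> \<le> \<delta> * t + L" if w: "\<omega> \<in> space M" for \<omega>
  proof -
    let ?q = "\<lambda>u. exp (- quadratic_variation S u \<omega>) * (simple_value S u \<omega>)\<^sup>2"
    have [measurable]: "(\<lambda>u. simple_value S u \<omega>) \<in> borel_measurable (time_measure t)"
      "(\<lambda>u. \<psi> u \<omega>) \<in> borel_measurable (time_measure t)"
      using w by measurable
    have [measurable]: "(\<lambda>u. quadratic_variation S u \<omega>) \<in> borel_measurable (time_measure t)"
      by (intro measurable_time_measure borel_measurable_continuous_onI continuous_on_quadratic_variation)
    have "integrable (time_measure t) ?q"
    proof (intro T.integrable_const_bound[of _ "C\<^sup>2"] AE_I2)
      fix u assume "u \<in> space (time_measure t)"
      then have "0 \<le> quadratic_variation S u \<omega>"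
        using quadratic_variation_mono[OF S, of 0 u \<omega>] quadratic_variation_0[OF S] by simp
      moreover have "(simple_value S u \<omega>)\<^sup>2 \<le> C\<^sup>2"
        using C[OF w, of u] abs_le_square_iff[of "simple_value S u \<omega>" C] by auto
      ultimately have "exp (- quadratic_variation S u \<omega>) * (simple_value S u \<omega>)\<^sup>2 \<le> 1 * C\<^sup>2"
        by (intro mult_mono) auto
      then show "norm (?q u) \<le> C\<^sup>2" by simp
    qed measurable
    then have q: "integrable (time_measure t) ?q" "(\<integral>u. ?q u \<partial>time_measure t) \<le> 1"
      using quadratic_variation_has_integral(2)[OF S t, of \<omega>] integral_time_measure(2)[of t ?q]
      by (auto simp: has_integral_iff)
    have "\<bar>R \<omega>\<bar> \<le> (\<integral>u. \<bar>\<psi> u \<omega>\<bar> \<partial>time_measure t)"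
      unfolding R_def \<psi>_def[symmetric] by (rule integral_abs_bound)
    also have "\<dots> \<le> (\<integral>u. \<delta> + L * ?q u \<partial>time_measure t)"
    proof (rule integral_mono)
      show "integrable (time_measure t) (\<lambda>u. \<bar>\<psi> u \<omega>\<bar>)"
        using \<psi>_bound w by (intro T.integrable_const_bound[of _ "\<delta> + L * C\<^sup>2"] AE_I2) auto
      show "integrable (time_measure t) (\<lambda>u. \<delta> + L * ?q u)" using q by auto
      fix u assume "u \<in> space (time_measure t)"
      then have u: "0 \<le> u" by simp
      have "\<bar>\<psi> u \<omega>\<bar> \<le> weight S u \<omega> * (\<delta> + L * (simple_value S u \<omega>)\<^sup>2)"
        using weight_properties(2)[OF S, of u \<omega>] by (auto simp: \<psi>_def abs_mult intro!: mult_left_mono generator_le)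
      also have "\<dots> = weight S u \<omega> * \<delta> + L * (weight S u \<omega> * (simple_value S u \<omega>)\<^sup>2)"
        by (simp add: algebra_simps)
      also have "\<dots> \<le> 1 * \<delta> + L * ?q u"
        using weight_properties(3,4)[OF S u w] drift_nonneg L_nonneg
        by (intro add_mono mult_right_mono mult_left_mono) auto
      finally show "\<bar>\<psi> u \<omega>\<bar> \<le> \<delta> + L * ?q u" by simp
    qed
    also have "\<dots> = \<delta> * t + L * (\<integral>u. ?q u \<partial>time_measure t)"
      using q t by (simp add: measure_time_measure)
    also have "\<dots> \<le> \<delta> * t + L * 1" using q L_nonneg by (intro add_left_mono mult_left_mono) auto
    finally show ?thesis by simp
  qed
  obtain n \<tau> \<xi> where S_eq: "S = (n, \<tau>, \<xi>)" by (cases S)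
  define Y where "Y u \<omega> = \<delta> * u + simple_integral B S u \<omega>" for u \<omega>
  have Y: "Y u \<in> borel_measurable M" "integrable M (Y u)" if "0 \<le> u" for u
  proof -
    note I = simple_integral_adapted[OF S[unfolded S_eq] that, folded S_eq]
    note [measurable] = measurable_from_F[OF I(1)]
    show "Y u \<in> borel_measurable M" unfolding Y_def by measurable
    show "integrable M (Y u)"
      unfolding Y_def by (intro Bochner_Integration.integrable_add integrable_const I(2))
  qed
  have XY: "AE \<omega> in M. \<forall>u. X u \<omega> = Y u \<omega>"
    using B'(3) by eventually_elim (simp add: X_def Y_def S_eq simple_integral_def)
  have wm: "weight S u \<in> borel_measurable M" if "0 \<le> u" for u
    using weight_properties(1)[OF S that] measurable_from_F by blast
  have "integrable M (X t)"
    by (rule integrable_cong_AE_imp[OF Y(2)[OF t] X[OF t]]) (use XY in eventually_elim, simp)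
  then have int_bound: "integrable M (\<lambda>\<omega>. f 0 + \<bar>X t \<omega>\<bar>)" by auto
  show "integrable M (\<lambda>\<omega>. weight S t \<omega> * f (X t \<omega>))"
  proof (rule Bochner_Integration.integrable_bound[OF int_bound])
    show "(\<lambda>\<omega>. weight S t \<omega> * f (X t \<omega>)) \<in> borel_measurable M" using X[OF t] wm[OF t] by measurable
    show "AE \<omega> in M. norm (weight S t \<omega> * f (X t \<omega>)) \<le> norm (f 0 + \<bar>X t \<omega>\<bar>)"
    proof (rule AE_I2)
      fix \<omega> assume "\<omega> \<in> space M"
      then have "\<bar>weight S t \<omega>\<bar> * \<bar>f (X t \<omega>)\<bar> \<le> 1 * (f 0 + \<bar>X t \<omega>\<bar>)"
        using weight_properties(2,4)[OF S, of t \<omega>] t by (intro mult_mono linear_growth) auto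
      then show "norm (weight S t \<omega> * f (X t \<omega>)) \<le> norm (f 0 + \<bar>X t \<omega>\<bar>)" by (simp add: abs_mult)
    qed
  qed
  have "expectation (\<lambda>\<omega>. weight S t \<omega> * f (X t \<omega>)) = expectation (\<lambda>\<omega>. weight S t \<omega> * f (Y t \<omega>))"
  proof (rule integral_cong_AE)
    show "AE \<omega> in M. weight S t \<omega> * f (X t \<omega>) = weight S t \<omega> * f (Y t \<omega>)"
      using XY by eventually_elim simp
  qed (use X[OF t] Y[OF t] wm[OF t] in auto)
  also have "\<dots> \<le> f 0 + integral {0..t} (\<lambda>u. expectation (\<lambda>\<omega>. weight S u \<omega> * generator (simple_value S u \<omega>) (Y u \<omega>)))"
    unfolding Y_def S_eq
    by (rule simple_process_inequality[OF S[unfolded S_eq] t])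
      (use weight_properties[OF S[unfolded S_eq]] in auto)
  also have "integral {0..t} (\<lambda>u. expectation (\<lambda>\<omega>. weight S u \<omega> * generator (simple_value S u \<omega>) (Y u \<omega>)))
      = integral {0..t} (\<lambda>u. expectation (\<psi> u))"
  proof (rule Henstock_Kurzweil_Integration.integral_cong)
    fix u assume u: "u \<in> {0..t}"
    have [measurable]: "(\<lambda>\<omega>. simple_value S u \<omega>) \<in> borel_measurable M" "\<psi> u \<in> borel_measurable M"
      using u measurable_Pair2[OF simple_value_measurable(1)[OF S, of t], of u] measurable_Pair2[OF \<psi>_pair, of u] by auto
    have "weight S u \<in> borel_measurable M" "Y u \<in> borel_measurable M" using wm Y(1) u by auto
    note [measurable] = this
    show "expectation (\<lambda>\<omega>. weight S u \<omega> * generator (simple_value S u \<omega>) (Y u \<omega>)) = expectation (\<psi> u)"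
    proof (rule integral_cong_AE)
      show "AE \<omega> in M. weight S u \<omega> * generator (simple_value S u \<omega>) (Y u \<omega>) = \<psi> u \<omega>"
        using XY by eventually_elim (simp add: \<psi>_def)
      show "(\<lambda>\<omega>. weight S u \<omega> * generator (simple_value S u \<omega>) (Y u \<omega>)) \<in> borel_measurable M"
        unfolding generator_def by measurable
    qed measurable
  qed
  also have "\<dots> = (\<integral>u. expectation (\<psi> u) \<partial>time_measure t)"
  proof (rule integral_time_measure(2))
    show "integrable (time_measure t) (\<lambda>u. expectation (\<psi> u))"
      using P.integrable_fst[OF \<psi>_int] by simp
  qed
  \<comment> \<open>After this exchange the right-hand side is the expectation of a pathwise time
    integral, whose limit can be taken for each sample point.\<close>
  also have "\<dots> = expectation (\<lambda>\<omega>. \<integral>u. \<psi> u \<omega> \<partial>time_measure t)"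
    by (rule P.Fubini_integral[OF \<psi>_int, symmetric])
  also have "\<dots> = expectation R" by (simp add: R_def \<psi>_def)
  finally show "expectation (\<lambda>\<omega>. weight S t \<omega> * f (X t \<omega>)) \<le> f 0 + expectation R" .
qed

end

section \<open>Passage to the limit\<close>

lemma abs_exp_diff_le:
  fixes x y :: real
  assumes "x \<le> 0" "y \<le> 0"
  shows "\<bar>exp x - exp y\<bar> \<le> \<bar>x - y\<bar>"
proof -
  have "norm (exp x - exp y) \<le> 1 * norm (x - y)"
    by (rule field_differentiable_bound[of "{..0}" exp exp])
      (use assms in \<open>auto intro: has_field_derivative_at_within\<close>)
  then show ?thesis by simp
qed

lemma tendsto_0_if_min_1:
  fixes y :: "nat \<Rightarrow> real"
  assumes "(\<lambda>k. min 1 (y k)) \<longlonglongrightarrow> 0"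
  shows "y \<longlonglongrightarrow> 0"
proof -
  have "eventually (\<lambda>k. min 1 (y k) < 1) sequentially"
    using assms by (rule order_tendstoD(2)) simp
  then have "eventually (\<lambda>k. min 1 (y k) = y k) sequentially"
    by eventually_elim (auto simp: min_def)
  with assms show ?thesis by (rule Lim_transform_eventually)
qed

context killed_process
begin

text \<open>Along a subsequence everything converges almost surely. The time integrals
  \<open>R\<close> are uniformly bounded, so their expectations converge; the left side has no such
  bound, as \<open>f\<close> may be unbounded, and passes to the limit by Fatou's lemma.\<close>

lemma killed_limit:
  assumes t: "0 \<le> t" and \<gamma>: "0 < \<gamma>"
    and Z_nonneg: "\<And>u \<omega>. 0 \<le> u \<Longrightarrow> \<omega> \<in> space M \<Longrightarrow> 0 \<le> Z u \<omega>"
    and S: "\<And>k. simple_process M F (S k)"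
    and S_lim: "\<And>\<epsilon>. 0 < \<epsilon> \<Longrightarrow> (\<lambda>k. prob {\<omega>\<in>space M.
      (\<integral>\<^sup>+u\<in>{0..t}. ennreal ((simple_value (S k) u \<omega> - Z u \<omega> powr \<gamma>)\<^sup>2) \<partial>lborel) > ennreal \<epsilon>}) \<longlonglongrightarrow> 0"
    and I_lim: "\<And>u \<epsilon>. 0 \<le> u \<Longrightarrow> 0 < \<epsilon> \<Longrightarrow>
      (\<lambda>k. prob {\<omega>\<in>space M. \<bar>simple_integral B (S k) u \<omega> - I u \<omega>\<bar> > \<epsilon>}) \<longlonglongrightarrow> 0"
    and I: "\<And>u. 0 \<le> u \<Longrightarrow> I u \<in> borel_measurable M"
    and Z_eq: "AE \<omega> in M. \<forall>u\<ge>0. Z u \<omega> = \<delta> * u + I u \<omega>"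
  defines "w \<equiv> \<lambda>u \<omega>. exp (- killing u \<omega> - integral {0..u} (\<lambda>s. (Z s \<omega> powr \<gamma>)\<^sup>2))"
  assumes c: "\<And>\<omega>. \<omega> \<in> space M \<Longrightarrow>
      (\<integral>u. w u \<omega> * generator (Z u \<omega> powr \<gamma>) (Z u \<omega>) \<partial>time_measure t) \<le> c"
  shows "(\<integral>\<^sup>+\<omega>. ennreal (w t \<omega> * f (Z t \<omega>)) \<partial>M) \<le> ennreal (f 0 + c)"
proof -
  interpret T: finite_measure "time_measure t" by (rule finite_measure_time_measure)
  interpret P: pair_sigma_finite "time_measure t" M ..
  interpret TM: finite_measure "time_measure t \<Otimes>\<^sub>M M"
    by (intro finite_measure_pair_measure finite_measure_time_measure finite_measure_axioms)
  obtain B' where B': "\<And>u. 0 \<le> u \<Longrightarrow> B' u \<in> borel_measurable M"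
    "\<And>\<omega>. continuous_on {0..} (\<lambda>u. B' u \<omega>)" "AE \<omega> in M. \<forall>u. B' u \<omega> = B u \<omega>"
    using B_regular_version by blast
  define X where "X k u \<omega> = \<delta> * u + simple_integral B' (S k) u \<omega>" for k u \<omega>
  define s where "s k u \<omega> = simple_value (S k) u \<omega>" for k u \<omega>
  define h where "h u \<omega> = Z u \<omega> powr \<gamma>" for u \<omega>
  define V where "V u \<omega> = integral {0..u} (\<lambda>s. (h s \<omega>)\<^sup>2)" for u \<omega>
  define R where "R k \<omega> = (\<integral>u. weight (S k) u \<omega> * generator (s k u \<omega>) (X k u \<omega>) \<partial>time_measure t)" for k \<omega>
  define R' where "R' \<omega> = (\<integral>u. w u \<omega> * generator (h u \<omega>) (Z u \<omega>) \<partial>time_measure t)" for \<omega>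
  have w_eq: "w u \<omega> = exp (- killing u \<omega> - V u \<omega>)" for u \<omega> by (simp add: w_def V_def h_def)
  note killed = killed_inequality[OF S t B', folded X_def s_def, folded R_def]

  have h_cont: "continuous_on {0..} (\<lambda>u. h u \<omega>)" if "\<omega> \<in> space M" for \<omega>
    unfolding h_def using Z_nonneg that \<gamma> by (intro continuous_on_powr' Z_continuous continuous_intros) auto
  have h2_int: "(\<lambda>u. (h u \<omega>)\<^sup>2) integrable_on {0..u}" if "\<omega> \<in> space M" for u \<omega>
    by (intro integrable_continuous_real continuous_intros continuous_on_subset[OF h_cont[OF that]]) auto
  have V_nonneg: "0 \<le> V u \<omega>" if "\<omega> \<in> space M" for u \<omega>
    unfolding V_def by (intro Henstock_Kurzweil_Integration.integral_nonneg h2_int that) auto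
  have V_cont: "continuous_on {0..} (\<lambda>u. V u \<omega>)" if "\<omega> \<in> space M" for \<omega>
    unfolding V_def by (intro continuous_on_atLeast_if_compact indefinite_integral_continuous_1 h2_int that)
  have w_cont: "continuous_on {0..} (\<lambda>u. w u \<omega>)" if "\<omega> \<in> space M" for \<omega>
    unfolding w_eq by (intro continuous_intros killing_continuous V_cont that)
  have w_le: "w u \<omega> \<le> 1" if "\<omega> \<in> space M" for u \<omega>
    using killing_nonneg[OF that, of u] V_nonneg[OF that, of u] by (simp add: w_eq)
  have h_bounded: "\<exists>K. \<forall>u\<in>{0..t}. \<bar>h u \<omega>\<bar> \<le> K" if "\<omega> \<in> space M" for \<omega>
  proof -
    have "compact ((\<lambda>u. h u \<omega>) ` {0..t})"
      by (intro compact_continuous_image continuous_on_subset[OF h_cont[OF that]]) auto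
    then have "bounded ((\<lambda>u. h u \<omega>) ` {0..t})" by (rule compact_imp_bounded)
    then show ?thesis by (auto simp: bounded_iff)
  qed
  have Z_pair: "(\<lambda>(u, \<omega>). Z u \<omega>) \<in> borel_measurable (time_measure t \<Otimes>\<^sub>M M)"
    by (rule measurable_pair_continuous_paths[OF t Z_measurable])
      (auto intro: continuous_on_subset[OF Z_continuous])
  have h_pair: "(\<lambda>(u, \<omega>). h u \<omega>) \<in> borel_measurable (time_measure t \<Otimes>\<^sub>M M)"
    using Z_pair unfolding h_def case_prod_beta' by measurable
  have s_pair: "(\<lambda>(u, \<omega>). s k u \<omega>) \<in> borel_measurable (time_measure t \<Otimes>\<^sub>M M)" for k
    unfolding s_def by (rule simple_value_measurable(1)[OF S])
  have swap: "(\<lambda>(\<omega>, u). Y u \<omega>) \<in> borel_measurable (M \<Otimes>\<^sub>M time_measure t')"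
    if "(\<lambda>(u, \<omega>). Y u \<omega>) \<in> borel_measurable (time_measure t' \<Otimes>\<^sub>M M)" for Y :: "real \<Rightarrow> 'a \<Rightarrow> real" and t'
    by (subst measurable_pair_swap_iff) (use that in \<open>simp add: case_prod_beta'\<close>)
  have slice: "(\<lambda>u. Y u \<omega>) \<in> borel_measurable (time_measure t)"
    if "(\<lambda>(u, \<omega>). Y u \<omega>) \<in> borel_measurable (time_measure t \<Otimes>\<^sub>M M)" "\<omega> \<in> space M" for Y :: "real \<Rightarrow> 'a \<Rightarrow> real" and \<omega>
    using measurable_Pair1[OF that] by simp
  have X_meas: "X k u \<in> borel_measurable M" if "0 \<le> u" for k u
    using simple_integral_measurable[OF S B'(1) that] unfolding X_def by measurable
  have s_bounded: "\<exists>C. \<forall>u. \<forall>\<omega>\<in>space M. \<bar>s k u \<omega>\<bar> \<le> C" for k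
    unfolding s_def by (rule simple_value_measurable(2)[OF S])

  \<comment> \<open>At each time the approximations converge in probability, hence the truncation at
    1.\<close>
  define d where "d k u \<omega> = min 1 \<bar>X k u \<omega> - Z u \<omega>\<bar>" for k u \<omega>
  define m where "m k \<omega> = (\<integral>u. d k u \<omega> \<partial>time_measure t)" for k \<omega>
  define v where "v k \<omega> = (\<integral>u. (s k u \<omega> - h u \<omega>)\<^sup>2 \<partial>time_measure t)" for k \<omega>
  have d: "0 \<le> d k u \<omega>" "d k u \<omega> \<le> 1" for k u \<omega> by (auto simp: d_def)
  have d_meas: "d k u \<in> borel_measurable M" if "0 \<le> u" for k u
    using X_meas[OF that] Z_measurable[OF that] unfolding d_def by measurable
  have d_pair: "(\<lambda>(u, \<omega>). d k u \<omega>) \<in> borel_measurable (time_measure t \<Otimes>\<^sub>M M)" for k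
    using killed(1)[of k] Z_pair unfolding d_def case_prod_beta' by measurable
  have d_lim: "(\<lambda>k. expectation (d k u)) \<longlonglongrightarrow> 0" if u: "0 \<le> u" for u
  proof -
    let ?Y = "\<lambda>k \<omega>. \<bar>simple_integral B (S k) u \<omega> - I u \<omega>\<bar>"
    have I_S: "simple_integral B (S k) u \<in> borel_measurable M" for k
      by (rule simple_integral_measurable[OF S B_measurable u])
    have "(\<lambda>k. expectation (\<lambda>\<omega>. min 1 (?Y k \<omega>))) \<longlonglongrightarrow> 0"
      using I_S I[OF u] by (intro expectation_min_1_tendsto_0 I_lim[OF u]) auto
    moreover have "expectation (\<lambda>\<omega>. min 1 (?Y k \<omega>)) = expectation (d k u)" for k
    proof (rule integral_cong_AE)
      show "AE \<omega> in M. min 1 (?Y k \<omega>) = d k u \<omega>"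
        using B'(3) Z_eq
      proof eventually_elim
        case (elim \<omega>)
        have "simple_integral B' (S k) u \<omega> = simple_integral B (S k) u \<omega>"
          using elim(1) by (cases "S k") (simp add: simple_integral_def)
        then show ?case using elim(2) u by (simp add: d_def X_def)
      qed
    qed (use I_S I[OF u] d_meas[OF u] in auto)
    ultimately show ?thesis by simp
  qed
  have d_int: "integrable (time_measure t \<Otimes>\<^sub>M M) (\<lambda>(u, \<omega>). d k u \<omega>)" for k
    by (rule TM.integrable_const_bound[where B = 1, OF _ d_pair]) (use d in \<open>auto intro!: AE_I2\<close>)
  have m_nonneg: "0 \<le> m k \<omega>" for k \<omega>
    unfolding m_def by (rule Bochner_Integration.integral_nonneg) (rule d)
  have m_int: "integrable M (m k)" for k
    unfolding m_def using P.integrable_snd[OF d_int] by simp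
  have "expectation (m k) = (\<integral>u. expectation (d k u) \<partial>time_measure t)" for k
    unfolding m_def by (rule P.Fubini_integral[OF d_int])
  \<comment> \<open>Convergence at each fixed time passes to the time integral by dominated
    convergence, with constant majorant 1.\<close>
  moreover have "(\<lambda>k. \<integral>u. expectation (d k u) \<partial>time_measure t) \<longlonglongrightarrow> (\<integral>u. 0 \<partial>time_measure t)"
  proof (rule integral_dominated_convergence[where w = "\<lambda>_. 1"])
    show "(\<lambda>u. expectation (d k u)) \<in> borel_measurable (time_measure t)" for k
      by (rule borel_measurable_lebesgue_integral) (rule d_pair)
    show "AE u in time_measure t. (\<lambda>k. expectation (d k u)) \<longlonglongrightarrow> 0"
      using d_lim by (intro AE_I2) auto
    show "AE u in time_measure t. norm (expectation (d k u)) \<le> 1" for k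
    proof (rule AE_I2)
      fix u assume "u \<in> space (time_measure t)"
      then have "\<bar>expectation (d k u)\<bar> \<le> expectation (\<lambda>_. 1)"
        using d d_meas[of u k]
        by (intro order_trans[OF integral_abs_bound] integral_mono integrable_const_bound[of _ 1] AE_I2) auto
      then show "norm (expectation (d k u)) \<le> 1" by (simp add: prob_space)
    qed
  qed auto
  ultimately have m_lim: "(\<lambda>k. expectation (m k)) \<longlonglongrightarrow> 0" by simp

  have v_meas: "v k \<in> borel_measurable M" for k
    unfolding v_def
    by (rule T.borel_measurable_lebesgue_integral)
      (use swap[OF h_pair] swap[OF s_pair[of k]] in \<open>unfold case_prod_beta', measurable\<close>)
  have v_nonneg: "0 \<le> v k \<omega>" for k \<omega>
    unfolding v_def by (rule Bochner_Integration.integral_nonneg) simp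
  have v_int: "integrable (time_measure t) (\<lambda>u. (s k u \<omega> - h u \<omega>)\<^sup>2)" if w: "\<omega> \<in> space M" for k \<omega>
  proof -
    obtain C K where CK: "\<And>u. \<bar>s k u \<omega>\<bar> \<le> C" "\<And>u. u \<in> {0..t} \<Longrightarrow> \<bar>h u \<omega>\<bar> \<le> K"
      using s_bounded[of k] h_bounded[OF w] w by blast
    show ?thesis
    proof (rule T.integrable_const_bound[of _ "(C + K)\<^sup>2"])
      show "AE u in time_measure t. norm ((s k u \<omega> - h u \<omega>)\<^sup>2) \<le> (C + K)\<^sup>2"
      proof (rule AE_I2)
        fix u assume "u \<in> space (time_measure t)"
        then have "\<bar>s k u \<omega> - h u \<omega>\<bar> \<le> \<bar>C + K\<bar>" using CK(1)[of u] CK(2)[of u] by simp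
        then show "norm ((s k u \<omega> - h u \<omega>)\<^sup>2) \<le> (C + K)\<^sup>2" by (simp add: abs_le_square_iff)
      qed
    qed (use slice[OF h_pair w] slice[OF s_pair[of k] w] in measurable)
  qed
  have v_lim: "(\<lambda>k. expectation (\<lambda>\<omega>. min 1 (v k \<omega>))) \<longlonglongrightarrow> 0"
  proof (rule expectation_min_1_tendsto_0[OF v_meas v_nonneg])
    fix \<epsilon> :: real assume "0 < \<epsilon>"
    have "(\<integral>\<^sup>+u\<in>{0..t}. ennreal ((s k u \<omega> - h u \<omega>)\<^sup>2) \<partial>lborel) = ennreal (v k \<omega>)" if "\<omega> \<in> space M" for k \<omega>
      unfolding v_def nn_integral_time_measure[symmetric]
      by (rule nn_integral_eq_integral[OF v_int[OF that]]) simp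
    then have "{\<omega>\<in>space M. (\<integral>\<^sup>+u\<in>{0..t}. ennreal ((s k u \<omega> - h u \<omega>)\<^sup>2) \<partial>lborel) > ennreal \<epsilon>} = {\<omega>\<in>space M. v k \<omega> > \<epsilon>}" for k
      using \<open>0 < \<epsilon>\<close> by (auto simp: ennreal_less_iff)
    then show "(\<lambda>k. prob {\<omega>\<in>space M. v k \<omega> > \<epsilon>}) \<longlonglongrightarrow> 0"
      using S_lim[OF \<open>0 < \<epsilon>\<close>, folded s_def h_def] by simp
  qed

  \<comment> \<open>The three summands control the states in time average, the integrands in L2 and
    the state at time \<open>t\<close>. They are nonnegative, so one subsequence along which their
    sum vanishes serves all three.\<close>
  define U where "U k \<omega> = m k \<omega> + min 1 (v k \<omega>) + d k t \<omega>" for k \<omega>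
  have v1_int: "integrable M (\<lambda>\<omega>. min 1 (v k \<omega>))" for k
    using v_nonneg v_meas[of k] by (intro integrable_const_bound[of _ 1] AE_I2) auto
  have dt_int: "integrable M (d k t)" for k
    using d d_meas[OF t] by (intro integrable_const_bound[of _ 1] AE_I2) auto
  have U_nonneg: "0 \<le> U k \<omega>" for k \<omega>
    unfolding U_def using m_nonneg v_nonneg d by (intro add_nonneg_nonneg) auto
  have U_int: "integrable M (U k)" for k
    unfolding U_def by (intro Bochner_Integration.integrable_add m_int v1_int dt_int)
  have "(\<integral>\<omega>. norm (U k \<omega>) \<partial>M) = expectation (m k) + expectation (\<lambda>\<omega>. min 1 (v k \<omega>)) + expectation (d k t)" for k
    using m_int v1_int dt_int U_nonneg by (simp add: U_def abs_of_nonneg)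
  moreover have "(\<lambda>k. expectation (m k) + expectation (\<lambda>\<omega>. min 1 (v k \<omega>)) + expectation (d k t)) \<longlonglongrightarrow> 0 + 0 + 0"
    by (intro tendsto_add m_lim v_lim d_lim t)
  ultimately have "(\<lambda>k. \<integral>\<omega>. norm (U k \<omega>) \<partial>M) \<longlonglongrightarrow> 0" by simp
  then obtain r where r: "strict_mono r" "AE \<omega> in M. (\<lambda>k. U (r k) \<omega>) \<longlonglongrightarrow> 0"
    using tendsto_L1_AE_subseq[of M U, OF U_int] by blast

  \<comment> \<open>The killing cancels, and \<open>exp\<close> is 1-Lipschitz on the negative
    half-line, so the weights differ by at most the difference of the quadratic variations. The
    resulting bound is uniform in \<open>u\<close>.\<close>
  have weight_diff: "\<bar>weight (S k) u \<omega> - w u \<omega>\<bar> \<le> (\<integral>u. \<bar>(s k u \<omega>)\<^sup>2 - (h u \<omega>)\<^sup>2\<bar> \<partial>time_measure t)"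
    if u: "u \<in> {0..t}" and \<omega>: "\<omega> \<in> space M" for k u \<omega>
  proof -
    let ?q = "\<lambda>u. \<bar>(s k u \<omega>)\<^sup>2 - (h u \<omega>)\<^sup>2\<bar>"
    have q: "integrable (time_measure t) ?q"
    proof -
      obtain C K where CK: "\<And>u. \<bar>s k u \<omega>\<bar> \<le> C" "\<And>u. u \<in> {0..t} \<Longrightarrow> \<bar>h u \<omega>\<bar> \<le> K"
        using s_bounded[of k] h_bounded[OF \<omega>] \<omega> by blast
      show ?thesis
      proof (rule T.integrable_const_bound[of _ "C\<^sup>2 + K\<^sup>2"])
        show "AE u in time_measure t. norm (?q u) \<le> C\<^sup>2 + K\<^sup>2"
        proof (rule AE_I2)
          fix u assume "u \<in> space (time_measure t)"
          then have "(s k u \<omega>)\<^sup>2 \<le> C\<^sup>2" "(h u \<omega>)\<^sup>2 \<le> K\<^sup>2"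
            using CK(1)[of u] CK(2)[of u] abs_le_square_iff[of "s k u \<omega>" C] abs_le_square_iff[of "h u \<omega>" K] by auto
          then show "norm (?q u) \<le> C\<^sup>2 + K\<^sup>2"
            using zero_le_power2[of "s k u \<omega>"] zero_le_power2[of "h u \<omega>"] unfolding real_norm_def abs_abs by linarith
        qed
      qed (use slice[OF h_pair \<omega>] slice[OF s_pair[of k] \<omega>] in measurable)
    qed
    have s2: "((\<lambda>u. (s k u \<omega>)\<^sup>2) has_integral quadratic_variation (S k) u \<omega>) {0..u}"
      using quadratic_variation_has_integral(1)[OF S] u unfolding s_def by auto
    have q_u: "?q integrable_on {0..u}"
      using u by (intro integrable_on_subinterval[OF integral_time_measure(1)[OF q]]) auto
    have "quadratic_variation (S k) u \<omega> - V u \<omega> = integral {0..u} (\<lambda>u. (s k u \<omega>)\<^sup>2 - (h u \<omega>)\<^sup>2)"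
      using s2 h2_int[OF \<omega>, of u] by (simp add: V_def Henstock_Kurzweil_Integration.integral_diff has_integral_iff)
    also have "norm \<dots> \<le> integral {0..u} ?q"
      using s2 h2_int[OF \<omega>, of u] q_u
      by (intro integral_norm_bound_integral Henstock_Kurzweil_Integration.integrable_diff) (auto simp: has_integral_iff)
    also have "\<dots> \<le> integral {0..t} ?q"
      using u q_u integral_time_measure(1)[OF q] by (intro integral_subset_le) auto
    also have "\<dots> = (\<integral>u. ?q u \<partial>time_measure t)" by (rule integral_time_measure(2)[OF q])
    finally have Q: "\<bar>quadratic_variation (S k) u \<omega> - V u \<omega>\<bar> \<le> (\<integral>u. ?q u \<partial>time_measure t)" by simp
    have "0 \<le> quadratic_variation (S k) u \<omega>"
      using quadratic_variation_mono[OF S, of 0 u _ \<omega>] quadratic_variation_0[OF S] u by (metis atLeastAtMost_iff)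
    then have "\<bar>weight (S k) u \<omega> - w u \<omega>\<bar> \<le> \<bar>(- killing u \<omega> - quadratic_variation (S k) u \<omega>) - (- killing u \<omega> - V u \<omega>)\<bar>"
      unfolding weight_def w_eq using killing_nonneg[OF \<omega>, of u] V_nonneg[OF \<omega>, of u] by (intro abs_exp_diff_le) auto
    also have "\<dots> = \<bar>quadratic_variation (S k) u \<omega> - V u \<omega>\<bar>" by simp
    finally show ?thesis using Q by linarith
  qed

  have lim: "AE \<omega> in M. (\<lambda>k. R (r k) \<omega>) \<longlonglongrightarrow> R' \<omega> \<and>
      (\<lambda>k. weight (S (r k)) t \<omega> * f (X (r k) t \<omega>)) \<longlonglongrightarrow> w t \<omega> * f (Z t \<omega>)"
    using r(2) AE_space
  proof eventually_elim
    case (elim \<omega>)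
    note \<omega> = elim(2)
    have "(\<lambda>k. m (r k) \<omega>) \<longlonglongrightarrow> 0" "(\<lambda>k. min 1 (v (r k) \<omega>)) \<longlonglongrightarrow> 0" "(\<lambda>k. d (r k) t \<omega>) \<longlonglongrightarrow> 0"
      using m_nonneg[of _ \<omega>] v_nonneg[of _ \<omega>] d(1)[of _ t \<omega>]
      by (auto intro!: tendsto_sandwich[OF always_eventually always_eventually tendsto_const elim(1)] simp: U_def
          add_nonneg_nonneg add_increasing add_increasing2)
    then have m0: "(\<lambda>k. m (r k) \<omega>) \<longlonglongrightarrow> 0" and v0: "(\<lambda>k. v (r k) \<omega>) \<longlonglongrightarrow> 0"
      and X0: "(\<lambda>k. \<bar>X (r k) t \<omega> - Z t \<omega>\<bar>) \<longlonglongrightarrow> 0"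
      by (auto intro: tendsto_0_if_min_1 simp: d_def)
    obtain K where K: "\<And>u. u \<in> {0..t} \<Longrightarrow> \<bar>h u \<omega>\<bar> \<le> K" using h_bounded[OF \<omega>] by blast
    have w_meas: "(\<lambda>u. w u \<omega>) \<in> borel_measurable (time_measure t)"
      using integrable_time_measure_continuous[OF continuous_on_subset[OF w_cont[OF \<omega>]]] by auto
    note limits = weighted_generator_limit[OF finite_measure_time_measure[of t],
        of "\<lambda>k u. X (r k) u \<omega>" "\<lambda>k u. weight (S (r k)) u \<omega>" "\<lambda>k u. s (r k) u \<omega>" "\<lambda>u. Z u \<omega>" "\<lambda>u. w u \<omega>" "\<lambda>u. h u \<omega>" K,
        OF slice[OF killed(1) \<omega>] slice[OF weight_pair_measurable[OF S t] \<omega>] slice[OF s_pair \<omega>]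
          slice[OF Z_pair \<omega>] w_meas slice[OF h_pair \<omega>] _ v_int[OF \<omega>] v0[unfolded v_def] m0[unfolded m_def d_def]]
    have side: "\<bar>h u \<omega>\<bar> \<le> K" "0 \<le> weight (S (r k)) u \<omega>" "weight (S (r k)) u \<omega> \<le> 1" "0 \<le> w u \<omega>" "w u \<omega> \<le> 1"
      "\<bar>weight (S (r k)) u \<omega> - w u \<omega>\<bar> \<le> (\<integral>u. \<bar>(s (r k) u \<omega>)\<^sup>2 - (h u \<omega>)\<^sup>2\<bar> \<partial>time_measure t)"
      if "u \<in> space (time_measure t)" for u k
      using that K weight_properties(2,4)[OF S[of "r k"], of u \<omega>] w_le[OF \<omega>] weight_diff[OF _ \<omega>] \<omega> by (auto simp: w_eq)
    have R_lim: "(\<lambda>k. R (r k) \<omega>) \<longlonglongrightarrow> R' \<omega>"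
      unfolding R_def R'_def by (rule limits(2)) (use side in auto)
    have q_lim: "(\<lambda>k. \<integral>u. \<bar>(s (r k) u \<omega>)\<^sup>2 - (h u \<omega>)\<^sup>2\<bar> \<partial>time_measure t) \<longlonglongrightarrow> 0"
      by (rule limits(1)) (use side in auto)
    have "(\<lambda>k. weight (S (r k)) t \<omega> - w t \<omega>) \<longlonglongrightarrow> 0"
      by (rule Lim_null_comparison[OF _ q_lim]) (use weight_diff[of t \<omega>] t \<omega> in auto)
    then have "(\<lambda>k. weight (S (r k)) t \<omega>) \<longlonglongrightarrow> w t \<omega>" by (rule LIM_zero_cancel)
    moreover have "(\<lambda>k. X (r k) t \<omega>) \<longlonglongrightarrow> Z t \<omega>"
      using X0 tendsto_rabs_zero_iff LIM_zero_cancel by blast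
    then have "(\<lambda>k. f (X (r k) t \<omega>)) \<longlonglongrightarrow> f (Z t \<omega>)"
      by (rule continuous_on_tendsto_compose[OF continuous(1)]) auto
    ultimately show ?case using R_lim by (auto intro: tendsto_mult)
  qed
  have R'_lim: "AE \<omega> in M. (\<lambda>k. R (r k) \<omega>) \<longlonglongrightarrow> R' \<omega>"
    using lim by eventually_elim simp
  have R'_meas: "R' \<in> borel_measurable M"
  proof -
    have w_pair: "(\<lambda>(u, \<omega>). w u \<omega>) \<in> borel_measurable (time_measure t \<Otimes>\<^sub>M M)"
    proof (rule measurable_pair_continuous_paths[OF t])
      \<comment> \<open>The exponent \<open>V\<close> is a time integral up to \<open>u\<close>, so
        its measurability is obtained over \<open>time_measure u\<close> instead of
        \<open>time_measure t\<close>.\<close>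
      fix u assume u: "0 \<le> u" "u \<le> t"
      interpret Tu: finite_measure "time_measure u" by (rule finite_measure_time_measure)
      have "(\<lambda>(u', \<omega>). h u' \<omega>) \<in> borel_measurable (time_measure u \<Otimes>\<^sub>M M)"
      proof (rule measurable_pair_continuous_paths[OF u(1)])
        show "h u' \<in> borel_measurable M" if "0 \<le> u'" for u'
          using Z_measurable[OF that] unfolding h_def by measurable
      qed (auto intro: continuous_on_subset[OF h_cont])
      note [measurable] = swap[OF this]
      have "(\<lambda>(\<omega>, u'). (h u' \<omega>)\<^sup>2) \<in> borel_measurable (M \<Otimes>\<^sub>M time_measure u)"
        by measurable
      then have "(\<lambda>\<omega>. \<integral>u'. (h u' \<omega>)\<^sup>2 \<partial>time_measure u) \<in> borel_measurable M"
        by (rule Tu.borel_measurable_lebesgue_integral)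
      moreover have "V u \<omega> = (\<integral>u'. (h u' \<omega>)\<^sup>2 \<partial>time_measure u)" if "\<omega> \<in> space M" for \<omega>
        unfolding V_def
        by (intro integral_time_measure(2) integrable_time_measure_continuous continuous_intros
            continuous_on_subset[OF h_cont[OF that]]) auto
      ultimately have "V u \<in> borel_measurable M" by (subst measurable_cong) auto
      then show "w u \<in> borel_measurable M"
        unfolding w_eq[abs_def] using measurable_from_F[OF killing_adapted[OF u(1)]] by measurable
    qed (auto intro: continuous_on_subset[OF w_cont])
    note [measurable] = swap[OF w_pair] swap[OF h_pair] swap[OF Z_pair]
    show ?thesis unfolding R'_def generator_def by measurable
  qed
  have ER_lim: "(\<lambda>k. expectation (R (r k))) \<longlonglongrightarrow> expectation R'" and R'_int: "integrable M R'"
    by (rule integral_dominated_convergence[where w = "\<lambda>_. \<delta> * t + L", OF R'_meas killed(2) _ R'_lim]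
        integrable_dominated_convergence[where w = "\<lambda>_. \<delta> * t + L", OF R'_meas killed(2) _ R'_lim],
        use killed(3) in auto)+
  have "expectation R' \<le> expectation (\<lambda>_. c)"
    using R'_int c by (intro integral_mono) (auto simp: R'_def h_def)
  then have ER': "expectation R' \<le> c" by (simp add: prob_space)

  let ?g = "\<lambda>k \<omega>. weight (S (r k)) t \<omega> * f (X (r k) t \<omega>)"
  have "(\<integral>\<^sup>+\<omega>. ennreal (w t \<omega> * f (Z t \<omega>)) \<partial>M) = (\<integral>\<^sup>+\<omega>. liminf (\<lambda>k. ennreal (?g k \<omega>)) \<partial>M)"
  proof (rule nn_integral_cong_AE)
    show "AE \<omega> in M. ennreal (w t \<omega> * f (Z t \<omega>)) = liminf (\<lambda>k. ennreal (?g k \<omega>))"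
      using lim by eventually_elim (auto intro!: lim_imp_Liminf[symmetric] tendsto_ennrealI)
  qed
  also have "\<dots> \<le> liminf (\<lambda>k. \<integral>\<^sup>+\<omega>. ennreal (?g k \<omega>) \<partial>M)"
    using killed(4) by (intro nn_integral_liminf) auto
  also have "\<dots> \<le> liminf (\<lambda>k. ennreal (f 0 + expectation (R (r k))))"
  proof (rule Liminf_mono[OF always_eventually], rule allI)
    fix k
    have "(\<integral>\<^sup>+\<omega>. ennreal (?g k \<omega>) \<partial>M) = ennreal (expectation (?g k))"
      using weight_properties(2)[OF S] nonneg by (intro nn_integral_eq_integral killed(4)) auto
    also have "\<dots> \<le> ennreal (f 0 + expectation (R (r k)))"
      by (intro ennreal_leI killed(5))
    finally show "(\<integral>\<^sup>+\<omega>. ennreal (?g k \<omega>) \<partial>M) \<le> ennreal (f 0 + expectation (R (r k)))" .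
  qed
  also have "\<dots> = ennreal (f 0 + expectation R')"
    by (intro lim_imp_Liminf tendsto_ennrealI tendsto_add tendsto_const ER_lim) simp
  also have "\<dots> \<le> ennreal (f 0 + c)" using ER' by (intro ennreal_leI) simp
  finally show ?thesis .
qed

end

section \<open>Occupation time of a solution at 0\<close>

context brownian_filtration
begin

text \<open>The rate \<open>\<kappa>\<close> is \<theta> times the factor left over by the
  regularised generator, which is therefore at most \<open>\<delta> / \<theta> * \<kappa>\<close>.
  The term \<open>\<epsilon> * pi / 2\<close> is \<open>f 0\<close>, and \<open>\<sigma>\<close> is
  the lower bound of \<open>f\<close> that does not depend on \<epsilon>.\<close>

lemma solution_estimate:
  fixes \<gamma> \<delta> \<epsilon> t \<theta> :: real
  assumes \<gamma>: "0 < \<gamma>" "\<gamma> < 1/2" and \<delta>: "0 < \<delta>" and \<epsilon>: "0 < \<epsilon>" "\<epsilon> \<le> 1" and \<theta>: "0 < \<theta>" and t: "0 \<le> t"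
    and sol: "nonneg_solution M F B \<delta> \<gamma> Z"
  defines "\<kappa> \<equiv> \<lambda>z. \<theta> * (1 - (z\<^sup>2 / (z\<^sup>2 + \<epsilon>\<^sup>2)) powr (1/2 + \<gamma>))"
    and "\<sigma> \<equiv> \<lambda>z. z * exp (- (\<delta> / (1/2 - \<gamma>)) * (z\<^sup>2 + 1) powr (1/2 - \<gamma>))"
  shows "(\<integral>\<^sup>+\<omega>. ennreal (exp (- integral {0..t} (\<lambda>s. \<kappa> (Z s \<omega>)) - integral {0..t} (\<lambda>s. (Z s \<omega> powr \<gamma>)\<^sup>2)) * \<sigma> (Z t \<omega>)) \<partial>M)
    \<le> ennreal (\<epsilon> * pi / 2 + \<delta> / \<theta>)"
proof -
  obtain f f' f'' L where tf: "test_function f f' f'' L" and f0: "f 0 = \<epsilon> * pi / 2"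
    and lower: "\<And>z. 0 \<le> z \<Longrightarrow> z * exp (- (\<delta> / (1/2 - \<gamma>)) * (z\<^sup>2 + 1) powr (1/2 - \<gamma>)) \<le> f z"
    and f_ode: "\<And>z. 0 \<le> z \<Longrightarrow> \<delta> * f' z + f'' z / 2 * (z powr \<gamma>)\<^sup>2 = \<delta> * f' z * (1 - (z\<^sup>2 / (z\<^sup>2 + \<epsilon>\<^sup>2)) powr (1/2 + \<gamma>))"
    by (rule test_function_exists[OF \<gamma> \<delta> \<epsilon>]) (rule that)
  have f_lower: "\<sigma> z \<le> f z" if "0 \<le> z" for z
    unfolding \<sigma>_def by (rule lower[OF that])
  have Z_adapted: "\<And>u. 0 \<le> u \<Longrightarrow> Z u \<in> borel_measurable (F u)"
    and Z_continuous: "\<And>\<omega>. \<omega> \<in> space M \<Longrightarrow> continuous_on {0..} (\<lambda>u. Z u \<omega>)"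
    and Z_nonneg: "\<And>u \<omega>. 0 \<le> u \<Longrightarrow> \<omega> \<in> space M \<Longrightarrow> 0 \<le> Z u \<omega>"
    using sol unfolding nonneg_solution_def adapted_process_def by auto
  obtain I where ito: "ito_integral M F B (\<lambda>t \<omega>. Z t \<omega> powr \<gamma>) I"
    and Z_eq: "AE \<omega> in M. \<forall>u\<ge>0. Z u \<omega> = \<delta> * u + I u \<omega>"
    using sol unfolding nonneg_solution_def by auto
  have I: "I u \<in> borel_measurable M" if "0 \<le> u" for u
    using ito that unfolding ito_integral_def by simp
  obtain S where S: "\<And>k :: nat. simple_process M F (S k)"
    and S_lims: "\<forall>T\<ge>0. \<forall>\<epsilon>>0. (\<lambda>k. prob {\<omega>\<in>space M.
      (\<integral>\<^sup>+u\<in>{0..T}. ennreal ((simple_value (S k) u \<omega> - Z u \<omega> powr \<gamma>)\<^sup>2) \<partial>lborel) > ennreal \<epsilon>}) \<longlonglongrightarrow> 0"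
    and I_lims: "\<forall>T\<ge>0. \<forall>\<epsilon>>0. (\<lambda>k. prob {\<omega>\<in>space M. \<bar>simple_integral B (S k) T \<omega> - I T \<omega>\<bar> > \<epsilon>}) \<longlonglongrightarrow> 0"
    using ito unfolding ito_integral_def by (elim conjE exE) (rule that, simp_all)
  note S_lim = S_lims[rule_format, OF t] and I_lim = I_lims[rule_format]
  have base: "0 \<le> z\<^sup>2 / (z\<^sup>2 + \<epsilon>\<^sup>2)" "z\<^sup>2 / (z\<^sup>2 + \<epsilon>\<^sup>2) \<le> 1" "z\<^sup>2 + \<epsilon>\<^sup>2 \<noteq> 0" for z
  proof -
    have "0 < z\<^sup>2 + \<epsilon>\<^sup>2" using \<epsilon> by (intro add_nonneg_pos) auto
    then show "0 \<le> z\<^sup>2 / (z\<^sup>2 + \<epsilon>\<^sup>2)" "z\<^sup>2 / (z\<^sup>2 + \<epsilon>\<^sup>2) \<le> 1" "z\<^sup>2 + \<epsilon>\<^sup>2 \<noteq> 0"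
      by (auto simp: divide_le_eq)
  qed
  have \<kappa>_nonneg: "0 \<le> \<kappa> z" for z
    unfolding \<kappa>_def using \<theta> \<gamma> base[of z] by (intro mult_nonneg_nonneg) (auto intro: powr_le1)
  have \<kappa>_continuous: "continuous_on UNIV \<kappa>"
    unfolding \<kappa>_def using base \<gamma>
    by (intro continuous_on_mult continuous_on_diff continuous_on_const continuous_on_powr' continuous_on_divide
        continuous_on_power continuous_on_add continuous_on_id) auto
  interpret test_function f f' f'' L by (rule tf)
  interpret killed_process M F B f f' f'' L \<delta> Z \<kappa>
    using \<delta> Z_adapted Z_continuous \<kappa>_continuous \<kappa>_nonneg by unfold_locales auto
  define V where "V u \<omega> = integral {0..u} (\<lambda>s. (Z s \<omega> powr \<gamma>)\<^sup>2)" for u \<omega>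
  have "(\<integral>\<^sup>+\<omega>. ennreal (exp (- killing t \<omega> - V t \<omega>) * f (Z t \<omega>)) \<partial>M) \<le> ennreal (f 0 + \<delta> / \<theta>)"
    unfolding V_def
  proof (rule killed_limit[OF t \<gamma>(1) Z_nonneg S S_lim I_lim I Z_eq], fold V_def)
    fix \<omega> assume \<omega>: "\<omega> \<in> space M"
    have Zc: "continuous_on {0..t} (\<lambda>u. Z u \<omega>)"
      by (rule continuous_on_subset[OF Z_continuous[OF \<omega>]]) auto
    have kc: "continuous_on {0..t} (\<lambda>u. killing u \<omega>)"
      by (rule continuous_on_subset[OF killing_continuous[OF \<omega>]]) auto
    have h_cont: "continuous_on {0..t} (\<lambda>u. Z u \<omega> powr \<gamma>)"
      using Z_nonneg \<omega> \<gamma> by (intro continuous_on_powr' Zc continuous_intros) auto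
    have Vc: "continuous_on {0..t} (\<lambda>u. V u \<omega>)"
      unfolding V_def by (intro indefinite_integral_continuous_1 integrable_continuous_real continuous_intros h_cont)
    have V_nonneg: "0 \<le> V u \<omega>" if "u \<in> {0..t}" for u
      unfolding V_def using that
      by (intro Henstock_Kurzweil_Integration.integral_nonneg integrable_continuous_real continuous_intros
          continuous_on_subset[OF h_cont]) auto
    have \<kappa>c: "continuous_on {0..t} (\<lambda>u. \<kappa> (Z u \<omega>))" by (rule \<kappa>_Z_continuous[OF \<omega>])
    let ?k = "\<lambda>u. exp (- killing u \<omega>) * \<kappa> (Z u \<omega>)"
    have kint: "integrable (time_measure t) ?k"
      by (intro integrable_time_measure_continuous continuous_intros kc \<kappa>c)
    have gc: "continuous_on {0..t} (\<lambda>u. generator (Z u \<omega> powr \<gamma>) (Z u \<omega>))"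
      unfolding generator_def
      by (intro continuous_intros h_cont continuous_on_compose2[OF continuous(2) Zc] continuous_on_compose2[OF continuous(3) Zc]) auto
    \<comment> \<open>The integrand is the derivative of \<open>- exp (- killing)\<close>, so its
      integral is at most 1 for every \<theta> and \<epsilon>.\<close>
    have "(?k has_integral - exp (- killing t \<omega>) - (- exp (- killing 0 \<omega>))) {0..t}"
    proof (rule fundamental_theorem_of_calculus[OF t])
      fix u assume u: "u \<in> {0..t}"
      have "((\<lambda>u. killing u \<omega>) has_real_derivative \<kappa> (Z u \<omega>)) (at u within {0..t})"
        unfolding killing_def using integral_has_vector_derivative[OF \<kappa>c u]
        by (simp add: has_real_derivative_iff_has_vector_derivative)
      then show "((\<lambda>u. - exp (- killing u \<omega>)) has_vector_derivative ?k u) (at u within {0..t})"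
        unfolding has_real_derivative_iff_has_vector_derivative[symmetric]
        by (auto intro!: derivative_eq_intros)
    qed
    then have "(\<integral>u. ?k u \<partial>time_measure t) = 1 - exp (- killing t \<omega>)"
      using integral_time_measure(2)[OF kint] by (simp add: has_integral_iff killing_def)
    then have k1: "(\<integral>u. ?k u \<partial>time_measure t) \<le> 1" by simp
    have "(\<integral>u. exp (- killing u \<omega> - V u \<omega>) * generator (Z u \<omega> powr \<gamma>) (Z u \<omega>) \<partial>time_measure t)
        \<le> (\<integral>u. \<delta> / \<theta> * ?k u \<partial>time_measure t)"
    proof (rule integral_mono)
      show "integrable (time_measure t) (\<lambda>u. exp (- killing u \<omega> - V u \<omega>) * generator (Z u \<omega> powr \<gamma>) (Z u \<omega>))"
        by (intro integrable_time_measure_continuous continuous_intros kc Vc gc)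
      show "integrable (time_measure t) (\<lambda>u. \<delta> / \<theta> * ?k u)" using kint by simp
      fix u assume "u \<in> space (time_measure t)"
      then have u: "u \<in> {0..t}" by simp
      have "generator (Z u \<omega> powr \<gamma>) (Z u \<omega>) = f' (Z u \<omega>) * (\<delta> / \<theta> * \<kappa> (Z u \<omega>))"
        using f_ode[OF Z_nonneg, of u \<omega>] u \<omega> \<theta> by (simp add: generator_def \<kappa>_def)
      also have "\<dots> \<le> 1 * (\<delta> / \<theta> * \<kappa> (Z u \<omega>))"
        using deriv1_bound[of "Z u \<omega>"] \<kappa>_nonneg \<delta> \<theta> by (intro mult_right_mono) auto
      finally have "generator (Z u \<omega> powr \<gamma>) (Z u \<omega>) \<le> \<delta> / \<theta> * \<kappa> (Z u \<omega>)" by simp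
      then have "exp (- killing u \<omega> - V u \<omega>) * generator (Z u \<omega> powr \<gamma>) (Z u \<omega>)
          \<le> exp (- killing u \<omega> - V u \<omega>) * (\<delta> / \<theta> * \<kappa> (Z u \<omega>))"
        by (intro mult_left_mono) auto
      \<comment> \<open>The factor \<open>exp (- V)\<close> is discarded in this upper bound; in the
        conclusion of the lemma it stays, as a strictly positive weight.\<close>
      also have "\<dots> \<le> exp (- killing u \<omega>) * (\<delta> / \<theta> * \<kappa> (Z u \<omega>))"
        using V_nonneg[OF u] \<kappa>_nonneg \<delta> \<theta> by (intro mult_right_mono) auto
      finally show "exp (- killing u \<omega> - V u \<omega>) * generator (Z u \<omega> powr \<gamma>) (Z u \<omega>) \<le> \<delta> / \<theta> * ?k u"
        by (simp add: mult_ac)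
    qed
    also have "\<dots> = \<delta> / \<theta> * (\<integral>u. ?k u \<partial>time_measure t)" by simp
    also have "\<dots> \<le> \<delta> / \<theta> * 1" using k1 \<delta> \<theta> by (intro mult_left_mono) auto
    finally show "(\<integral>u. exp (- killing u \<omega> - V u \<omega>) * generator (Z u \<omega> powr \<gamma>) (Z u \<omega>) \<partial>time_measure t) \<le> \<delta> / \<theta>"
      by simp
  qed
  moreover have "(\<integral>\<^sup>+\<omega>. ennreal (exp (- killing t \<omega> - V t \<omega>) * \<sigma> (Z t \<omega>)) \<partial>M)
      \<le> (\<integral>\<^sup>+\<omega>. ennreal (exp (- killing t \<omega> - V t \<omega>) * f (Z t \<omega>)) \<partial>M)"
    using f_lower Z_nonneg[OF t] by (intro nn_integral_mono ennreal_leI mult_left_mono) auto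
  ultimately show ?thesis
    by (simp add: f0 killing_def V_def)
qed

text \<open>As the regularisation is removed, the accumulated killing becomes \<theta> times the
  occupation time at 0. Where that time is 0 the weight does not depend on \<theta>, while the bound
  \<open>\<delta> / \<theta>\<close> tends to 0.\<close>

lemma solution_zero_if_no_zeros:
  assumes \<gamma>: "0 < \<gamma>" "\<gamma> < 1/2" and \<delta>: "0 < \<delta>" and t: "0 \<le> t"
    and sol: "nonneg_solution M F B \<delta> \<gamma> Z"
  shows "AE \<omega> in M. emeasure lborel {s\<in>{0..t}. Z s \<omega> = 0} = 0 \<longrightarrow> Z t \<omega> = 0"
proof -
  interpret T: finite_measure "time_measure t" by (rule finite_measure_time_measure)
  have Z_adapted: "\<And>u. 0 \<le> u \<Longrightarrow> Z u \<in> borel_measurable (F u)"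
    and Z_continuous: "\<And>\<omega>. \<omega> \<in> space M \<Longrightarrow> continuous_on {0..} (\<lambda>u. Z u \<omega>)"
    and Z_nonneg: "\<And>u \<omega>. 0 \<le> u \<Longrightarrow> \<omega> \<in> space M \<Longrightarrow> 0 \<le> Z u \<omega>"
    using sol unfolding nonneg_solution_def adapted_process_def by auto
  have Z_meas: "Z u \<in> borel_measurable M" if "0 \<le> u" for u
    using Z_adapted[OF that] measurable_from_F by blast
  have Z_path: "continuous_on {0..t} (\<lambda>u. Z u \<omega>)" if "\<omega> \<in> space M" for \<omega>
    by (rule continuous_on_subset[OF Z_continuous[OF that]]) auto
  have Z_pair: "(\<lambda>(u, \<omega>). Z u \<omega>) \<in> borel_measurable (time_measure t \<Otimes>\<^sub>M M)"
    by (rule measurable_pair_continuous_paths[OF t Z_meas Z_path])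
  have [measurable]: "(\<lambda>(\<omega>, u). Z u \<omega>) \<in> borel_measurable (M \<Otimes>\<^sub>M time_measure t)"
    by (subst measurable_pair_swap_iff) (use Z_pair in \<open>simp add: case_prod_beta'\<close>)
  have [measurable]: "Z t \<in> borel_measurable M" by (rule Z_meas[OF t])
  \<comment> \<open>The measure of the zero set written as a parameter integral, so that joint
    measurability of \<open>Z\<close> makes it a random variable.\<close>
  define zeros where "zeros \<omega> = (\<integral>u. indicator {0} (Z u \<omega>) \<partial>time_measure t :: real)" for \<omega>
  have zeros_meas [measurable]: "zeros \<in> borel_measurable M"
    unfolding zeros_def by measurable
  have zeros_eq: "zeros \<omega> = 0" if \<omega>: "\<omega> \<in> space M" and null: "emeasure lborel {s\<in>{0..t}. Z s \<omega> = 0} = 0" for \<omega>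
  proof -
    have "closed {s\<in>{0..t}. Z s \<omega> = 0}"
      using continuous_closed_preimage_constant[OF Z_path[OF \<omega>]] by simp
    then have "{s\<in>{0..t}. Z s \<omega> = 0} \<in> null_sets lborel"
      using null by (auto simp: null_sets_def)
    then have "AE s in lborel. s \<notin> {s\<in>{0..t}. Z s \<omega> = 0}" by (rule AE_not_in)
    then have "AE s in time_measure t. indicator {0} (Z s \<omega>) = (0 :: real)"
      unfolding time_measure_def by (subst AE_restrict_space_iff) auto
    then show ?thesis unfolding zeros_def by (rule integral_eq_zero_AE)
  qed
  define \<sigma> where "\<sigma> z = z * exp (- (\<delta> / (1/2 - \<gamma>)) * (z\<^sup>2 + 1) powr (1/2 - \<gamma>))" for z
  define V where "V \<omega> = integral {0..t} (\<lambda>s. (Z s \<omega> powr \<gamma>)\<^sup>2)" for \<omega>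
  \<comment> \<open>The rate of \<open>solution_estimate\<close> divided by \<theta>, with
    \<open>\<epsilon> = 1 / (n + 1)\<close>. It is 1 at 0 for every \<open>n\<close> and tends to 0
    elsewhere.\<close>
  define g where "g n z = 1 - (z\<^sup>2 / (z\<^sup>2 + (inverse (real (Suc n)))\<^sup>2)) powr (1/2 + \<gamma>)" for n z
  define G where "G n \<omega> = (\<integral>u. g n (Z u \<omega>) \<partial>time_measure t)" for n \<omega>
  have [measurable]: "g n \<in> borel_measurable borel" for n unfolding g_def by measurable
  have [measurable]: "\<sigma> \<in> borel_measurable borel" unfolding \<sigma>_def by measurable
  have g: "0 \<le> g n z" "g n z \<le> 1" for n z
  proof -
    have "0 < z\<^sup>2 + (inverse (real (Suc n)))\<^sup>2" by (intro add_nonneg_pos) auto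
    then show "0 \<le> g n z" "g n z \<le> 1" using \<gamma> by (auto simp: g_def divide_le_eq intro!: powr_le1)
  qed
  have g_continuous: "continuous_on UNIV (g n)" for n
  proof -
    have "z\<^sup>2 + (inverse (real (Suc n)))\<^sup>2 \<noteq> 0" for z
      using add_nonneg_pos[of "z\<^sup>2" "(inverse (real (Suc n)))\<^sup>2"] by simp
    then show ?thesis
      unfolding g_def using \<gamma>
      by (intro continuous_on_diff continuous_on_const continuous_on_powr' continuous_on_divide
          continuous_on_power continuous_on_add continuous_on_id) (auto intro!: divide_nonneg_nonneg add_nonneg_nonneg)
  qed
  have G_lim: "(\<lambda>n. G n \<omega>) \<longlonglongrightarrow> zeros \<omega>" if \<omega>: "\<omega> \<in> space M" for \<omega>
    unfolding G_def zeros_def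
  proof (rule integral_dominated_convergence[where w = "\<lambda>_. 1"])
    have [measurable]: "(\<lambda>u. Z u \<omega>) \<in> borel_measurable (time_measure t)"
      using measurable_Pair1[OF Z_pair \<omega>] by simp
    show "(\<lambda>u. indicator {0} (Z u \<omega>) :: real) \<in> borel_measurable (time_measure t)"
      "(\<lambda>u. g n (Z u \<omega>)) \<in> borel_measurable (time_measure t)" for n by measurable
    show "AE u in time_measure t. (\<lambda>n. g n (Z u \<omega>)) \<longlonglongrightarrow> indicator {0} (Z u \<omega>)"
    proof (intro AE_I2)
      fix u
      show "(\<lambda>n. g n (Z u \<omega>)) \<longlonglongrightarrow> indicator {0} (Z u \<omega>)"
      proof (cases "Z u \<omega> = 0")
        case False
        let ?z = "(Z u \<omega>)\<^sup>2"
        have "(\<lambda>n. 1 - (?z / (?z + (inverse (real (Suc n)))\<^sup>2)) powr (1/2 + \<gamma>)) \<longlonglongrightarrow> 1 - (?z / (?z + 0\<^sup>2)) powr (1/2 + \<gamma>)"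
          using False by (intro tendsto_intros LIMSEQ_inverse_real_of_nat) auto
        then show ?thesis using False by (simp add: g_def)
      qed (simp add: g_def)
    qed
    show "AE u in time_measure t. norm (g n (Z u \<omega>)) \<le> 1" for n
      using g by (intro AE_I2) simp
  qed simp
  have G_eq: "integral {0..t} (\<lambda>s. \<theta> * g n (Z s \<omega>)) = \<theta> * G n \<omega>" if "\<omega> \<in> space M" for n \<theta> \<omega>
    unfolding G_def
    by (subst integral_time_measure(2))
      (auto intro!: integrable_time_measure_continuous continuous_intros continuous_on_compose2[OF g_continuous Z_path[OF that]])
  have [measurable]: "G n \<in> borel_measurable M" for n
    unfolding G_def by measurable
  have [measurable]: "V \<in> borel_measurable M"
  proof -
    have "(\<lambda>\<omega>. \<integral>u. (Z u \<omega> powr \<gamma>)\<^sup>2 \<partial>time_measure t) \<in> borel_measurable M" by measurable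
    moreover have "V \<omega> = (\<integral>u. (Z u \<omega> powr \<gamma>)\<^sup>2 \<partial>time_measure t)" if "\<omega> \<in> space M" for \<omega>
      unfolding V_def using Z_nonneg that \<gamma>
      by (intro integral_time_measure(2) integrable_time_measure_continuous continuous_intros continuous_on_powr' Z_path) auto
    ultimately show ?thesis by (subst measurable_cong) auto
  qed
  have est: "(\<integral>\<^sup>+\<omega>. ennreal (exp (- \<theta> * G n \<omega> - V \<omega>) * \<sigma> (Z t \<omega>)) \<partial>M) \<le> ennreal (inverse (real (Suc n)) * pi / 2 + \<delta> / \<theta>)"
    if "0 < \<theta>" for n \<theta>
  proof -
    have "(\<integral>\<^sup>+\<omega>. ennreal (exp (- \<theta> * G n \<omega> - V \<omega>) * \<sigma> (Z t \<omega>)) \<partial>M)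
      = (\<integral>\<^sup>+\<omega>. ennreal (exp (- integral {0..t} (\<lambda>s. \<theta> * g n (Z s \<omega>)) - V \<omega>) * \<sigma> (Z t \<omega>)) \<partial>M)"
      by (intro nn_integral_cong) (simp only: G_eq minus_mult_left)
    also have "\<dots> \<le> ennreal (inverse (real (Suc n)) * pi / 2 + \<delta> / \<theta>)"
      unfolding g_def V_def \<sigma>_def
      by (rule solution_estimate[OF \<gamma> \<delta> _ _ that t sol]) (simp_all add: inverse_le_1_iff)
    finally show ?thesis .
  qed
  \<comment> \<open>On the event \<open>zeros \<omega> = 0\<close> the limiting factor
    \<open>exp (- \<theta> * zeros \<omega>)\<close> is 1 for all \<theta>; hence
    \<open>\<Phi>\<close> lies below every Fatou limit at once.\<close>
  define \<Phi> where "\<Phi> \<omega> = ennreal (indicator {0} (zeros \<omega>) * (exp (- V \<omega>) * \<sigma> (Z t \<omega>)))" for \<omega>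
  have \<sigma>_nonneg: "0 \<le> \<sigma> (Z t \<omega>)" if "\<omega> \<in> space M" for \<omega>
    using Z_nonneg[OF t that] by (simp add: \<sigma>_def)
  have "(\<integral>\<^sup>+\<omega>. \<Phi> \<omega> \<partial>M) \<le> ennreal (\<delta> / \<theta>)" if \<theta>: "0 < \<theta>" for \<theta>
  proof -
    have "(\<integral>\<^sup>+\<omega>. \<Phi> \<omega> \<partial>M) \<le> (\<integral>\<^sup>+\<omega>. liminf (\<lambda>n. ennreal (exp (- \<theta> * G n \<omega> - V \<omega>) * \<sigma> (Z t \<omega>))) \<partial>M)"
    proof (rule nn_integral_mono)
      fix \<omega> assume \<omega>: "\<omega> \<in> space M"
      have "(\<lambda>n. ennreal (exp (- \<theta> * G n \<omega> - V \<omega>) * \<sigma> (Z t \<omega>))) \<longlonglongrightarrow> ennreal (exp (- \<theta> * zeros \<omega> - V \<omega>) * \<sigma> (Z t \<omega>))"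
        by (intro tendsto_ennrealI tendsto_intros G_lim[OF \<omega>])
      then have "liminf (\<lambda>n. ennreal (exp (- \<theta> * G n \<omega> - V \<omega>) * \<sigma> (Z t \<omega>))) = ennreal (exp (- \<theta> * zeros \<omega> - V \<omega>) * \<sigma> (Z t \<omega>))"
        by (intro lim_imp_Liminf) auto
      moreover have "\<Phi> \<omega> \<le> ennreal (exp (- \<theta> * zeros \<omega> - V \<omega>) * \<sigma> (Z t \<omega>))"
        unfolding \<Phi>_def using \<sigma>_nonneg[OF \<omega>] by (intro ennreal_leI) (auto split: split_indicator)
      ultimately show "\<Phi> \<omega> \<le> liminf (\<lambda>n. ennreal (exp (- \<theta> * G n \<omega> - V \<omega>) * \<sigma> (Z t \<omega>)))" by simp
    qed
    also have "\<dots> \<le> liminf (\<lambda>n. \<integral>\<^sup>+\<omega>. ennreal (exp (- \<theta> * G n \<omega> - V \<omega>) * \<sigma> (Z t \<omega>)) \<partial>M)"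
      by (rule nn_integral_liminf) measurable
    also have "\<dots> \<le> liminf (\<lambda>n. ennreal (inverse (real (Suc n)) * pi / 2 + \<delta> / \<theta>))"
      by (intro Liminf_mono always_eventually allI est \<theta>)
    also have "\<dots> = ennreal (0 * pi / 2 + \<delta> / \<theta>)"
      by (intro lim_imp_Liminf tendsto_ennrealI tendsto_intros LIMSEQ_inverse_real_of_nat) auto
    finally show ?thesis by simp
  qed
  note bound = this
  have "(\<integral>\<^sup>+\<omega>. \<Phi> \<omega> \<partial>M) \<le> 0"
  proof (rule LIMSEQ_le_const)
    have "(\<lambda>n. ennreal (\<delta> * inverse (real (Suc n)))) \<longlonglongrightarrow> ennreal (\<delta> * 0)"
      by (intro tendsto_ennrealI tendsto_intros LIMSEQ_inverse_real_of_nat)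
    then show "(\<lambda>n. ennreal (\<delta> * inverse (real (Suc n)))) \<longlonglongrightarrow> 0" by simp
    \<comment> \<open>The bound is used with \<open>\<theta> = n + 1\<close>.\<close>
    show "\<exists>N. \<forall>n\<ge>N. (\<integral>\<^sup>+\<omega>. \<Phi> \<omega> \<partial>M) \<le> ennreal (\<delta> * inverse (real (Suc n)))"
      using bound[of "real (Suc n)" for n] by (simp add: divide_inverse)
  qed
  moreover have "\<Phi> \<in> borel_measurable M" unfolding \<Phi>_def by measurable
  ultimately have "AE \<omega> in M. \<Phi> \<omega> = 0" by (simp add: nn_integral_0_iff_AE)
  with AE_space show ?thesis
  proof eventually_elim
    case (elim \<omega>)
    show ?case
    proof
      assume "emeasure lborel {s\<in>{0..t}. Z s \<omega> = 0} = 0"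
      then have "zeros \<omega> = 0" by (rule zeros_eq[OF elim(1)])
      then have "exp (- V \<omega>) * \<sigma> (Z t \<omega>) \<le> 0"
        using elim(2) by (simp add: \<Phi>_def ennreal_eq_0_iff)
      \<comment> \<open>Strict positivity of the auxiliary weight is what allows it to be cancelled;
        the same holds for the exponential in \<open>\<sigma>\<close>.\<close>
      then have "\<sigma> (Z t \<omega>) \<le> 0" by (simp add: mult_le_0_iff)
      then have "Z t \<omega> \<le> 0" by (simp add: \<sigma>_def mult_le_0_iff)
      then show "Z t \<omega> = 0" using Z_nonneg[OF t elim(1)] by simp
    qed
  qed
qed

end

theorem theorem2p4:
  fixes M :: "'a measure" and F :: "real \<Rightarrow> 'a measure"
    and B Z :: "real \<Rightarrow> 'a \<Rightarrow> real" and \<gamma> \<delta> T :: real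
  assumes "0 < \<gamma>" and "\<gamma> < 1/2" and "\<delta> > 0"
    and "filtered_prob_space M F"
    and "standard_brownian_motion M F B"
    and "nonneg_solution M F B \<delta> \<gamma> Z"
    and "AE \<omega> in M. Z 0 \<omega> = 0"
    and "T > 0"
  shows "AE \<omega> in M. emeasure lborel {t \<in> {0..T}. Z t \<omega> = 0} > 0"
proof -
  interpret brownian_filtration M F B
    using assms by (simp add: brownian_filtration_def brownian_filtration_axioms_def)
  \<comment> \<open>Each time has its own exceptional null set; countably many times leave a single
    one.\<close>
  have "AE \<omega> in M. \<forall>q\<in>\<rat> \<inter> {0..}. emeasure lborel {s\<in>{0..q}. Z s \<omega> = 0} = 0 \<longrightarrow> Z q \<omega> = 0"
    using solution_zero_if_no_zeros[OF assms(1-3) _ assms(6)]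
    by (subst AE_ball_countable) (auto intro: countable_Int1 countable_rat)
  with AE_space show ?thesis
  proof eventually_elim
    case (elim \<omega>)
    have cont: "continuous_on {0..} (\<lambda>u. Z u \<omega>)" and nonneg: "\<And>u. 0 \<le> u \<Longrightarrow> 0 \<le> Z u \<omega>"
      using assms(6) elim(1) by (auto simp: nonneg_solution_def)
    have closed: "closed {s\<in>{0..T}. Z s \<omega> = 0}"
      using continuous_closed_preimage_constant[OF continuous_on_subset[OF cont, of "{0..T}"]] by auto
    show ?case
    proof (rule ccontr)
      assume "\<not> 0 < emeasure lborel {s\<in>{0..T}. Z s \<omega> = 0}"
      then have null: "emeasure lborel {s\<in>{0..T}. Z s \<omega> = 0} = 0" by (simp add: zero_less_iff_neq_zero)
      have rat: "Z q \<omega> = 0" if "q \<in> \<rat>" "0 \<le> q" "q \<le> T" for q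
      proof -
        \<comment> \<open>A null zero set on \<open>[0, T]\<close> is null on every shorter
          interval, so the implication fires at all rational times up to \<open>T\<close>.\<close>
        have "emeasure lborel {s\<in>{0..q}. Z s \<omega> = 0} \<le> emeasure lborel {s\<in>{0..T}. Z s \<omega> = 0}"
          using that closed by (intro emeasure_mono) auto
        then show ?thesis using elim(2) that null by auto
      qed
      have "Z s \<omega> = 0" if s: "0 \<le> s" "s < T" for s
      proof (rule ccontr)
        assume "Z s \<omega> \<noteq> 0"
        then have pos: "0 < Z s \<omega>" using nonneg[OF s(1)] by simp
        then obtain d where d: "0 < d" "\<And>x. 0 \<le> x \<Longrightarrow> dist x s < d \<Longrightarrow> dist (Z x \<omega>) (Z s \<omega>) < Z s \<omega>"
          using cont s(1) unfolding continuous_on_iff by (metis atLeast_iff)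
        \<comment> \<open>Approximating from the right keeps \<open>q\<close> nonnegative even for
          \<open>s = 0\<close>; keeping it below \<open>T\<close> is the reason for assuming
          \<open>s < T\<close>.\<close>
        obtain q where q: "q \<in> \<rat>" "s < q" "q < min (s + d) T"
          using Rats_dense_in_real[of s "min (s + d) T"] d(1) s by auto
        then have "Z q \<omega> = 0" using s by (intro rat) auto
        moreover have "dist (Z q \<omega>) (Z s \<omega>) < Z s \<omega>"
          using q s by (intro d(2)) (auto simp: dist_real_def)
        ultimately show False by (simp add: dist_real_def)
      qed
      \<comment> \<open>The contradiction: a path that vanishes on all of \<open>[0, T)\<close> has
        a zero set of measure at least \<open>T > 0\<close>.\<close>
      then have "emeasure lborel {0..<T} \<le> emeasure lborel {s\<in>{0..T}. Z s \<omega> = 0}"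
        using closed by (intro emeasure_mono) auto
      then show False using null assms(8) by simp
    qed
  qed
qed

end
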